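(* Let $n\ge 2$ and $G=SL_n$, let $w_0=s_{i_1}s_{i_2}\cdots s_{i_K}$ be a reduced word for the longest element of the Weyl group, and for $1\le l\le K$ put $u_l=s_{i_1}\cdots s_{i_l}$. Then each of the functions $\Delta_{u_l\omega_{i_l},\omega_{i_l}}$, $1\le l\le K$, lies in a single graded piece $$[V_\lambda\otimes V_\mu\otimes V_\nu]^G\subset\mathcal O(\operatorname{Conf}_3\mathcal A_G)$$ for some dominant weights $\lambda,\mu,\nu$; that is, there are dominant $\lambda,\mu,\nu$ (depending on $l$) and $f\in[V_\lambda\otimes V_\mu\otimes V_\nu]^G$ such that $i^*f=\Delta_{u_l\omega_{i_l},\omega_{i_l}}$ on $B^-$, where $i:B^-\to\operatorname{Conf}_3\mathcal A_G$ is $i(y)=(U^-,\overline{w_0}U^-,y\overline{w_0}U^-)$.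
   Context: Ground field of characteristic $0$. $B^\pm$ are the upper/lower triangular Borel subgroups of $G$, $H=B^+\cap B^-$, $U^\pm=[B^\pm,B^\pm]$. $s_1,\dots,s_{n-1}$ are the simple reflections and $\omega_1,\dots,\omega_{n-1}$ the fundamental weights; $\overline w\in G$ is the standard lift of $w\in W$. $\mathcal A_G=G/U^-$ and $\operatorname{Conf}_3\mathcal A_G=G\backslash(G/U^-)^3$ (diagonal left action). Generalized minors: on $G_0=U^-HU^+$ write $x=[x]_-[x]_0[x]_+$. For $u,v\in W$, $\Delta_{u\omega_i,v\omega_i}(x)=([\overline u^{-1}x\overline v]_0)^{\omega_i}$ (extended as a function on $G$). Here $v=e$ and the function is restricted to $B^-$. Grading: $V_\lambda$ is the irreducible representation of highest weight $\lambda$. The algebra $\mathcal O(\operatorname{Conf}_3\mathcal A_G)$ is graded by triples of dominant weights; the piece denoted $[V_\lambda\otimes V_\mu\otimes V_\nu]^G$ is the space of functions $(g_1U^-,g_2U^-,g_3U^-)\mapsto\Phi(g_1v_\lambda^-,g_2v_\mu^-,g_3v_\nu^-)$ where $v^-$ denotes a lowest weight vector and $\Phi$ is a $G$-invariant trilinear form on $V_\lambda\times V_\mu\times V_\nu$. *)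

theory Defs
  imports
    "HOL-Algebra.Generated_Groups"
    "HOL-Algebra.Left_Coset"
    "HOL-Algebra.Group_Action"
    "HOL-Combinatorics.Permutations"
    "Jordan_Normal_Form.VS_Connect"
begin

section \<open>The group \<open>SL\<^sub>n\<close> and its standard subgroups\<close>

definition SL :: "nat \<Rightarrow> 'k::field_char_0 mat monoid" where
  "SL n = \<lparr>carrier = {A \<in> carrier_mat n n. det A = 1}, mult = (*), one = 1\<^sub>m n\<rparr>"

definition Bplus :: "nat \<Rightarrow> 'k::field_char_0 mat set" where
  "Bplus n = {A \<in> carrier (SL n). \<forall>i<n. \<forall>j<n. j < i \<longrightarrow> A $$ (i, j) = 0}"

definition Bminus :: "nat \<Rightarrow> 'k::field_char_0 mat set" where
  "Bminus n = {A \<in> carrier (SL n). \<forall>i<n. \<forall>j<n. i < j \<longrightarrow> A $$ (i, j) = 0}"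

definition Torus :: "nat \<Rightarrow> 'k::field_char_0 mat set" where
  "Torus n = Bplus n \<inter> Bminus n"

definition Uplus :: "nat \<Rightarrow> 'k::field_char_0 mat set" where
  "Uplus n = derived (SL n) (Bplus n)"

definition Uminus :: "nat \<Rightarrow> 'k::field_char_0 mat set" where
  "Uminus n = derived (SL n) (Bminus n)"


section \<open>Weights\<close>

text \<open>
  The weight lattice of \<open>SL\<^sub>n\<close> is the quotient of \<open>\<int>\<^sup>n\<close> by the line through \<open>(1,\<dots>,1)\<close>. A weight is
  represented by any \<open>a :: nat \<Rightarrow> int\<close> in its class; only \<open>a 0, \<dots>, a (n - 1)\<close> matter. The value
  of its character on the torus does not depend on the representative, because \<open>det h = 1\<close>.
\<close>

definition wt_char :: "nat \<Rightarrow> (nat \<Rightarrow> int) \<Rightarrow> 'k::field_char_0 mat \<Rightarrow> 'k" where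
  "wt_char n a h = (\<Prod>j<n. (h $$ (j, j)) powi (a j))"

definition dominant :: "nat \<Rightarrow> (nat \<Rightarrow> int) \<Rightarrow> bool" where
  "dominant n a \<longleftrightarrow> (\<forall>j. Suc j < n \<longrightarrow> a (Suc j) \<le> a j)"

text \<open>The fundamental weight \<open>\<omega>\<^sub>i\<close>, for \<open>1 \<le> i \<le> n - 1\<close>.\<close>

definition fund_weight :: "nat \<Rightarrow> nat \<Rightarrow> int" where
  "fund_weight i = (\<lambda>j. if j < i then 1 else 0)"


section \<open>The Weyl group\<close>

text \<open>
  The Weyl group is the group of permutations of \<open>{0, \<dots>, n - 1}\<close> (the row and column
  indices), and the simple reflection \<open>s\<^sub>i\<close>, \<open>1 \<le> i \<le> n - 1\<close>, exchanges \<open>i - 1\<close> and \<open>i\<close>.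
\<close>

definition weyl_group :: "nat \<Rightarrow> (nat \<Rightarrow> nat) set" where
  "weyl_group n = {w. w permutes {..<n}}"

definition simple_refl :: "nat \<Rightarrow> nat \<Rightarrow> nat" where
  "simple_refl i = Transposition.transpose (i - 1) i"

definition weyl_word :: "nat list \<Rightarrow> nat \<Rightarrow> nat" where
  "weyl_word ws = foldr (\<lambda>i w. simple_refl i \<circ> w) ws id"

definition weyl_length :: "nat \<Rightarrow> (nat \<Rightarrow> nat) \<Rightarrow> nat" where
  "weyl_length n w =
    (LEAST m. \<exists>ws. set ws \<subseteq> {1..<n} \<and> weyl_word ws = w \<and> length ws = m)"

definition reduced_word :: "nat \<Rightarrow> (nat \<Rightarrow> nat) \<Rightarrow> nat list \<Rightarrow> bool" where
  "reduced_word n w ws \<longleftrightarrow>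
     set ws \<subseteq> {1..<n} \<and> weyl_word ws = w \<and> length ws = weyl_length n w"

definition longest :: "nat \<Rightarrow> nat \<Rightarrow> nat" where
  "longest n = (ARG_MAX (weyl_length n) w. w \<in> weyl_group n)"

text \<open>
  The standard lift of \<open>s\<^sub>i\<close> is the image of the matrix with rows \<open>(0, -1)\<close> and \<open>(1, 0)\<close> under
  the embedding of \<open>SL\<^sub>2\<close> attached to the simple root \<open>\<alpha>\<^sub>i\<close>. The lift of \<open>w\<close> is the product of
  the lifts of the letters of a reduced word of \<open>w\<close>; by the braid relations it does not depend on
  the reduced word chosen.
\<close>

definition simple_lift :: "nat \<Rightarrow> nat \<Rightarrow> 'k::field_char_0 mat" where
  "simple_lift n i = mat n n (\<lambda>(r, c).
     if r = i - 1 \<and> c = i then - 1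
     else if r = i \<and> c = i - 1 then 1
     else if r = c \<and> r \<noteq> i - 1 \<and> r \<noteq> i then 1
     else 0)"

definition word_lift :: "nat \<Rightarrow> nat list \<Rightarrow> 'k::field_char_0 mat" where
  "word_lift n ws = foldr (\<lambda>i A. simple_lift n i * A) ws (1\<^sub>m n)"

definition weyl_lift :: "nat \<Rightarrow> (nat \<Rightarrow> nat) \<Rightarrow> 'k::field_char_0 mat" where
  "weyl_lift n w = word_lift n (SOME ws. reduced_word n w ws)"


section \<open>Regular functions\<close>

text \<open>
  The algebra of functions generated by a set \<open>C\<close> of coordinate functions. As the ground field is
  infinite, the group of rational points of \<open>SL\<^sub>n\<close> is Zariski dense, so regular functions on powers
  of \<open>SL\<^sub>n\<close> can be identified with the functions they induce on rational points.
\<close>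

inductive_set poly_funs :: "('x \<Rightarrow> 'k::field_char_0) set \<Rightarrow> ('x \<Rightarrow> 'k) set"
  for C :: "('x \<Rightarrow> 'k) set"
where
  const: "(\<lambda>_. c) \<in> poly_funs C"
| coord: "f \<in> C \<Longrightarrow> f \<in> poly_funs C"
| add: "f \<in> poly_funs C \<Longrightarrow> g \<in> poly_funs C \<Longrightarrow> (\<lambda>x. f x + g x) \<in> poly_funs C"
| mult: "f \<in> poly_funs C \<Longrightarrow> g \<in> poly_funs C \<Longrightarrow> (\<lambda>x. f x * g x) \<in> poly_funs C"

definition mat_coords :: "nat \<Rightarrow> ('k::field_char_0 mat \<Rightarrow> 'k) set" where
  "mat_coords n = {\<lambda>A. A $$ (i, j) | i j. i < n \<and> j < n}"

definition mat3_coords ::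
    "nat \<Rightarrow> ('k::field_char_0 mat \<times> 'k mat \<times> 'k mat \<Rightarrow> 'k) set" where
  "mat3_coords n =
     {\<lambda>(A, B, C). c A | c. c \<in> mat_coords n} \<union>
     {\<lambda>(A, B, C). c B | c. c \<in> mat_coords n} \<union>
     {\<lambda>(A, B, C). c C | c. c \<in> mat_coords n}"

definition O_SL :: "nat \<Rightarrow> ('k::field_char_0 mat \<Rightarrow> 'k) set" where
  "O_SL n = {f \<in> extensional (carrier (SL n)).
     \<exists>p \<in> poly_funs (mat_coords n). \<forall>g \<in> carrier (SL n). f g = p g}"


section \<open>Generalized minors\<close>

definition gauss_cell :: "nat \<Rightarrow> 'k::field_char_0 mat set" where
  "gauss_cell n = {x. \<exists>a \<in> Uminus n. \<exists>h \<in> Torus n. \<exists>b \<in> Uplus n.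
     x = a \<otimes>\<^bsub>SL n\<^esub> h \<otimes>\<^bsub>SL n\<^esub> b}"

definition torus_part :: "nat \<Rightarrow> 'k::field_char_0 mat \<Rightarrow> 'k mat" where
  "torus_part n x = (THE h. h \<in> Torus n \<and> (\<exists>a \<in> Uminus n. \<exists>b \<in> Uplus n.
     x = a \<otimes>\<^bsub>SL n\<^esub> h \<otimes>\<^bsub>SL n\<^esub> b))"

text \<open>
  \<open>gen_minor n u v i\<close> is \<open>\<Delta>\<^bsub>u\<omega>\<^sub>i,v\<omega>\<^sub>i\<^esub>\<close>: the unique regular function on \<open>SL\<^sub>n\<close> extending the formula
  given by the Gauss decomposition on a translate of the dense open cell.
\<close>

definition gen_minor ::
    "nat \<Rightarrow> (nat \<Rightarrow> nat) \<Rightarrow> (nat \<Rightarrow> nat) \<Rightarrow> nat \<Rightarrow> 'k::field_char_0 mat \<Rightarrow> 'k" where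
  "gen_minor n u v i = (THE f. f \<in> O_SL n \<and>
     (\<forall>x \<in> carrier (SL n).
        let x' = inv\<^bsub>SL n\<^esub> (weyl_lift n u) \<otimes>\<^bsub>SL n\<^esub> x \<otimes>\<^bsub>SL n\<^esub> weyl_lift n v
        in x' \<in> gauss_cell n \<longrightarrow> f x = wt_char n (fund_weight i) (torus_part n x')))"


section \<open>Configurations of three decorated flags\<close>

definition dec_flags :: "nat \<Rightarrow> 'k::field_char_0 mat set set" where
  "dec_flags n = lcosets\<^bsub>SL n\<^esub> (Uminus n)"

definition diag_action :: "nat \<Rightarrow> 'k::field_char_0 mat \<Rightarrow>
    'k mat set \<times> 'k mat set \<times> 'k mat set \<Rightarrow> 'k mat set \<times> 'k mat set \<times> 'k mat set" where
  "diag_action n g = (\<lambda>(a, b, c).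
     (g <#\<^bsub>SL n\<^esub> a, g <#\<^bsub>SL n\<^esub> b, g <#\<^bsub>SL n\<^esub> c))"

definition Conf3 :: "nat \<Rightarrow> ('k::field_char_0 mat set \<times> 'k mat set \<times> 'k mat set) set set" where
  "Conf3 n = orbits (SL n) (dec_flags n \<times> dec_flags n \<times> dec_flags n) (diag_action n)"

text \<open>The class of \<open>(g\<^sub>1U\<^sup>-, g\<^sub>2U\<^sup>-, g\<^sub>3U\<^sup>-)\<close>.\<close>

definition conf3 :: "nat \<Rightarrow> 'k::field_char_0 mat \<Rightarrow> 'k mat \<Rightarrow> 'k mat \<Rightarrow>
    ('k mat set \<times> 'k mat set \<times> 'k mat set) set" where
  "conf3 n g1 g2 g3 = orbit (SL n) (diag_action n)
     (g1 <#\<^bsub>SL n\<^esub> Uminus n, g2 <#\<^bsub>SL n\<^esub> Uminus n, g3 <#\<^bsub>SL n\<^esub> Uminus n)"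

text \<open>
  The regular functions on \<open>Conf3\<close> are the \<open>SL\<^sub>n\<close>-invariant regular functions on the third power of
  \<open>SL\<^sub>n / U\<^sup>-\<close>, and a function on that variety is regular iff its pullback to the third power of
  \<open>SL\<^sub>n\<close> is.
\<close>

definition O_Conf3 ::
    "nat \<Rightarrow> (('k::field_char_0 mat set \<times> 'k mat set \<times> 'k mat set) set \<Rightarrow> 'k) set" where
  "O_Conf3 n = {f \<in> extensional (Conf3 n).
     \<exists>p \<in> poly_funs (mat3_coords n).
       \<forall>g1 \<in> carrier (SL n). \<forall>g2 \<in> carrier (SL n). \<forall>g3 \<in> carrier (SL n).
         f (conf3 n g1 g2 g3) = p (g1, g2, g3)}"

definition Bminus_to_Conf3 :: "nat \<Rightarrow> 'k::field_char_0 mat \<Rightarrow>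
    ('k mat set \<times> 'k mat set \<times> 'k mat set) set" where
  "Bminus_to_Conf3 n y = conf3 n \<one>\<^bsub>SL n\<^esub> (weyl_lift n (longest n))
     (y \<otimes>\<^bsub>SL n\<^esub> weyl_lift n (longest n))"


section \<open>Irreducible representations and the grading\<close>

text \<open>A rational representation of \<open>SL\<^sub>n\<close> of dimension \<open>d\<close>, in coordinates.\<close>

definition rational_rep ::
    "nat \<Rightarrow> nat \<Rightarrow> ('k::field_char_0 mat \<Rightarrow> 'k mat) \<Rightarrow> bool" where
  "rational_rep n d \<rho> \<longleftrightarrow>
     (\<forall>g \<in> carrier (SL n). \<rho> g \<in> carrier_mat d d) \<and>
     \<rho> \<one>\<^bsub>SL n\<^esub> = 1\<^sub>m d \<and>
     (\<forall>g \<in> carrier (SL n). \<forall>h \<in> carrier (SL n). \<rho> (g \<otimes>\<^bsub>SL n\<^esub> h) = \<rho> g * \<rho> h) \<and>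
     (\<forall>i<d. \<forall>j<d. restrict (\<lambda>g. \<rho> g $$ (i, j)) (carrier (SL n)) \<in> O_SL n)"

definition irreducible_rep ::
    "nat \<Rightarrow> nat \<Rightarrow> ('k::field_char_0 mat \<Rightarrow> 'k mat) \<Rightarrow> bool" where
  "irreducible_rep n d \<rho> \<longleftrightarrow> rational_rep n d \<rho> \<and> 0 < d \<and>
     (\<forall>W. VectorSpace.subspace class_ring W (module_vec TYPE('k) d) \<longrightarrow>
          (\<forall>g \<in> carrier (SL n). \<forall>w \<in> W. \<rho> g *\<^sub>v w \<in> W) \<longrightarrow>
          W = {0\<^sub>v d} \<or> W = carrier_vec d)"

definition weight_vector ::
    "nat \<Rightarrow> nat \<Rightarrow> ('k::field_char_0 mat \<Rightarrow> 'k mat) \<Rightarrow> (nat \<Rightarrow> int) \<Rightarrow> 'k vec \<Rightarrow> bool" where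
  "weight_vector n d \<rho> lam v \<longleftrightarrow> v \<in> carrier_vec d \<and> v \<noteq> 0\<^sub>v d \<and>
     (\<forall>h \<in> Torus n. \<rho> h *\<^sub>v v = wt_char n lam h \<cdot>\<^sub>v v)"

definition highest_weight_vector ::
    "nat \<Rightarrow> nat \<Rightarrow> ('k::field_char_0 mat \<Rightarrow> 'k mat) \<Rightarrow> (nat \<Rightarrow> int) \<Rightarrow> 'k vec \<Rightarrow> bool" where
  "highest_weight_vector n d \<rho> lam v \<longleftrightarrow>
     weight_vector n d \<rho> lam v \<and> (\<forall>u \<in> Uplus n. \<rho> u *\<^sub>v v = v)"

definition lowest_weight_vector ::
    "nat \<Rightarrow> nat \<Rightarrow> ('k::field_char_0 mat \<Rightarrow> 'k mat) \<Rightarrow> 'k vec \<Rightarrow> bool" where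
  "lowest_weight_vector n d \<rho> v \<longleftrightarrow>
     (\<exists>mu. weight_vector n d \<rho> mu v) \<and> (\<forall>u \<in> Uminus n. \<rho> u *\<^sub>v v = v)"

text \<open>\<open>\<rho>\<close> is a model of \<open>V\<^sub>\<lambda>\<close>.\<close>

definition is_V :: "nat \<Rightarrow> (nat \<Rightarrow> int) \<Rightarrow> nat \<Rightarrow> ('k::field_char_0 mat \<Rightarrow> 'k mat) \<Rightarrow> bool" where
  "is_V n lam d \<rho> \<longleftrightarrow> irreducible_rep n d \<rho> \<and> (\<exists>v. highest_weight_vector n d \<rho> lam v)"

definition linear_form :: "nat \<Rightarrow> ('k::field_char_0 vec \<Rightarrow> 'k) \<Rightarrow> bool" where
  "linear_form d \<phi> \<longleftrightarrow>
     (\<forall>x \<in> carrier_vec d. \<forall>y \<in> carrier_vec d. \<phi> (x + y) = \<phi> x + \<phi> y) \<and>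
     (\<forall>c. \<forall>x \<in> carrier_vec d. \<phi> (c \<cdot>\<^sub>v x) = c * \<phi> x)"

definition trilinear_form :: "nat \<Rightarrow> nat \<Rightarrow> nat \<Rightarrow>
    ('k::field_char_0 vec \<Rightarrow> 'k vec \<Rightarrow> 'k vec \<Rightarrow> 'k) \<Rightarrow> bool" where
  "trilinear_form d1 d2 d3 \<Phi> \<longleftrightarrow>
     (\<forall>y \<in> carrier_vec d2. \<forall>z \<in> carrier_vec d3. linear_form d1 (\<lambda>x. \<Phi> x y z)) \<and>
     (\<forall>x \<in> carrier_vec d1. \<forall>z \<in> carrier_vec d3. linear_form d2 (\<lambda>y. \<Phi> x y z)) \<and>
     (\<forall>x \<in> carrier_vec d1. \<forall>y \<in> carrier_vec d2. linear_form d3 (\<lambda>z. \<Phi> x y z))"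

text \<open>
  The piece \<open>[V\<^sub>\<lambda> \<otimes> V\<^sub>\<mu> \<otimes> V\<^sub>\<nu>]\<^sup>G\<close> for dominant \<open>\<lambda>, \<mu>, \<nu>\<close>. The representations \<open>V\<^sub>\<lambda>, V\<^sub>\<mu>, V\<^sub>\<nu>\<close> are
  unique up to isomorphism and their lowest weight vectors are unique up to scalars, so the set
  does not depend on the models and vectors used to describe its elements.
\<close>

definition graded_piece :: "nat \<Rightarrow> (nat \<Rightarrow> int) \<Rightarrow> (nat \<Rightarrow> int) \<Rightarrow> (nat \<Rightarrow> int) \<Rightarrow>
    (('k::field_char_0 mat set \<times> 'k mat set \<times> 'k mat set) set \<Rightarrow> 'k) set" where
  "graded_piece n lam mu nu = {f \<in> O_Conf3 n.
     \<exists>d1 d2 d3 \<rho>1 \<rho>2 \<rho>3 v1 v2 v3 \<Phi>.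
       is_V n lam d1 \<rho>1 \<and> lowest_weight_vector n d1 \<rho>1 v1 \<and>
       is_V n mu d2 \<rho>2 \<and> lowest_weight_vector n d2 \<rho>2 v2 \<and>
       is_V n nu d3 \<rho>3 \<and> lowest_weight_vector n d3 \<rho>3 v3 \<and>
       trilinear_form d1 d2 d3 \<Phi> \<and>
       (\<forall>g \<in> carrier (SL n). \<forall>x \<in> carrier_vec d1. \<forall>y \<in> carrier_vec d2. \<forall>z \<in> carrier_vec d3.
          \<Phi> (\<rho>1 g *\<^sub>v x) (\<rho>2 g *\<^sub>v y) (\<rho>3 g *\<^sub>v z) = \<Phi> x y z) \<and>
       (\<forall>g1 \<in> carrier (SL n). \<forall>g2 \<in> carrier (SL n). \<forall>g3 \<in> carrier (SL n).
          f (conf3 n g1 g2 g3) = \<Phi> (\<rho>1 g1 *\<^sub>v v1) (\<rho>2 g2 *\<^sub>v v2) (\<rho>3 g3 *\<^sub>v v3))}"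

end

theory Submission
  imports Defs
begin

text \<open>
  Write \<open>J = u {0, \<dots>, i - 1}\<close> for \<open>u = u\<^sub>l\<close> and \<open>i = i\<^sub>l\<close>. Up to sign, \<open>\<Delta>\<^bsub>u\<omega>\<^sub>i,\<omega>\<^sub>i\<^esub>\<close> is the minor of
  \<open>y\<close> with rows \<open>u 0, \<dots>, u (i - 1)\<close> and columns \<open>0, \<dots>, i - 1\<close> (\<open>gen_minor_eq_minor\<close>). In the
  configuration \<open>i(y)\<close> the first two flags are opposite coordinate flags, and for each \<open>j\<close> the
  determinant \<open>D\<^sub>j(x)\<close> of \<open>j\<close> vectors of the second flag, a vector \<open>x\<close> and \<open>n - 1 - j\<close> vectors of the
  first flag is, up to sign, the \<open>j\<close>-th coordinate of \<open>x\<close>. Hence the minor is the determinant of the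
  \<open>i \<times> i\<close> matrix of the \<open>D\<^sub>j(x\<^sub>s)\<close>, where \<open>j\<close> runs through \<open>J\<close> and the \<open>x\<^sub>s\<close> are the \<open>i\<close> vectors
  spanning the \<open>i\<close>-dimensional member of the third flag (\<open>triple_det_value\<close>). As a function on
  \<open>G\<^sup>3\<close> this determinant is invariant, and in each of the three arguments it is linear in the image
  of a highest weight vector, of weight \<open>\<Sum>\<^bsub>j \<in> J\<^esub> \<omega>\<^bsub>n-1-j\<^esub>\<close>, \<open>\<Sum>\<^bsub>j \<in> J\<^esub> \<omega>\<^sub>j\<close> and \<open>\<omega>\<^sub>i\<close>, in a tensor
  product of exterior powers (\<open>triple_det_orbit1\<close>, \<open>triple_det_orbit2\<close>, \<open>triple_det_orbit3\<close>). So it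
  comes from an invariant trilinear form on the submodules generated by these vectors
  (\<open>graded_piece_realization\<close>).

  These submodules are irreducible (locale \<open>orbit_module\<close>). The standard symmetric form on the
  tensor product satisfies \<open>\<langle>g x, y\<rangle> = \<langle>x, g\<^sup>T y\<rangle>\<close>, and it is nondegenerate on the submodule: this has
  a basis of rational vectors, as the rational points of \<open>SL\<^sub>n\<close> are dense, and the form is positive
  definite over \<open>\<rat>\<close>. Thus a nonzero vector \<open>x\<close> of an invariant subspace \<open>W\<close> pairs nontrivially with some
  \<open>g v\<close>, where \<open>v\<close> is the highest weight vector, and \<open>g\<^sup>T x \<in> W\<close> has a nonzero component along \<open>v\<close>.
  Since the highest weight space is one-dimensional, a polynomial in a regular torus element
  projects \<open>g\<^sup>T x\<close> to a nonzero multiple of \<open>v\<close>, whence \<open>v \<in> W\<close>.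

  The formula for the generalized minors needs the big cell: the matrices with nonzero leading
  principal minors have a Gauss decomposition whose unipotent factors lie in the derived groups of
  the Borel subgroups (\<open>gauss_cellI\<close>), and they are dense (\<open>SL_dense_nonvanishing\<close>).
\<close>

section \<open>The group \<open>SL\<^sub>n\<close> and its triangular subgroups\<close>

lemma SL_iff: "A \<in> carrier (SL n) \<longleftrightarrow> A \<in> carrier_mat n n \<and> det A = 1"
  by (simp add: SL_def)

lemma SL_carrier_mat: "A \<in> carrier (SL n) \<Longrightarrow> A \<in> carrier_mat n n"
  by (simp add: SL_def)

lemma SL_mult [simp]: "A \<otimes>\<^bsub>SL n\<^esub> B = A * B"
  by (simp add: SL_def)

lemma SL_one [simp]: "\<one>\<^bsub>SL n\<^esub> = 1\<^sub>m n"
  by (simp add: SL_def)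

lemma SL_mult_closed: "A \<in> carrier (SL n) \<Longrightarrow> B \<in> carrier (SL n) \<Longrightarrow> A * B \<in> carrier (SL n)"
  by (auto simp: SL_iff det_mult[of _ n])

lemma SL_one_closed: "1\<^sub>m n \<in> carrier (SL n)"
  by (simp add: SL_iff)

lemma SL_transpose: "A \<in> carrier (SL n) \<Longrightarrow> A\<^sup>T \<in> carrier (SL n)"
  by (auto simp: SL_iff det_transpose[of _ n])

lemma group_SL: "group (SL n :: 'k::field_char_0 mat monoid)"
proof (rule groupI, unfold SL_mult SL_one)
  fix A :: "'k mat" assume A: "A \<in> carrier (SL n)"
  note adj = adj_mat[OF SL_carrier_mat[OF A]]
  have d: "det A = 1" using A by (simp add: SL_iff)
  have *: "adj_mat A * A = 1\<^sub>m n" using adj(3) d by (auto intro!: eq_matI)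
  have "det (adj_mat A) * det A = det (1\<^sub>m n :: 'k mat)"
    using det_mult[OF adj(1) SL_carrier_mat[OF A]] * by simp
  then show "\<exists>B\<in>carrier (SL n). B * A = 1\<^sub>m n"
    using * adj(1) d by (intro bexI[of _ "adj_mat A"]) (auto simp: SL_iff)
qed (auto simp: SL_iff det_mult[of _ n] assoc_mult_mat[of _ n n _ n _ n])

lemma SL_inv_closed: "A \<in> carrier (SL n) \<Longrightarrow> inv\<^bsub>SL n\<^esub> A \<in> carrier (SL n)"
  using group.inv_closed[OF group_SL] by blast

lemma SL_inv_l: "A \<in> carrier (SL n) \<Longrightarrow> inv\<^bsub>SL n\<^esub> A * A = 1\<^sub>m n"
  using group.l_inv[OF group_SL, of A n] by simp

lemma SL_inv_r: "A \<in> carrier (SL n) \<Longrightarrow> A * inv\<^bsub>SL n\<^esub> A = 1\<^sub>m n"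
  using group.r_inv[OF group_SL, of A n] by simp

lemma SL_inv_eqI:
  assumes "A \<in> carrier (SL n)" "B \<in> carrier (SL n)" "A * B = 1\<^sub>m n"
  shows "inv\<^bsub>SL n\<^esub> A = B"
proof -
  have "inv\<^bsub>SL n\<^esub> B = A"
    using group.inv_equality[OF group_SL _ assms(2,1)] assms(3) by simp
  then show ?thesis using group.inv_inv[OF group_SL assms(2)] by simp
qed

lemma SL_inv_transpose:
  assumes A: "A \<in> carrier (SL n)"
  shows "inv\<^bsub>SL n\<^esub> (A\<^sup>T) = (inv\<^bsub>SL n\<^esub> A)\<^sup>T"
proof (rule SL_inv_eqI[OF SL_transpose[OF A] SL_transpose[OF SL_inv_closed[OF A]]])
  have "A\<^sup>T * (inv\<^bsub>SL n\<^esub> A)\<^sup>T = (inv\<^bsub>SL n\<^esub> A * A)\<^sup>T"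
    using SL_carrier_mat[OF A] SL_carrier_mat[OF SL_inv_closed[OF A]] by (simp add: transpose_mult)
  then show "A\<^sup>T * (inv\<^bsub>SL n\<^esub> A)\<^sup>T = 1\<^sub>m n" using SL_inv_l[OF A] by simp
qed

lemma SL_assoc:
  assumes "A \<in> carrier (SL n)" "B \<in> carrier (SL n)" "C \<in> carrier (SL n)"
  shows "A * B * C = A * (B * C)"
  using assms by (auto simp: SL_iff assoc_mult_mat[of _ n n _ n _ n])

lemma SL_inv_cancel:
  assumes "A \<in> carrier (SL n)" "B \<in> carrier (SL n)"
  shows "A * (inv\<^bsub>SL n\<^esub> A * B) = B" "inv\<^bsub>SL n\<^esub> A * (A * B) = B"
    "B * A * inv\<^bsub>SL n\<^esub> A = B" "B * inv\<^bsub>SL n\<^esub> A * A = B"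
proof -
  have c: "A \<in> carrier_mat n n" "B \<in> carrier_mat n n" "inv\<^bsub>SL n\<^esub> A \<in> carrier_mat n n"
    using assms SL_inv_closed SL_carrier_mat by blast+
  note i = SL_inv_l[OF assms(1)] SL_inv_r[OF assms(1)]
  show "A * (inv\<^bsub>SL n\<^esub> A * B) = B"
    using c i(2) assoc_mult_mat[OF c(1,3,2)] by simp
  show "inv\<^bsub>SL n\<^esub> A * (A * B) = B"
    using c i(1) assoc_mult_mat[OF c(3,1,2)] by simp
  show "B * A * inv\<^bsub>SL n\<^esub> A = B"
    using c i(2) assoc_mult_mat[OF c(2,1,3)] by simp
  show "B * inv\<^bsub>SL n\<^esub> A * A = B"
    using c i(1) assoc_mult_mat[OF c(2,3,1)] by simp
qed

lemma mat_mult_entry: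
  assumes "A \<in> carrier_mat m n" "B \<in> carrier_mat n p" "i < m" "j < p"
  shows "(A * B) $$ (i, j) = (\<Sum>c<n. A $$ (i, c) * B $$ (c, j))"
  using assms by (auto simp: scalar_prod_def atLeast0LessThan intro!: sum.cong)

lemma mult_lower_entry:
  assumes A: "A \<in> carrier_mat n n" "\<And>i j. i < j \<Longrightarrow> j < n \<Longrightarrow> A $$ (i, j) = 0"
    and B: "B \<in> carrier_mat n n" "\<And>i j. i < j \<Longrightarrow> j < n \<Longrightarrow> B $$ (i, j) = 0"
    and ij: "i \<le> j" "j < n"
  shows "(A * B) $$ (i, j) = (if i = j then A $$ (i, i) * B $$ (i, i) else 0)"
proof -
  have "(A * B) $$ (i, j) = (\<Sum>c<n. A $$ (i, c) * B $$ (c, j))"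
    using A B ij by (intro mat_mult_entry[of _ n n _ n]) auto
  also have "\<dots> = (\<Sum>c<n. if c = i then (if i = j then A $$ (i, i) * B $$ (i, i) else 0) else 0)"
  proof (intro sum.cong refl)
    fix c assume c: "c \<in> {..<n}"
    consider "c = i" | "i < c" | "c < i" by linarith
    then show "A $$ (i, c) * B $$ (c, j) =
        (if c = i then if i = j then A $$ (i, i) * B $$ (i, i) else 0 else 0)"
      by cases (use A(2)[of i c] B(2)[of c j] B(2)[of i j] ij c in auto)
  qed
  finally show ?thesis using ij by simp
qed

lemma inverse_lower:
  fixes A :: "'a::field mat"
  assumes A: "A \<in> carrier_mat n n" "\<And>i j. i < j \<Longrightarrow> j < n \<Longrightarrow> A $$ (i, j) = 0"
    and B: "B \<in> carrier_mat n n" and AB: "A * B = 1\<^sub>m n"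
    and d: "det A \<noteq> 0" and ij: "i < j" "j < n"
  shows "B $$ (i, j) = 0"
  using ij(1)
proof (induction i rule: less_induct)
  case (less i)
  have "det A = (\<Prod>i = 0..<n. A $$ (i, i))"
    using det_lower_triangular[of n A] A by (simp add: prod_list_diag_prod)
  then have ii: "A $$ (i, i) \<noteq> 0" using d less.prems ij by auto
  have "0 = (A * B) $$ (i, j)" using AB less.prems ij by simp
  also have "\<dots> = (\<Sum>c<n. A $$ (i, c) * B $$ (c, j))"
    using A B ij less.prems by (intro mat_mult_entry[of _ n n _ n]) auto
  also have "\<dots> = (\<Sum>c<n. if c = i then A $$ (i, i) * B $$ (i, j) else 0)"
  proof (intro sum.cong refl)
    fix c assume c: "c \<in> {..<n}"
    consider "c = i" | "i < c" | "c < i" by linarith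
    then show "A $$ (i, c) * B $$ (c, j) = (if c = i then A $$ (i, i) * B $$ (i, j) else 0)"
      by cases (use A(2)[of i c] less.IH[of c] less.prems ij c in auto)
  qed
  finally show ?case using ii less.prems ij by simp
qed

lemma Bminus_SL: "A \<in> Bminus n \<Longrightarrow> A \<in> carrier (SL n)"
  by (simp add: Bminus_def)

lemma Bminus_lower: "A \<in> Bminus n \<Longrightarrow> i < j \<Longrightarrow> j < n \<Longrightarrow> A $$ (i, j) = 0"
  by (simp add: Bminus_def)

lemma Bminus_mult_diag:
  assumes "A \<in> Bminus n" "B \<in> Bminus n" "i < n"
  shows "(A * B) $$ (i, i) = A $$ (i, i) * B $$ (i, i)"
  using mult_lower_entry[OF SL_carrier_mat[OF Bminus_SL[OF assms(1)]] Bminus_lower[OF assms(1)]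
      SL_carrier_mat[OF Bminus_SL[OF assms(2)]] Bminus_lower[OF assms(2)], of i i] assms(3)
  by simp

lemma subgroup_Bminus: "subgroup (Bminus n) (SL n :: 'k::field_char_0 mat monoid)"
proof (rule group.subgroupI[OF group_SL])
  show "Bminus n \<subseteq> (carrier (SL n) :: 'k mat set)" by (auto simp: Bminus_SL)
  show "Bminus n \<noteq> ({} :: 'k mat set)"
    using SL_one_closed[of n] by (auto simp: Bminus_def intro!: exI[of _ "1\<^sub>m n"])
next
  fix A :: "'k mat" assume A: "A \<in> Bminus n"
  note c = SL_carrier_mat[OF Bminus_SL[OF A]]
  have d: "det A \<noteq> 0" using Bminus_SL[OF A] by (simp add: SL_iff)
  show "inv\<^bsub>SL n\<^esub> A \<in> Bminus n"
    using inverse_lower[OF c Bminus_lower[OF A] SL_carrier_mat SL_inv_r d]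
      SL_inv_closed Bminus_SL[OF A] by (auto simp: Bminus_def)
next
  fix A B :: "'k mat" assume A: "A \<in> Bminus n" and B: "B \<in> Bminus n"
  show "A \<otimes>\<^bsub>SL n\<^esub> B \<in> Bminus n"
    using SL_mult_closed[OF Bminus_SL[OF A] Bminus_SL[OF B]]
      mult_lower_entry[OF SL_carrier_mat[OF Bminus_SL[OF A]] Bminus_lower[OF A]
        SL_carrier_mat[OF Bminus_SL[OF B]] Bminus_lower[OF B]]
    by (auto simp: Bminus_def)
qed

lemma Bminus_inv_diag:
  assumes A: "A \<in> Bminus n" and i: "i < n"
  shows "A $$ (i, i) * (inv\<^bsub>SL n\<^esub> A) $$ (i, i) = 1"
  using Bminus_mult_diag[OF A subgroup.m_inv_closed[OF subgroup_Bminus A] i]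
    SL_inv_r[OF Bminus_SL[OF A]] i by simp

text \<open>The lower unipotent matrices. They form the derived group of the lower Borel subgroup; only one
  inclusion is immediate.\<close>

definition lower_unip :: "nat \<Rightarrow> 'k::field_char_0 mat set" where
  "lower_unip n = {A \<in> Bminus n. \<forall>i<n. A $$ (i, i) = 1}"

lemma subgroup_lower_unip: "subgroup (lower_unip n) (SL n :: 'k::field_char_0 mat monoid)"
proof (rule group.subgroupI[OF group_SL])
  show "lower_unip n \<subseteq> (carrier (SL n) :: 'k mat set)" by (auto simp: lower_unip_def Bminus_SL)
  show "lower_unip n \<noteq> ({} :: 'k mat set)"
    using SL_one_closed[of n] by (auto simp: lower_unip_def Bminus_def intro!: exI[of _ "1\<^sub>m n"])
next
  fix A :: "'k mat" assume A: "A \<in> lower_unip n"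
  then show "inv\<^bsub>SL n\<^esub> A \<in> lower_unip n"
    using subgroup.m_inv_closed[OF subgroup_Bminus, of A n] Bminus_inv_diag[of A n]
    by (auto simp: lower_unip_def)
next
  fix A B :: "'k mat" assume A: "A \<in> lower_unip n" and B: "B \<in> lower_unip n"
  then show "A \<otimes>\<^bsub>SL n\<^esub> B \<in> lower_unip n"
    using subgroup.m_closed[OF subgroup_Bminus, of A n B] Bminus_mult_diag[of A n B]
    by (auto simp: lower_unip_def)
qed

lemma Uminus_subset_lower_unip: "Uminus n \<subseteq> (lower_unip n :: 'k::field_char_0 mat set)"
  unfolding Uminus_def derived_def
proof (rule group.generate_subgroup_incl[OF group_SL _ subgroup_lower_unip], safe)
  fix A B :: "'k mat" assume A: "A \<in> Bminus n" and B: "B \<in> Bminus n"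
  note sg = subgroup_Bminus
  note iA = subgroup.m_inv_closed[OF sg A] and iB = subgroup.m_inv_closed[OF sg B]
  note AB = subgroup.m_closed[OF sg A B]
  note ABA = subgroup.m_closed[OF sg AB iA]
  note 1 = subgroup.m_closed[OF sg ABA iB]
  have "(A * B * inv\<^bsub>SL n\<^esub> A * inv\<^bsub>SL n\<^esub> B) $$ (i, i) = 1" if i: "i < n" for i
  proof -
    let ?a = "A $$ (i, i)" and ?b = "B $$ (i, i)"
    let ?a' = "(inv\<^bsub>SL n\<^esub> A) $$ (i, i)" and ?b' = "(inv\<^bsub>SL n\<^esub> B) $$ (i, i)"
    have "(A * B * inv\<^bsub>SL n\<^esub> A * inv\<^bsub>SL n\<^esub> B) $$ (i, i) = ?a * ?b * ?a' * ?b'"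
      using Bminus_mult_diag[OF ABA[unfolded SL_mult] iB i]
        Bminus_mult_diag[OF AB[unfolded SL_mult] iA i] Bminus_mult_diag[OF A B i]
      by (simp only:)
    also have "\<dots> = (?a * ?a') * (?b * ?b')" by (simp only: ac_simps)
    finally show ?thesis by (simp only: Bminus_inv_diag[OF A i] Bminus_inv_diag[OF B i] mult_1)
  qed
  then show "A \<otimes>\<^bsub>SL n\<^esub> B \<otimes>\<^bsub>SL n\<^esub> inv\<^bsub>SL n\<^esub> A \<otimes>\<^bsub>SL n\<^esub> inv\<^bsub>SL n\<^esub> B \<in> lower_unip n"
    using 1 by (simp only: lower_unip_def SL_mult mem_Collect_eq) blast
qed

lemma subgroup_Uminus: "subgroup (Uminus n) (SL n)"
  unfolding Uminus_def by (rule group.derived_is_subgroup[OF group_SL]) (auto simp: Bminus_SL)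

lemma Uminus_SL: "u \<in> Uminus n \<Longrightarrow> u \<in> carrier (SL n)"
  using subgroup.subset[OF subgroup_Uminus] by blast

text \<open>Transposition is an anti-automorphism, so it maps generated subgroups to generated subgroups and
  exchanges the derived groups of the two Borel subgroups.\<close>

lemma generate_transpose:
  fixes u :: "'k::field_char_0 mat"
  assumes "u \<in> generate (SL n) X" and X: "\<And>h. h \<in> X \<Longrightarrow> h\<^sup>T \<in> Y \<and> h \<in> carrier (SL n)"
  shows "u\<^sup>T \<in> generate (SL n) Y \<and> u \<in> carrier (SL n)"
  using assms(1)
proof (induction rule: generate.induct)
  case one
  then show ?case using generate.one[of "SL n :: 'k mat monoid" Y] SL_one_closed by simp
next
  case (incl h)
  then show ?case using X[OF incl] generate.incl[of "h\<^sup>T" Y] by simp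
next
  case (inv h)
  have "inv\<^bsub>SL n\<^esub> (h\<^sup>T) \<in> generate (SL n) Y" using X[OF inv] generate.inv[of "h\<^sup>T" Y] by simp
  then show ?case using X[OF inv] by (simp add: SL_inv_transpose SL_inv_closed)
next
  case (eng h1 h2)
  then have "(h1 * h2)\<^sup>T = h2\<^sup>T * h1\<^sup>T"
    by (intro transpose_mult[of _ n n _ n]) (auto simp: SL_carrier_mat)
  then show ?case
    using eng(3,4) generate.eng[of "h2\<^sup>T" "SL n" Y "h1\<^sup>T"] SL_mult_closed[of h1 n h2] by simp
qed

lemma Uplus_transpose:
  fixes u :: "'k::field_char_0 mat"
  shows "u \<in> Uplus n \<Longrightarrow> u\<^sup>T \<in> Uminus n" "u \<in> Uminus n \<Longrightarrow> u\<^sup>T \<in> Uplus n"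
proof -
  have gen: "u\<^sup>T \<in> derived (SL n) H'"
    if u: "u \<in> derived (SL n) H" and H: "H \<subseteq> carrier (SL n)"
      and H': "\<And>x. x \<in> H \<Longrightarrow> x\<^sup>T \<in> H'" and inv': "\<And>x. x \<in> H \<Longrightarrow> inv\<^bsub>SL n\<^esub> x \<in> H"
    for u :: "'k mat" and H H'
  proof -
    let ?D = "\<lambda>H. derived_set (SL n) H :: 'k mat set"
    have D: "h\<^sup>T \<in> ?D H' \<and> h \<in> carrier (SL n)" if "h \<in> ?D H" for h
    proof -
      from that obtain x y where xy: "x \<in> H" "y \<in> H" and
        h: "h = x * y * inv\<^bsub>SL n\<^esub> x * inv\<^bsub>SL n\<^esub> y" by auto
      let ?x = "inv\<^bsub>SL n\<^esub> x" and ?y = "inv\<^bsub>SL n\<^esub> y"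
      have c: "x \<in> carrier (SL n)" "y \<in> carrier (SL n)"
        "?x \<in> carrier (SL n)" "?y \<in> carrier (SL n)"
        using xy H SL_inv_closed by blast+
      have cm: "x \<in> carrier_mat n n" "y \<in> carrier_mat n n" "?x \<in> carrier_mat n n"
        "?y \<in> carrier_mat n n" using c SL_carrier_mat by blast+
      have ii: "inv\<^bsub>SL n\<^esub> ?x = x" "inv\<^bsub>SL n\<^esub> ?y = y"
        using c(1,2) group.inv_inv[OF group_SL] by blast+
      have "h\<^sup>T = ?y\<^sup>T * (?x\<^sup>T * (y\<^sup>T * x\<^sup>T))"
        using cm by (simp add: h transpose_mult[of _ n n _ n])
      also have "\<dots> = ?y\<^sup>T * ?x\<^sup>T * y\<^sup>T * x\<^sup>T"
        using cm by (simp add: assoc_mult_mat[of _ n n _ n _ n])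
      also have "\<dots> = ?y\<^sup>T * ?x\<^sup>T * inv\<^bsub>SL n\<^esub> (?y\<^sup>T) * inv\<^bsub>SL n\<^esub> (?x\<^sup>T)"
        using SL_inv_transpose[OF c(3)] SL_inv_transpose[OF c(4)] ii by simp
      finally have "h\<^sup>T = ?y\<^sup>T * ?x\<^sup>T * inv\<^bsub>SL n\<^esub> (?y\<^sup>T) * inv\<^bsub>SL n\<^esub> (?x\<^sup>T)" .
      then have "h\<^sup>T \<in> ?D H'" using H'[OF inv'[OF xy(1)]] H'[OF inv'[OF xy(2)]] by auto
      moreover have "h \<in> carrier (SL n)" unfolding h using c by (intro SL_mult_closed)
      ultimately show ?thesis by blast
    qed
    show ?thesis
      using generate_transpose[OF u[unfolded derived_def] D] unfolding derived_def by blast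
  qed
  have B: "x\<^sup>T \<in> Bminus n" if "x \<in> Bplus n" for x :: "'k mat"
    using that by (auto simp: Bplus_def Bminus_def SL_iff det_transpose[of _ n])
  have B': "x\<^sup>T \<in> Bplus n" if "x \<in> Bminus n" for x :: "'k mat"
    using that by (auto simp: Bplus_def Bminus_def SL_iff det_transpose[of _ n])
  have inv': "inv\<^bsub>SL n\<^esub> x \<in> Bplus n" if x: "x \<in> Bplus n" for x :: "'k mat"
  proof -
    have c: "x \<in> carrier (SL n)" using x by (simp add: Bplus_def)
    have "inv\<^bsub>SL n\<^esub> (x\<^sup>T) \<in> Bminus n"
      using subgroup.m_inv_closed[OF subgroup_Bminus B[OF x]] .
    then have "(inv\<^bsub>SL n\<^esub> x)\<^sup>T \<in> Bminus n" using SL_inv_transpose[OF c] by simp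
    from B'[OF this] show ?thesis by simp
  qed
  show "u \<in> Uplus n \<Longrightarrow> u\<^sup>T \<in> Uminus n"
    unfolding Uplus_def Uminus_def by (rule gen[OF _ _ B inv']) (auto simp: Bplus_def)
  show "u \<in> Uminus n \<Longrightarrow> u\<^sup>T \<in> Uplus n"
    unfolding Uplus_def Uminus_def
    by (rule gen) (auto simp: Bminus_SL intro: B' subgroup.m_inv_closed[OF subgroup_Bminus])
qed

lemma Uminus_entry:
  assumes "u \<in> Uminus n"
  shows "i < j \<Longrightarrow> j < n \<Longrightarrow> u $$ (i, j) = 0" "i < n \<Longrightarrow> u $$ (i, i) = 1"
  using assms Uminus_subset_lower_unip[of n] Bminus_lower[of u n] by (auto simp: lower_unip_def)

lemma Uplus_SL: "u \<in> Uplus n \<Longrightarrow> u \<in> carrier (SL n)"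
  using SL_transpose[OF Uminus_SL[OF Uplus_transpose(1)]] by simp

lemma Uplus_entry:
  assumes u: "u \<in> Uplus n"
  shows "j < i \<Longrightarrow> i < n \<Longrightarrow> u $$ (i, j) = 0" "i < n \<Longrightarrow> u $$ (i, i) = 1"
  using Uminus_entry[OF Uplus_transpose(1)[OF u]] SL_carrier_mat[OF Uplus_SL[OF u]] by auto

lemma Torus_entry:
  assumes "h \<in> Torus n" "i < n" "j < n" "i \<noteq> j"
  shows "h $$ (i, j) = 0"
  using assms by (auto simp: Torus_def Bplus_def Bminus_def) (meson linorder_neqE_nat)

lemma Torus_SL: "h \<in> Torus n \<Longrightarrow> h \<in> carrier (SL n)"
  by (simp add: Torus_def Bminus_SL)

lemma Torus_diag_nonzero:
  assumes h: "h \<in> Torus n" and i: "i < n"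
  shows "h $$ (i, i) \<noteq> 0"
  using Bminus_inv_diag[of h n i] h i by (auto simp: Torus_def)

section \<open>Leading principal minors\<close>

text \<open>The leading principal submatrix of size \<open>k\<close>.\<close>

definition lead :: "nat \<Rightarrow> 'k::comm_ring_1 mat \<Rightarrow> 'k mat" where
  "lead k A = mat k k (\<lambda>(p, q). A $$ (p, q))"

lemma lead_carrier [simp]: "lead k A \<in> carrier_mat k k"
  by (simp add: lead_def)

lemma lead_entry [simp]: "i < k \<Longrightarrow> j < k \<Longrightarrow> lead k A $$ (i, j) = A $$ (i, j)"
  by (simp add: lead_def)

lemma lead_mult_upper:
  assumes "A \<in> carrier_mat n n" "B \<in> carrier_mat n n" "k \<le> n"
    and "\<And>i j. j < i \<Longrightarrow> i < n \<Longrightarrow> B $$ (i, j) = 0"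
  shows "lead k (A * B) = lead k A * lead k B"
proof (rule eq_matI)
  fix i j assume "i < dim_row (lead k A * lead k B)" "j < dim_col (lead k A * lead k B)"
  then have ij: "i < k" "j < k" by (auto simp: lead_def)
  have "(\<Sum>c<n. A $$ (i, c) * B $$ (c, j)) = (\<Sum>c<k. A $$ (i, c) * B $$ (c, j))"
    using assms ij by (intro sum.mono_neutral_right) auto
  then show "lead k (A * B) $$ (i, j) = (lead k A * lead k B) $$ (i, j)"
    using ij assms
    by (simp add: mat_mult_entry[of A n n B n] mat_mult_entry[of _ k k _ k] del: index_mult_mat(1))
qed (auto simp: lead_def)

lemma det_lead_mult_upper:
  assumes "A \<in> carrier_mat n n" "B \<in> carrier_mat n n" "k \<le> n"
    and "\<And>i j. j < i \<Longrightarrow> i < n \<Longrightarrow> B $$ (i, j) = 0"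
  shows "det (lead k (A * B)) = det (lead k A) * (\<Prod>j<k. B $$ (j, j))"
proof -
  have "upper_triangular (lead k B)"
    using assms by (auto simp: lead_def)
  then have "det (lead k B) = (\<Prod>j<k. B $$ (j, j))"
    by (subst det_upper_triangular[of _ k]) (auto simp: prod_list_diag_prod lead_def atLeast0LessThan)
  then show ?thesis
    by (subst lead_mult_upper[of A n B k, OF assms]) (auto simp: det_mult[of _ k])
qed

lemma lead_transpose: "k \<le> n \<Longrightarrow> A \<in> carrier_mat n n \<Longrightarrow> lead k (A\<^sup>T) = (lead k A)\<^sup>T"
  by (rule eq_matI) (auto simp: lead_def)

lemma det_lead_mult_lower:
  assumes "A \<in> carrier_mat n n" "B \<in> carrier_mat n n" "k \<le> n"
    and "\<And>i j. i < j \<Longrightarrow> j < n \<Longrightarrow> A $$ (i, j) = 0"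
  shows "det (lead k (A * B)) = (\<Prod>j<k. A $$ (j, j)) * det (lead k B)"
proof -
  have "det (lead k (A * B)) = det (lead k (B\<^sup>T * A\<^sup>T))"
    using assms by (simp add: transpose_mult[symmetric, of A n n B n] lead_transpose[of _ n]
        det_transpose[of _ k])
  also have "\<dots> = det (lead k (B\<^sup>T)) * (\<Prod>j<k. A\<^sup>T $$ (j, j))"
    using assms by (intro det_lead_mult_upper) auto
  also have "(\<Prod>j<k. A\<^sup>T $$ (j, j)) = (\<Prod>j<k. A $$ (j, j))"
    using assms by (intro prod.cong) auto
  finally show ?thesis using assms by (simp add: lead_transpose[of _ n] det_transpose[of _ k])
qed

lemma det_lead_gauss:
  assumes a: "a \<in> Uminus n" and h: "h \<in> Torus n" and b: "b \<in> Uplus n" and k: "k \<le> n"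
  shows "det (lead k (a * h * b)) = (\<Prod>j<k. h $$ (j, j))"
proof -
  have c: "a \<in> carrier_mat n n" "h \<in> carrier_mat n n" "b \<in> carrier_mat n n"
    using SL_carrier_mat[OF Uminus_SL[OF a]] SL_carrier_mat[OF Torus_SL[OF h]]
      SL_carrier_mat[OF Uplus_SL[OF b]] by auto
  have "det (lead k (a * h * b)) = det (lead k (a * h)) * (\<Prod>j<k. b $$ (j, j))"
    using c k Uplus_entry[OF b] by (intro det_lead_mult_upper) auto
  also have "det (lead k (a * h)) = det (lead k a) * (\<Prod>j<k. h $$ (j, j))"
    using c k Torus_entry[OF h] by (intro det_lead_mult_upper) auto
  also have "det (lead k a) = det (lead k (a * 1\<^sub>m n))" using c by simp
  also have "\<dots> = (\<Prod>j<k. a $$ (j, j)) * det (lead k (1\<^sub>m n))"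
    using c k Uminus_entry[OF a] by (intro det_lead_mult_lower) auto
  also have "lead k (1\<^sub>m n :: 'a mat) = 1\<^sub>m k" using k by (intro eq_matI) (auto simp: lead_def)
  finally show ?thesis using Uplus_entry(2)[OF b] Uminus_entry(2)[OF a] k by simp
qed

text \<open>The torus part of a matrix in the big cell is determined by the leading minors, since these
  are the partial products of its diagonal.\<close>

lemma torus_part_gauss:
  assumes a: "a \<in> Uminus n" and h: "h \<in> Torus n" and b: "b \<in> Uplus n"
  shows "torus_part n (a * h * b) = h"
  unfolding torus_part_def SL_mult
proof (rule the_equality)
  show "h \<in> Torus n \<and> (\<exists>a'\<in>Uminus n. \<exists>b'\<in>Uplus n. a * h * b = a' * h * b')" using assms by blast
next
  fix h' assume "h' \<in> Torus n \<and> (\<exists>a'\<in>Uminus n. \<exists>b'\<in>Uplus n. a * h * b = a' * h' * b')"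
  then obtain a' b' where h': "h' \<in> Torus n" "a' \<in> Uminus n" "b' \<in> Uplus n"
    and eq: "a * h * b = a' * h' * b'" by blast
  have p: "(\<Prod>j<k. h $$ (j, j)) = (\<Prod>j<k. h' $$ (j, j))" if "k \<le> n" for k
    using det_lead_gauss[OF a h b that] det_lead_gauss[OF h'(2,1,3) that] eq by simp
  have d: "h' $$ (i, i) = h $$ (i, i)" if "i < n" for i
  proof -
    have "(\<Prod>j<i. h $$ (j, j)) \<noteq> 0" using Torus_diag_nonzero[OF h] that by auto
    then show ?thesis using p[of "Suc i"] p[of i] that by simp
  qed
  show "h' = h"
    using SL_carrier_mat[OF Torus_SL[OF h]] SL_carrier_mat[OF Torus_SL[OF h'(1)]]
      Torus_entry[OF h] Torus_entry[OF h'(1)] d by (intro eq_matI) (auto, metis)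
qed

text \<open>On the big cell \<open>x \<mapsto> ([x]\<^sub>0)\<^bsup>\<omega>\<^sub>i\<^esup>\<close> is the leading minor of size \<open>i\<close>.\<close>

lemma fund_char_torus_part:
  assumes "x \<in> gauss_cell n" "i \<le> n"
  shows "wt_char n (fund_weight i) (torus_part n x) = det (lead i x)"
proof -
  obtain a h b where abh: "a \<in> Uminus n" "h \<in> Torus n" "b \<in> Uplus n" and x: "x = a * h * b"
    using assms(1) by (auto simp: gauss_cell_def)
  have "(\<Prod>j<n. h $$ (j, j) powi fund_weight i j) = (\<Prod>j<i. h $$ (j, j))"
    using assms(2) by (intro prod.mono_neutral_cong_right) (auto simp: fund_weight_def)
  then show ?thesis
    unfolding x torus_part_gauss[OF abh] wt_char_def det_lead_gauss[OF abh assms(2)] .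
qed

section \<open>Polynomial functions and density\<close>

lemma poly_funs_sum:
  "(\<And>i. i \<in> I \<Longrightarrow> (\<lambda>x. f i x) \<in> poly_funs C) \<Longrightarrow> (\<lambda>x. \<Sum>i\<in>I. f i x) \<in> poly_funs C"
  by (induction I rule: infinite_finite_induct) (auto intro: poly_funs.intros)

lemma poly_funs_prod:
  "(\<And>i. i \<in> I \<Longrightarrow> (\<lambda>x. f i x) \<in> poly_funs C) \<Longrightarrow> (\<lambda>x. \<Prod>i\<in>I. f i x) \<in> poly_funs C"
  by (induction I rule: infinite_finite_induct) (auto intro: poly_funs.intros)

lemma permutes_lessThan_less: "p permutes {0..<k} \<Longrightarrow> i < k \<Longrightarrow> p i < (k :: nat)"
  using permutes_in_image[of p "{0..<k}" i] by simp

lemma poly_funs_det: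
  assumes "\<And>i j. i < k \<Longrightarrow> j < k \<Longrightarrow> (\<lambda>x. e x i j) \<in> poly_funs C"
  shows "(\<lambda>x. det (mat k k (\<lambda>(i, j). e x i j))) \<in> poly_funs C"
proof -
  have "(\<lambda>x. \<Sum>p\<in>{p. p permutes {0..<k}}. signof p * (\<Prod>i = 0..<k. e x i (p i))) \<in> poly_funs C"
    by (intro poly_funs_sum poly_funs.mult poly_funs.const poly_funs_prod assms)
      (auto dest: permutes_lessThan_less)
  also have "(\<lambda>x. \<Sum>p\<in>{p. p permutes {0..<k}}. signof p * (\<Prod>i = 0..<k. e x i (p i))) =
      (\<lambda>x. det (mat k k (\<lambda>(i, j). e x i j)))"
    by (rule ext, subst det_def'[of _ k], simp, intro sum.cong refl arg_cong2[of _ _ _ _ "(*)"] prod.cong)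
      (auto simp: permutes_lessThan_less)
  finally show ?thesis .
qed

lemma poly_funs_entry:
  "i < n \<Longrightarrow> j < n \<Longrightarrow> (\<lambda>A. A $$ (i, j)) \<in> poly_funs (mat_coords n)"
  by (intro poly_funs.coord) (auto simp: mat_coords_def)

lemma poly_funs_det_lead: "k \<le> n \<Longrightarrow> (\<lambda>A. det (lead k A)) \<in> poly_funs (mat_coords n)"
  unfolding lead_def by (intro poly_funs_det poly_funs_entry) auto

lemma lead_full: "A \<in> carrier_mat n n \<Longrightarrow> lead n A = A"
  by (intro eq_matI) (auto simp: lead_def)

text \<open>A polynomial function restricts to a univariate polynomial on every affine line.\<close>

lemma poly_funs_line:
  assumes "p \<in> poly_funs (mat_coords n)" "A \<in> carrier_mat n n" "B \<in> carrier_mat n n"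
  shows "\<exists>q. \<forall>t. p (A + t \<cdot>\<^sub>m B) = poly q t"
  using assms(1)
proof induction
  case (const c)
  then show ?case by (intro exI[of _ "[:c:]"]) simp
next
  case (coord f)
  then obtain i j where "f = (\<lambda>A. A $$ (i, j))" "i < n" "j < n" by (auto simp: mat_coords_def)
  then show ?case using assms by (intro exI[of _ "[:A $$ (i, j), B $$ (i, j):]"]) simp
next
  case (add f g)
  then obtain q r where "\<forall>t. f (A + t \<cdot>\<^sub>m B) = poly q t" "\<forall>t. g (A + t \<cdot>\<^sub>m B) = poly r t" by blast
  then show ?case by (intro exI[of _ "q + r"]) simp
next
  case (mult f g)
  then obtain q r where "\<forall>t. f (A + t \<cdot>\<^sub>m B) = poly q t" "\<forall>t. g (A + t \<cdot>\<^sub>m B) = poly r t" by blast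
  then show ?case by (intro exI[of _ "q * r"]) simp
qed

lemma infinite_Rats: "infinite (\<rat> :: 'a::field_char_0 set)"
proof
  assume "finite (\<rat> :: 'a set)"
  then have "finite (range (of_nat :: nat \<Rightarrow> 'a))" by (rule rev_finite_subset) auto
  then show False using finite_imageD[of of_nat "UNIV :: nat set"] by (simp add: inj_of_nat)
qed

lemma poly_zero_on_Rats:
  fixes q :: "'a::field_char_0 poly"
  assumes "\<And>t. t \<in> \<rat> \<Longrightarrow> poly q t = 0"
  shows "q = 0"
proof (rule ccontr)
  assume "q \<noteq> 0"
  then have "finite {t. poly q t = 0}" by (rule poly_roots_finite)
  then show False using infinite_Rats assms 
    by (auto dest: finite_subset[of "\<rat>", rotated])
qed

text \<open>Matrices with rational entries. The ground field has characteristic \<open>0\<close>, so it contains \<open>\<rat>\<close>.\<close>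

definition rat_mat :: "nat \<Rightarrow> 'k::field_char_0 mat \<Rightarrow> bool" where
  "rat_mat n A \<longleftrightarrow> (\<forall>i<n. \<forall>j<n. A $$ (i, j) \<in> \<rat>)"

text \<open>A polynomial function that vanishes at the rational matrices is zero. The entries outside a set
  \<open>Z\<close> of positions are kept rational, and \<open>Z\<close> is enlarged one position at a time: a univariate
  polynomial with all rational numbers as roots is zero.\<close>

lemma poly_funs_zero_if_rat:
  fixes p :: "'k::field_char_0 mat \<Rightarrow> 'k"
  assumes p: "p \<in> poly_funs (mat_coords n)"
    and z: "\<And>A. A \<in> carrier_mat n n \<Longrightarrow> rat_mat n A \<Longrightarrow> p A = 0"
    and A: "A \<in> carrier_mat n n"
  shows "p A = 0"
proof -
  have "p A = 0" if "finite Z" "A \<in> carrier_mat n n"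
    "\<And>i j. i < n \<Longrightarrow> j < n \<Longrightarrow> (i, j) \<notin> Z \<Longrightarrow> A $$ (i, j) \<in> \<rat>" for Z A
    using that
  proof (induction Z arbitrary: A)
    case empty
    then show ?case using z[of A] by (simp add: rat_mat_def)
  next
    case (insert ij Z)
    obtain i j where ij: "ij = (i, j)" by (cases ij)
    let ?A = "mat n n (\<lambda>(r, c). if (r, c) = ij then 0 else A $$ (r, c))"
    let ?E = "mat n n (\<lambda>(r, c). if (r, c) = ij then 1 else 0)"
    obtain q where q: "\<And>t. p (?A + t \<cdot>\<^sub>m ?E) = poly q t"
      using poly_funs_line[OF p, of ?A ?E] by auto
    have "poly q t = 0" if "t \<in> \<rat>" for t
    proof -
      have "p (?A + t \<cdot>\<^sub>m ?E) = 0"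
      proof (rule insert.IH)
        fix r c assume rc: "r < n" "c < n" "(r, c) \<notin> Z"
        show "(?A + t \<cdot>\<^sub>m ?E) $$ (r, c) \<in> \<rat>"
        proof (cases "(r, c) = ij")
          case False
          then have "A $$ (r, c) \<in> \<rat>" using insert.prems(2)[of r c] rc by simp
          then show ?thesis using rc False by simp
        qed (use rc that ij in auto)
      qed simp
      then show ?thesis using q by simp
    qed
    then have q0: "q = 0" by (rule poly_zero_on_Rats)
    have "A = ?A + (A $$ (i, j)) \<cdot>\<^sub>m ?E"
      using insert.prems(1) ij by (intro eq_matI) auto
    then have "p A = poly q (A $$ (i, j))" using q[of "A $$ (i, j)"] by simp
    then show ?case using q0 by simp
  qed
  from this[of "{..<n} \<times> {..<n}" A] A show ?thesis by simp
qed

lemma poly_funs_nonzero_both: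
  fixes p q :: "'k::field_char_0 mat \<Rightarrow> 'k"
  assumes p: "p \<in> poly_funs (mat_coords n)" and q: "q \<in> poly_funs (mat_coords n)"
    and A: "A \<in> carrier_mat n n" and B: "B \<in> carrier_mat n n"
    and nz: "p A \<noteq> 0" "q B \<noteq> 0"
  shows "\<exists>C\<in>carrier_mat n n. p C * q C \<noteq> 0"
proof -
  have c: "B - A \<in> carrier_mat n n" by (rule minus_carrier_mat[OF A])
  obtain P Q where P: "\<And>t. p (A + t \<cdot>\<^sub>m (B - A)) = poly P t"
    and Q: "\<And>t. q (A + t \<cdot>\<^sub>m (B - A)) = poly Q t"
    using poly_funs_line[OF p A c] poly_funs_line[OF q A c] by blast
  have "A + 0 \<cdot>\<^sub>m (B - A) = A" "A + 1 \<cdot>\<^sub>m (B - A) = B" using A B by auto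
  then have "poly P 0 \<noteq> 0" "poly Q 1 \<noteq> 0" using P Q nz by metis+
  then have "P * Q \<noteq> 0" by auto
  then obtain t where "poly (P * Q) t \<noteq> 0" using poly_zero_on_Rats by blast
  then show ?thesis using P Q A c by (intro bexI[of _ "A + t \<cdot>\<^sub>m (B - A)"]) auto
qed

text \<open>Dividing the first column by the determinant retracts the invertible matrices to \<open>SL\<^sub>n\<close>.\<close>

definition unimod :: "nat \<Rightarrow> 'k::field_char_0 mat \<Rightarrow> 'k mat" where
  "unimod n A = mat n n (\<lambda>(r, c). if c = 0 then A $$ (r, c) / det A else A $$ (r, c))"

lemma unimod_SL:
  assumes n: "0 < n" and A: "A \<in> carrier_mat n n" and d: "det A \<noteq> 0"
  shows "unimod n A \<in> carrier (SL n)"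
proof -
  let ?D = "mat n n (\<lambda>(r, c). if r = c then (if r = 0 then 1 / det A else 1) else 0)"
  have "unimod n A = A * ?D"
  proof (rule eq_matI)
    fix i j assume ij: "i < dim_row (A * ?D)" "j < dim_col (A * ?D)"
    then have "(A * ?D) $$ (i, j) = (\<Sum>c<n. A $$ (i, c) * ?D $$ (c, j))"
      using A by (intro mat_mult_entry[of _ n n _ n]) auto
    also have "\<dots> = (\<Sum>c<n. if c = j then A $$ (i, j) * ?D $$ (j, j) else 0)"
      using ij by (intro sum.cong) auto
    finally show "unimod n A $$ (i, j) = (A * ?D) $$ (i, j)"
      using ij A by (simp add: unimod_def)
  qed (use A in \<open>auto simp: unimod_def\<close>)
  moreover have "det ?D = (\<Prod>i<n. if i = 0 then 1 / det A else 1)"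
    by (subst det_upper_triangular[of _ n])
      (auto simp: prod_list_diag_prod atLeast0LessThan intro!: prod.cong)
  then have "det ?D = 1 / det A" using n by (simp add: prod.delta)
  ultimately show ?thesis using A d by (simp add: SL_iff det_mult[of _ n])
qed

lemma unimod_of_SL: "A \<in> carrier (SL n) \<Longrightarrow> unimod n A = A"
  by (intro eq_matI) (auto simp: unimod_def SL_iff)

text \<open>Pulling a polynomial function back along this retraction only introduces powers of the
  determinant as denominators.\<close>

lemma unimod_clear_denominator:
  assumes "p \<in> poly_funs (mat_coords n)"
  shows "\<exists>N. \<exists>q\<in>poly_funs (mat_coords n). \<forall>A\<in>carrier_mat n n. det A \<noteq> 0 \<longrightarrow>
     q A = det A ^ N * p (unimod n A)"
  using assms
proof induction
  case (const c)
  then show ?case by (intro exI[of _ 0] bexI[of _ "\<lambda>_. c"]) (auto intro: poly_funs.intros)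
next
  case (coord f)
  then obtain i j where f: "f = (\<lambda>A. A $$ (i, j))" and ij: "i < n" "j < n"
    by (auto simp: mat_coords_def)
  show ?case
  proof (cases "j = 0")
    case True
    then show ?thesis using f ij
      by (intro exI[of _ 1] bexI[of _ f] poly_funs.coord coord) (auto simp: unimod_def)
  next
    case False
    then show ?thesis using f ij
      by (intro exI[of _ 0] bexI[of _ f] poly_funs.coord coord) (auto simp: unimod_def)
  qed
next
  case (add f g)
  obtain N q where q: "q \<in> poly_funs (mat_coords n)"
    "\<And>A. A \<in> carrier_mat n n \<Longrightarrow> det A \<noteq> 0 \<Longrightarrow> q A = det A ^ N * f (unimod n A)"
    using add.IH(1) by blast
  obtain M r where r: "r \<in> poly_funs (mat_coords n)"
    "\<And>A. A \<in> carrier_mat n n \<Longrightarrow> det A \<noteq> 0 \<Longrightarrow> r A = det A ^ M * g (unimod n A)"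
    using add.IH(2) by blast
  have pw: "(\<lambda>A. det (lead n A) ^ K) \<in> poly_funs (mat_coords n)" for K
    using poly_funs_prod[of "{..<K}" "\<lambda>_ A. det (lead n A)" "mat_coords n"] poly_funs_det_lead[of n n]
    by simp
  show ?case
    by (rule exI[of _ "N + M"],
        rule bexI[of _ "\<lambda>A. det (lead n A) ^ M * q A + det (lead n A) ^ N * r A"])
      (auto simp: lead_full q(2) r(2) power_add algebra_simps
        intro!: poly_funs.add poly_funs.mult pw q(1) r(1))
next
  case (mult f g)
  obtain N q where q: "q \<in> poly_funs (mat_coords n)"
    "\<And>A. A \<in> carrier_mat n n \<Longrightarrow> det A \<noteq> 0 \<Longrightarrow> q A = det A ^ N * f (unimod n A)"
    using mult.IH(1) by blast
  obtain M r where r: "r \<in> poly_funs (mat_coords n)"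
    "\<And>A. A \<in> carrier_mat n n \<Longrightarrow> det A \<noteq> 0 \<Longrightarrow> r A = det A ^ M * g (unimod n A)"
    using mult.IH(2) by blast
  show ?case
    by (rule exI[of _ "N + M"], rule bexI[of _ "\<lambda>A. q A * r A"])
      (auto simp: q(2) r(2) power_add algebra_simps intro!: poly_funs.mult q(1) r(1))
qed

text \<open>The non-vanishing locus of a polynomial function on \<open>SL\<^sub>n\<close> is dense as soon as it is nonempty.\<close>

lemma SL_dense_nonvanishing:
  fixes p d :: "'k::field_char_0 mat \<Rightarrow> 'k"
  assumes n: "0 < n" and p: "p \<in> poly_funs (mat_coords n)" and d: "d \<in> poly_funs (mat_coords n)"
    and x1: "x1 \<in> carrier (SL n)" "d x1 \<noteq> 0"
    and z: "\<And>x. x \<in> carrier (SL n) \<Longrightarrow> d x \<noteq> 0 \<Longrightarrow> p x = 0"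
    and x: "x \<in> carrier (SL n)"
  shows "p x = 0"
proof (rule ccontr)
  assume nz: "p x \<noteq> 0"
  obtain N q where q: "q \<in> poly_funs (mat_coords n)"
    "\<And>A. A \<in> carrier_mat n n \<Longrightarrow> det A \<noteq> 0 \<Longrightarrow> q A = det A ^ N * p (unimod n A)"
    using unimod_clear_denominator[OF p] by blast
  obtain M r where r: "r \<in> poly_funs (mat_coords n)"
    "\<And>A. A \<in> carrier_mat n n \<Longrightarrow> det A \<noteq> 0 \<Longrightarrow> r A = det A ^ M * d (unimod n A)"
    using unimod_clear_denominator[OF d] by blast
  have "q x \<noteq> 0" using q(2)[OF SL_carrier_mat[OF x]] x nz by (simp add: SL_iff unimod_of_SL)
  moreover have "r x1 \<noteq> 0"
    using r(2)[OF SL_carrier_mat[OF x1(1)]] x1 by (simp add: SL_iff unimod_of_SL)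
  ultimately obtain C where C: "C \<in> carrier_mat n n" "q C * r C \<noteq> 0"
    using poly_funs_nonzero_both[OF q(1) r(1)] x x1 SL_carrier_mat by metis
  obtain D where D: "D \<in> carrier_mat n n" "(q D * r D) * det (lead n D) \<noteq> 0"
    using poly_funs_nonzero_both[OF poly_funs.mult[OF q(1) r(1)] poly_funs_det_lead[of n n] C(1)
      one_carrier_mat[of n] C(2)] by (auto simp: lead_full)
  then have "det D \<noteq> 0" by (simp add: lead_full)
  then show False using D q(2)[OF D(1)] r(2)[OF D(1)] z[OF unimod_SL[OF n D(1)]] by auto
qed

text \<open>The rational points of \<open>SL\<^sub>n\<close> are dense.\<close>

lemma SL_dense_rat:
  fixes p :: "'k::field_char_0 mat \<Rightarrow> 'k"
  assumes n: "0 < n" and p: "p \<in> poly_funs (mat_coords n)"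
    and z: "\<And>x. x \<in> carrier (SL n) \<Longrightarrow> rat_mat n x \<Longrightarrow> p x = 0"
    and x: "x \<in> carrier (SL n)"
  shows "p x = 0"
proof -
  obtain N q where q: "q \<in> poly_funs (mat_coords n)"
    "\<And>A. A \<in> carrier_mat n n \<Longrightarrow> det A \<noteq> 0 \<Longrightarrow> q A = det A ^ N * p (unimod n A)"
    using unimod_clear_denominator[OF p] by blast
  have rat_det: "det A \<in> \<rat>" if A: "A \<in> carrier_mat n n" "rat_mat n A" for A :: "'k mat"
  proof -
    have "signof \<pi> \<in> (\<rat> :: 'k set)" for \<pi> :: "nat \<Rightarrow> nat" by (simp add: sign_def)
    then show ?thesis unfolding det_def'[OF A(1)]
      using A(2) by (intro Rats_sum Rats_mult Rats_prod) (auto simp: rat_mat_def permutes_lessThan_less)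
  qed
  have "q A * det (lead n A) = 0" if A: "A \<in> carrier_mat n n" "rat_mat n A" for A
  proof (cases "det A = 0")
    case False
    have "rat_mat n (unimod n A)"
      using A rat_det[OF A] by (auto simp: rat_mat_def unimod_def)
    then show ?thesis using q(2)[OF A(1) False] z[OF unimod_SL[OF n A(1) False]] by simp
  qed (use A in \<open>simp add: lead_full\<close>)
  then have "q x * det (lead n x) = 0"
    using poly_funs_zero_if_rat[OF poly_funs.mult[OF q(1) poly_funs_det_lead[of n n]]]
      SL_carrier_mat[OF x] by simp
  then show ?thesis
    using q(2)[OF SL_carrier_mat[OF x]] x by (simp add: SL_iff unimod_of_SL lead_full)
qed

section \<open>The big cell and the generalized minors\<close>

lemma addrow_mat_entry:
  "i < n \<Longrightarrow> j < n \<Longrightarrow> addrow_mat n a k l $$ (i, j) =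
     (if i = j then 1 else 0) + (if i = k \<and> j = l then a else 0)"
  by (auto simp: addrow_mat_def add.commute)

lemma addrow_mat_mult:
  fixes A :: "'a::comm_ring_1 mat"
  assumes "A \<in> carrier_mat n n" "k < n" "l < n" "i < n" "j < n"
  shows "(addrow_mat n a k l * A) $$ (i, j) = A $$ (i, j) + (if i = k then a * A $$ (l, j) else 0)"
proof -
  have "(addrow_mat n a k l * A) $$ (i, j) = (\<Sum>c<n. addrow_mat n a k l $$ (i, c) * A $$ (c, j))"
    using assms by (intro mat_mult_entry[of _ n n _ n]) auto
  also have "\<dots> = (\<Sum>c<n. (if c = i then A $$ (i, j) else 0) +
      (if c = l then (if i = k then a * A $$ (l, j) else 0) else 0))"
    using assms by (intro sum.cong) (auto simp: addrow_mat_entry algebra_simps)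
  also have "\<dots> = A $$ (i, j) + (if i = k then a * A $$ (l, j) else 0)"
    using assms by (simp add: sum.distrib)
  finally show ?thesis .
qed

lemma addrow_mat_add:
  fixes a b :: "'a::comm_ring_1"
  assumes "k < n" "l < n" "k \<noteq> l"
  shows "addrow_mat n a k l * addrow_mat n b k l = addrow_mat n (a + b) k l"
  using assms by (intro eq_matI) (auto simp: addrow_mat_mult addrow_mat_entry simp del: index_mult_mat(1))

lemma addrow_SL: "k \<noteq> l \<Longrightarrow> addrow_mat n a k l \<in> carrier (SL n)"
  using det_addrow_mat[of k l n a] by (simp add: SL_iff)

text \<open>An elementary matrix is the commutator of a torus element, on which the corresponding root takes
  the value \<open>4\<close>, and an elementary matrix.\<close>

lemma addrow_mat_Uminus:
  fixes t :: "'k::field_char_0"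
  assumes lk: "l < k" "k < n"
  shows "addrow_mat n t k l \<in> Uminus n"
proof -
  define s where "s = t / 3"
  have ts: "t = 3 * s" by (simp add: s_def)
  let ?E = "\<lambda>s. addrow_mat n s k l :: 'k mat"
  define h :: "'k mat" where
    "h = mat n n (\<lambda>(r, c). if r = c then (if r = k then 2 else if r = l then 1 / 2 else 1) else 0)"
  have hc: "h \<in> carrier_mat n n" by (simp add: h_def)
  have "det h = (\<Prod>i<n. if i = k then 2 else if i = l then 1 / 2 else 1)"
    unfolding h_def by (subst det_upper_triangular[of _ n])
      (auto simp: prod_list_diag_prod atLeast0LessThan intro!: prod.cong)
  also have "\<dots> = (\<Prod>i\<in>{k, l}. if i = k then 2 else if i = l then 1 / 2 else 1)"
    using lk by (intro prod.mono_neutral_right) auto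
  also have "\<dots> = 1" using lk by simp
  finally have h: "h \<in> Bminus n" using hc by (auto simp: Bminus_def SL_iff h_def)
  have E: "?E s \<in> Bminus n" for s
    using lk addrow_SL[of k l n s] by (auto simp: Bminus_def addrow_mat_entry)
  have hE: "h * ?E s = ?E (4 * s) * h"
  proof (rule eq_matI)
    fix i j assume "i < dim_row (?E (4 * s) * h)" "j < dim_col (?E (4 * s) * h)"
    then have ij: "i < n" "j < n" using hc by auto
    have "(h * ?E s) $$ (i, j) = (\<Sum>c<n. h $$ (i, c) * ?E s $$ (c, j))"
      using hc ij by (intro mat_mult_entry[of _ n n _ n]) auto
    also have "\<dots> = (\<Sum>c<n. if c = i then h $$ (i, i) * ?E s $$ (i, j) else 0)"
      using ij by (intro sum.cong) (auto simp: h_def)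
    also have "\<dots> = h $$ (i, i) * ?E s $$ (i, j)" using ij by simp
    finally show "(h * ?E s) $$ (i, j) = (?E (4 * s) * h) $$ (i, j)"
      using ij lk hc by (auto simp: addrow_mat_mult addrow_mat_entry h_def simp del: index_mult_mat)
  qed (use hc in auto)
  note hS = Bminus_SL[OF h] and ES = Bminus_SL[OF E]
  have iS: "inv\<^bsub>SL n\<^esub> h \<in> carrier (SL n)" "inv\<^bsub>SL n\<^esub> (?E s) \<in> carrier (SL n)"
    using SL_inv_closed hS ES by blast+
  have "h * ?E s * inv\<^bsub>SL n\<^esub> h * inv\<^bsub>SL n\<^esub> (?E s) = ?E (4 * s) * h * inv\<^bsub>SL n\<^esub> h * inv\<^bsub>SL n\<^esub> (?E s)"
    using hE by simp
  also have "\<dots> = ?E (4 * s) * inv\<^bsub>SL n\<^esub> (?E s)"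
    using SL_inv_cancel(3)[OF hS ES] by simp
  also have "?E (4 * s) = ?E t * ?E s" using lk ts by (simp add: addrow_mat_add)
  also have "?E t * ?E s * inv\<^bsub>SL n\<^esub> (?E s) = ?E t"
    using SL_inv_cancel(3)[OF ES ES] by simp
  finally have "?E t = h * ?E s * inv\<^bsub>SL n\<^esub> h * inv\<^bsub>SL n\<^esub> (?E s)" ..
  then have "?E t \<in> derived_set (SL n) (Bminus n)" 
    using h E[of s] unfolding UN_iff SL_mult singleton_iff
    by (intro bexI[of _ h] bexI[of _ "?E s"])
  then show ?thesis unfolding Uminus_def derived_def by (rule generate.incl)
qed

lemma Uminus_mult_closed: "a \<in> Uminus n \<Longrightarrow> b \<in> Uminus n \<Longrightarrow> a * b \<in> Uminus n"
  using subgroup.m_closed[OF subgroup_Uminus, of a n b] by simp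

lemma det_lead_Uminus_mult:
  assumes "a \<in> Uminus n" "A \<in> carrier_mat n n" "k \<le> n"
  shows "det (lead k (a * A)) = det (lead k A)"
  using det_lead_mult_lower[OF SL_carrier_mat[OF Uminus_SL[OF assms(1)]] assms(2,3)]
    Uminus_entry[OF assms(1)] assms(3) by simp

text \<open>One stage of Gaussian elimination without pivoting: clearing column \<open>j\<close> below the diagonal.\<close>

lemma eliminate_column:
  fixes B :: "'k::field_char_0 mat"
  assumes B: "B \<in> carrier_mat n n" and j: "j < n" and piv: "B $$ (j, j) \<noteq> 0"
    and z: "\<And>r c. c < j \<Longrightarrow> c < r \<Longrightarrow> r < n \<Longrightarrow> B $$ (r, c) = 0" and m: "m \<le> n"
  shows "\<exists>b\<in>Uminus n. (\<forall>r<n. \<forall>c. c < r \<and> (c < j \<or> c = j \<and> r < m) \<longrightarrow> (b * B) $$ (r, c) = 0) \<and>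
    (\<forall>c<n. (b * B) $$ (j, c) = B $$ (j, c))"
  using m
proof (induction m)
  case 0
  have "1\<^sub>m n \<in> Uminus n" using subgroup.one_closed[OF subgroup_Uminus, of n] by simp
  then show ?case using B z by (intro bexI[of _ "1\<^sub>m n"]) auto
next
  case (Suc m)
  then obtain b where b: "b \<in> Uminus n"
    and 1: "\<And>r c. r < n \<Longrightarrow> c < r \<Longrightarrow> c < j \<or> c = j \<and> r < m \<Longrightarrow> (b * B) $$ (r, c) = 0"
    and 2: "\<And>c. c < n \<Longrightarrow> (b * B) $$ (j, c) = B $$ (j, c)" by auto
  show ?case
  proof (cases "m \<le> j")
    case True
    then show ?thesis using b 1 2 by (intro bexI[of _ b]) auto
  next
    case False
    let ?E = "addrow_mat n (- (b * B) $$ (m, j) / B $$ (j, j)) m j"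
    have E: "?E \<in> Uminus n" using False Suc.prems by (intro addrow_mat_Uminus) auto
    have bc: "b \<in> carrier_mat n n" using b Uminus_SL SL_carrier_mat by blast
    have eq: "?E * b * B = ?E * (b * B)" using bc B by (simp add: assoc_mult_mat[of _ n n _ n _ n])
    have ent: "(?E * b * B) $$ (r, c) = (b * B) $$ (r, c) +
       (if r = m then - (b * B) $$ (m, j) / B $$ (j, j) * B $$ (j, c) else 0)"
      if "r < n" "c < n" for r c
      unfolding eq using that bc B j Suc.prems 2
      by (subst addrow_mat_mult[of _ n]) (auto simp del: index_mult_mat(1))
    have Bj: "B $$ (j, c) = 0" if "c < j" for c using z[of c j] that j by simp
    show ?thesis
    proof (intro bexI[of _ "?E * b"] conjI allI impI)
      fix r c assume r: "r < n" and c: "c < r \<and> (c < j \<or> c = j \<and> r < Suc m)"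
      then show "(?E * b * B) $$ (r, c) = 0"
        using ent[of r c] 1[of r c] Bj[of c] piv by (auto simp del: index_mult_mat)
    next
      fix c assume "c < n"
      then show "(?E * b * B) $$ (j, c) = B $$ (j, c)"
        using ent[of j c] 2[of c] False j by (auto simp del: index_mult_mat)
    qed (rule Uminus_mult_closed[OF E b])
  qed
qed

lemma gauss_elimination:
  fixes A :: "'k::field_char_0 mat"
  assumes A: "A \<in> carrier (SL n)" and minors: "\<And>k. k \<le> n \<Longrightarrow> det (lead k A) \<noteq> 0"
  shows "\<exists>a\<in>Uminus n. a * A \<in> Bplus n"
proof -
  have Ac: "A \<in> carrier_mat n n" using A SL_carrier_mat by blast
  have "\<exists>a\<in>Uminus n. \<forall>c<j. \<forall>r<n. c < r \<longrightarrow> (a * A) $$ (r, c) = 0" if "j \<le> n" for j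
    using that
  proof (induction j)
    case 0
    then show ?case using subgroup.one_closed[OF subgroup_Uminus, of n] by auto
  next
    case (Suc j)
    then obtain a where a: "a \<in> Uminus n"
      and z: "\<And>r c. c < j \<Longrightarrow> c < r \<Longrightarrow> r < n \<Longrightarrow> (a * A) $$ (r, c) = 0" by auto
    have ac: "a \<in> carrier_mat n n" using a Uminus_SL SL_carrier_mat by blast
    let ?B = "a * A"
    have Bc: "?B \<in> carrier_mat n n" using ac Ac by simp
    have "det (lead (Suc j) ?B) = (\<Prod>i<Suc j. lead (Suc j) ?B $$ (i, i))"
    proof (subst det_upper_triangular[of _ "Suc j"])
      show "upper_triangular (lead (Suc j) ?B)"
        using z Suc.prems by (auto simp: lead_def simp del: index_mult_mat)
    qed (auto simp: prod_list_diag_prod lead_def atLeast0LessThan)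
    moreover have "det (lead (Suc j) ?B) \<noteq> 0"
      using det_lead_Uminus_mult[OF a Ac, of "Suc j"] minors[of "Suc j"] Suc.prems by simp
    ultimately have piv: "?B $$ (j, j) \<noteq> 0" by (auto simp: lead_def simp del: index_mult_mat)
    obtain b where b: "b \<in> Uminus n"
      and 1: "\<And>r c. r < n \<Longrightarrow> c < r \<Longrightarrow> c < j \<or> c = j \<and> r < n \<Longrightarrow> (b * ?B) $$ (r, c) = 0"
      using eliminate_column[OF Bc _ piv z le_refl] Suc.prems by auto
    have bc: "b \<in> carrier_mat n n" using b Uminus_SL SL_carrier_mat by blast
    have "b * ?B = b * a * A" using ac bc Ac by (simp add: assoc_mult_mat[of _ n n _ n _ n])
    then show ?case using 1 Uminus_mult_closed[OF b a]
      by (intro bexI[of _ "b * a"]) (auto simp: less_Suc_eq simp del: index_mult_mat)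
  qed
  from this[OF le_refl] obtain a where a: "a \<in> Uminus n"
    and z: "\<And>r c. r < n \<Longrightarrow> c < n \<Longrightarrow> c < r \<Longrightarrow> (a * A) $$ (r, c) = 0" by blast
  have "a * A \<in> Bplus n" using z SL_mult_closed[OF Uminus_SL[OF a] A] by (auto simp: Bplus_def)
  with a show ?thesis by blast
qed

text \<open>Elimination applied to a lower unipotent matrix ends with a matrix that is both lower unipotent
  and upper triangular, that is, with the identity.\<close>

lemma Uminus_eq_lower_unip: "Uminus n = (lower_unip n :: 'k::field_char_0 mat set)"
proof (rule antisym[OF Uminus_subset_lower_unip], safe)
  fix L :: "'k mat" assume L: "L \<in> lower_unip n"
  then have LB: "L \<in> Bminus n" and LS: "L \<in> carrier (SL n)" by (auto simp: lower_unip_def Bminus_SL)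
  have Lc: "L \<in> carrier_mat n n" using LS SL_carrier_mat by blast
  have "det (lead k L) \<noteq> 0" if k: "k \<le> n" for k
  proof -
    have "det (lead k (L * 1\<^sub>m n)) = (\<Prod>j<k. L $$ (j, j)) * det (lead k (1\<^sub>m n))"
      by (rule det_lead_mult_lower[OF Lc _ k]) (auto simp: Bminus_lower[OF LB])
    moreover have "lead k (1\<^sub>m n :: 'k mat) = 1\<^sub>m k"
      using k by (intro eq_matI) (auto simp: lead_def)
    ultimately show ?thesis using L k Lc by (simp add: lower_unip_def)
  qed
  then obtain a where a: "a \<in> Uminus n" and b: "a * L \<in> Bplus n"
    using gauss_elimination[OF LS] by blast
  have "a * L \<in> lower_unip n"
    using subgroup.m_closed[OF subgroup_lower_unip _ L, of a] a Uminus_subset_lower_unip by auto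
  then have "a * L = 1\<^sub>m n"
  proof (intro eq_matI)
    fix i j assume "i < dim_row (1\<^sub>m n :: 'k mat)" "j < dim_col (1\<^sub>m n :: 'k mat)"
    then have ij: "i < n" "j < n" by auto
    consider "i = j" | "i < j" | "j < i" by linarith
    then show "(a * L) $$ (i, j) = 1\<^sub>m n $$ (i, j)"
      by cases (use ij b \<open>a * L \<in> lower_unip n\<close> in
        \<open>simp_all add: lower_unip_def Bminus_def Bplus_def del: index_mult_mat(1)\<close>)
  qed (use SL_carrier_mat[OF Uminus_SL[OF a]] Lc in auto)
  then have "inv\<^bsub>SL n\<^esub> a = L" by (rule SL_inv_eqI[OF Uminus_SL[OF a] LS])
  then show "L \<in> Uminus n" using subgroup.m_inv_closed[OF subgroup_Uminus a] by simp
qed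

text \<open>The upper triangular result of the elimination splits into its diagonal and a unipotent part.\<close>

lemma gauss_cellI:
  fixes A :: "'k::field_char_0 mat"
  assumes A: "A \<in> carrier (SL n)" and minors: "\<And>k. k \<le> n \<Longrightarrow> det (lead k A) \<noteq> 0"
  shows "A \<in> gauss_cell n"
proof -
  obtain a where a: "a \<in> Uminus n" and b: "a * A \<in> Bplus n"
    using gauss_elimination[OF assms] by blast
  define b where "b = a * A"
  have bB: "b \<in> Bplus n" and bS: "b \<in> carrier (SL n)" using b by (auto simp: b_def Bplus_def)
  have bc: "b \<in> carrier_mat n n" using bS SL_carrier_mat by blast
  have z: "b $$ (i, j) = 0" if "j < i" "i < n" for i j
    using bB that by (auto simp: Bplus_def)
  have "det b = (\<Prod>i<n. b $$ (i, i))"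
    using z bc by (subst det_upper_triangular[of _ n]) (auto simp: prod_list_diag_prod atLeast0LessThan)
  then have db: "(\<Prod>i<n. b $$ (i, i)) = 1" using bS by (simp add: SL_iff)
  have nz: "b $$ (i, i) \<noteq> 0" if "i < n" for i
  proof
    assume "b $$ (i, i) = 0"
    then have "(\<Prod>i<n. b $$ (i, i)) = 0" using that by (intro prod_zero) auto
    then show False using db by simp
  qed
  define h where "h = mat n n (\<lambda>(r, c). if r = c then b $$ (r, r) else 0)"
  define u where "u = mat n n (\<lambda>(r, c). b $$ (r, c) / b $$ (r, r))"
  have dh: "det h = 1" unfolding h_def
    by (subst det_upper_triangular[of _ n])
      (use db in \<open>auto simp: prod_list_diag_prod atLeast0LessThan cong: prod.cong_simp\<close>)
  have h: "h \<in> Torus n" using dh by (auto simp: Torus_def Bplus_def Bminus_def SL_iff h_def)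
  have "det u = (\<Prod>i<n. 1)" unfolding u_def
    by (subst det_upper_triangular[of _ n])
      (auto simp: prod_list_diag_prod atLeast0LessThan z nz intro!: prod.cong)
  then have "u\<^sup>T \<in> lower_unip n"
    by (auto simp: lower_unip_def Bminus_def SL_iff det_transpose[of _ n] u_def z nz)
  then have u: "u \<in> Uplus n"
    using Uplus_transpose(2)[of "u\<^sup>T" n] by (simp add: Uminus_eq_lower_unip)
  have "b = h * u"
  proof (rule eq_matI)
    fix i j assume "i < dim_row (h * u)" "j < dim_col (h * u)"
    then have ij: "i < n" "j < n" by (auto simp: h_def u_def)
    have "(h * u) $$ (i, j) = (\<Sum>c<n. h $$ (i, c) * u $$ (c, j))"
      using ij by (intro mat_mult_entry[of _ n n _ n]) (auto simp: h_def u_def)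
    also have "\<dots> = (\<Sum>c<n. if c = i then h $$ (i, i) * u $$ (i, j) else 0)"
      using ij by (intro sum.cong) (auto simp: h_def)
    finally show "b $$ (i, j) = (h * u) $$ (i, j)" using ij nz by (simp add: h_def u_def)
  qed (use bc in \<open>auto simp: h_def u_def\<close>)
  moreover have "A = inv\<^bsub>SL n\<^esub> a * b"
    unfolding b_def using SL_inv_cancel(2)[OF Uminus_SL[OF a] A] by simp
  moreover have ai: "inv\<^bsub>SL n\<^esub> a \<in> Uminus n" using subgroup.m_inv_closed[OF subgroup_Uminus a] .
  ultimately have "A = inv\<^bsub>SL n\<^esub> a * h * u"
    using SL_assoc[OF Uminus_SL[OF ai] Torus_SL[OF h] Uplus_SL[OF u]] by simp
  then show ?thesis unfolding gauss_cell_def using ai h u by auto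
qed

text \<open>The generalized minor \<open>\<Delta>\<^bsub>u\<omega>\<^sub>i,\<omega>\<^sub>i\<^esub>\<close> is a leading minor of the translate by the inverse of the
  lift of \<open>u\<close>: by density of the big cell, this is the only regular function with the
  prescribed values.\<close>

lemma gen_minor_eq_lead:
  fixes x :: "'k::field_char_0 mat"
  assumes n: "0 < n" and i: "i \<le> n" and u: "weyl_lift n u \<in> carrier (SL n :: 'k mat monoid)"
    and e: "weyl_lift n v = (1\<^sub>m n :: 'k mat)" and x: "x \<in> carrier (SL n)"
  shows "gen_minor n u v i x = det (lead i (inv\<^bsub>SL n\<^esub> (weyl_lift n u) * x))"
proof -
  let ?U = "inv\<^bsub>SL n\<^esub> (weyl_lift n u) :: 'k mat"
  let ?f = "restrict (\<lambda>x. det (lead i (?U * x))) (carrier (SL n)) :: 'k mat \<Rightarrow> 'k"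
  have U: "?U \<in> carrier (SL n)" using SL_inv_closed[OF u] .
  have Uc: "?U \<in> carrier_mat n n" using SL_carrier_mat[OF U] .
  define m :: "nat \<Rightarrow> 'k mat \<Rightarrow> 'k" where
    "m k x = det (mat k k (\<lambda>(p, q). \<Sum>c<n. ?U $$ (p, c) * x $$ (c, q)))" for k x
  have m_poly: "(\<lambda>x. m k x) \<in> poly_funs (mat_coords n)" if "k \<le> n" for k
    unfolding m_def using that
    by (intro poly_funs_det poly_funs_sum poly_funs.mult poly_funs.const poly_funs_entry) auto
  have m: "m k x = det (lead k (?U * x))" if "k \<le> n" "x \<in> carrier (SL n)" for k x
    unfolding m_def lead_def using that SL_carrier_mat[OF that(2)] Uc
    by (intro arg_cong[of _ _ det] cong_mat) (auto simp: mat_mult_entry[of _ n n _ n] simp del: index_mult_mat)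
  have tr: "inv\<^bsub>SL n\<^esub> (weyl_lift n u) \<otimes>\<^bsub>SL n\<^esub> x \<otimes>\<^bsub>SL n\<^esub> weyl_lift n v = ?U * x"
    if "x \<in> carrier (SL n)" for x :: "'k mat"
    using Uc SL_carrier_mat[OF that] by (simp add: e right_mult_one_mat[of _ n n])
  have "gen_minor n u v i = ?f"
    unfolding gen_minor_def Let_def
  proof (rule the_equality, intro conjI ballI impI)
    show "?f \<in> O_SL n" 
      unfolding O_SL_def using m[OF i] by (auto intro!: bexI[OF _ m_poly[OF i]])
  next
    fix x :: "'k mat" assume x: "x \<in> carrier (SL n)"
      and g: "inv\<^bsub>SL n\<^esub> (weyl_lift n u) \<otimes>\<^bsub>SL n\<^esub> x \<otimes>\<^bsub>SL n\<^esub> weyl_lift n v \<in> gauss_cell n"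
    then show "?f x = wt_char n (fund_weight i)
       (torus_part n (inv\<^bsub>SL n\<^esub> (weyl_lift n u) \<otimes>\<^bsub>SL n\<^esub> x \<otimes>\<^bsub>SL n\<^esub> weyl_lift n v))"
      
      unfolding tr[OF x] using fund_char_torus_part[OF _ i, of "?U * x"] x by simp
  next
    fix f :: "'k mat \<Rightarrow> 'k"
    assume f: "f \<in> O_SL n \<and> (\<forall>x\<in>carrier (SL n).
      inv\<^bsub>SL n\<^esub> (weyl_lift n u) \<otimes>\<^bsub>SL n\<^esub> x \<otimes>\<^bsub>SL n\<^esub> weyl_lift n v \<in> gauss_cell n \<longrightarrow>
      f x = wt_char n (fund_weight i)
       (torus_part n (inv\<^bsub>SL n\<^esub> (weyl_lift n u) \<otimes>\<^bsub>SL n\<^esub> x \<otimes>\<^bsub>SL n\<^esub> weyl_lift n v)))"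
    then obtain p where p: "p \<in> poly_funs (mat_coords n)" "\<And>x. x \<in> carrier (SL n) \<Longrightarrow> f x = p x"
      and ext: "f \<in> extensional (carrier (SL n))" by (auto simp: O_SL_def)
    let ?d = "\<lambda>x. \<Prod>k\<le>n. m k x"
    have d: "?d \<in> poly_funs (mat_coords n)" by (intro poly_funs_prod m_poly) auto
    have d1: "?d (weyl_lift n u) \<noteq> 0"
    proof -
      have "lead k (1\<^sub>m n :: 'k mat) = 1\<^sub>m k" if "k \<le> n" for k
        using that by (intro eq_matI) (auto simp: lead_def)
      then show ?thesis using m[OF _ u] SL_inv_l[OF u] by simp
    qed
    have pm: "(\<lambda>x. p x + (-1) * m i x) \<in> poly_funs (mat_coords n)"
      by (intro poly_funs.add poly_funs.mult poly_funs.const p m_poly i)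
    have "p x + (-1) * m i x = 0" if x: "x \<in> carrier (SL n)" for x
    proof (rule SL_dense_nonvanishing[OF n pm d u d1 _ x])
      fix x :: "'k mat" assume x: "x \<in> carrier (SL n)" and dx: "?d x \<noteq> 0"
      have "?U * x \<in> gauss_cell n"
        by (rule gauss_cellI[OF SL_mult_closed[OF U x]]) (use dx m[OF _ x] in auto)
      then have "f x = det (lead i (?U * x))"
        using conjunct2[OF f, rule_format, OF x] fund_char_torus_part[OF _ i, of "?U * x"]
        unfolding tr[OF x] by simp
      then show "p x + (-1) * m i x = 0" using p(2)[OF x] m[OF i x] by simp
    qed
    then show "f = ?f"
      using ext p(2) m[OF i] by (intro extensionalityI[of _ "carrier (SL n)"]) auto
  qed
  then show ?thesis using x by simp
qed

section \<open>The longest element and the lifts of Weyl group elements\<close>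

text \<open>The pairs of positions \<open>a < b < n\<close> whose order is reversed by \<open>w\<close>. Their number is the length of
  \<open>w\<close>.\<close>

definition inversions :: "nat \<Rightarrow> (nat \<Rightarrow> nat) \<Rightarrow> (nat \<times> nat) set" where
  "inversions n w = {(a, b). a < b \<and> b < n \<and> w b < w a}"

lemma finite_inversions: "finite (inversions n w)"
  by (rule finite_subset[of _ "{..<n} \<times> {..<n}"]) (auto simp: inversions_def)

lemma simple_refl_less_iff:
  assumes "1 \<le> i" "x \<noteq> y" "{x, y} \<noteq> {i - 1, i}"
  shows "simple_refl i x < simple_refl i y \<longleftrightarrow> x < y"
  using assms unfolding simple_refl_def Transposition.transpose_def by (auto split: if_splits)

lemma simple_refl_permutes: "i \<in> {1..<n} \<Longrightarrow> simple_refl i permutes {..<n}"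
  unfolding simple_refl_def by (rule permutes_swap_id) auto

lemma simple_refl_involutory: "simple_refl i \<circ> (simple_refl i \<circ> w) = w"
  by (auto simp: simple_refl_def fun_eq_iff)

lemma weyl_word_Nil: "weyl_word [] = id"
  by (simp add: weyl_word_def)

lemma weyl_word_Cons: "weyl_word (i # ws) = simple_refl i \<circ> weyl_word ws"
  unfolding weyl_word_def foldr.simps o_apply ..

lemma weyl_word_permutes: "set ws \<subseteq> {1..<n} \<Longrightarrow> weyl_word ws permutes {..<n}"
proof (induction ws)
  case (Cons i ws)
  then have "(simple_refl i \<circ> weyl_word ws) permutes {..<n}"
    by (intro permutes_compose simple_refl_permutes) auto
  then show ?case by (simp only: weyl_word_Cons)
qed (simp add: weyl_word_Nil permutes_id)

text \<open>Multiplication by a simple reflection leaves the relative order of all pairs but one unchanged.\<close>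

lemma inversions_simple_refl:
  assumes w: "w permutes {..<n}" and i: "i \<in> {1..<n}"
    and ab: "w a = i - 1" "w b = i"
  shows "inversions n (simple_refl i \<circ> w) - {(min a b, max a b)} = inversions n w - {(min a b, max a b)}"
proof -
  have inj: "inj w" using permutes_inj[OF w] .
  have "(simple_refl i (w y) < simple_refl i (w x)) = (w y < w x)"
    if xy: "x < y" "(x, y) \<noteq> (min a b, max a b)" for x y
  proof (rule simple_refl_less_iff)
    show "w y \<noteq> w x" using inj xy by (metis injD less_irrefl)
    show "{w y, w x} \<noteq> {i - 1, i}"
    proof
      assume "{w y, w x} = {i - 1, i}"
      then have "w y = w a \<and> w x = w b \<or> w y = w b \<and> w x = w a"
        using ab by (auto simp: doubleton_eq_iff)
      then have "y = a \<and> x = b \<or> y = b \<and> x = a" using inj by (auto dest: injD)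
      then show False using xy by (auto simp: min_def max_def split: if_splits)
    qed
  qed (use i in auto)
  then show ?thesis by (auto simp: inversions_def)
qed

lemma inversions_id: "inversions n id = {}"
  by (auto simp: inversions_def)

lemma card_inversions_weyl_word:
  "set ws \<subseteq> {1..<n} \<Longrightarrow> card (inversions n (weyl_word ws)) \<le> length ws"
proof (induction ws)
  case Nil
  show ?case unfolding weyl_word_Nil inversions_id by simp
next
  case (Cons i ws)
  let ?w = "weyl_word ws"
  have w: "?w permutes {..<n}" using weyl_word_permutes Cons.prems by simp
  obtain a b where ab: "?w a = i - 1" "?w b = i" using permutes_surj[OF w] by (metis surjD)
  let ?p = "(min a b, max a b)"
  have "inversions n (simple_refl i \<circ> ?w) \<subseteq> insert ?p (inversions n ?w)"
    using inversions_simple_refl[OF w _ ab] Cons.prems by auto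
  then have "card (inversions n (simple_refl i \<circ> ?w)) \<le> card (insert ?p (inversions n ?w))"
    by (intro card_mono) (auto simp: finite_inversions)
  also have "\<dots> \<le> Suc (card (inversions n ?w))" by (simp add: card_insert_if finite_inversions)
  finally show ?case using Cons by (simp add: weyl_word_Cons del: o_apply)
qed

lemma permutes_mono_eq_id:
  assumes w: "w permutes {..<n}" and mono: "\<And>a. Suc a < n \<Longrightarrow> w a < w (Suc a)"
  shows "w = id"
proof (rule permutes_natset_ge[OF w])
  have "a < n \<Longrightarrow> a \<le> w a" for a
  proof (induction a)
    case (Suc a)
    then show ?case using mono[of a] by simp
  qed simp
  then show "\<forall>i\<in>{..<n}. i \<le> w i" by simp
qed

text \<open>Bubble sort: as long as \<open>w \<noteq> id\<close>, some adjacent pair of values is out of order, and exchanging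
  these two values removes one inversion.\<close>

lemma weyl_word_exists:
  assumes "w permutes {..<n}"
  shows "\<exists>ws. set ws \<subseteq> {1..<n} \<and> weyl_word ws = w \<and> length ws \<le> card (inversions n w)"
  using assms
proof (induction "card (inversions n w)" arbitrary: w rule: less_induct)
  case less
  note w = less.prems
  have inv_w: "Hilbert_Choice.inv w permutes {..<n}" using permutes_inv[OF w] .
  have wi: "w (Hilbert_Choice.inv w x) = x" for x using permutes_inverses[OF w] by simp
  show ?case
  proof (cases "w = id")
    case True
    then show ?thesis by (intro exI[of _ "[]"]) (simp add: weyl_word_def)
  next
    case False
    then have "Hilbert_Choice.inv w \<noteq> id" using wi by (metis eq_id_iff)
    then obtain c where c: "Suc c < n" "\<not> Hilbert_Choice.inv w c < Hilbert_Choice.inv w (Suc c)"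
      using permutes_mono_eq_id[OF inv_w] by blast
    define a b where "a = Hilbert_Choice.inv w c" and "b = Hilbert_Choice.inv w (Suc c)"
    have ab: "w a = Suc c - 1" "w b = Suc c" by (simp_all add: a_def b_def wi)
    then have "a \<noteq> b" by auto
    then have ba: "b < a" using c by (simp add: a_def b_def)
    have an: "a < n" unfolding a_def using permutes_in_image[OF inv_w, of c] c by simp
    let ?w = "simple_refl (Suc c) \<circ> w"
    have i: "Suc c \<in> {1..<n}" using c by simp
    have sub: "inversions n ?w - {(b, a)} = inversions n w - {(b, a)}"
      using inversions_simple_refl[OF w i ab] ba by simp
    have "(b, a) \<in> inversions n w" using ab ba an by (simp add: inversions_def)
    moreover have "(b, a) \<notin> inversions n ?w"
      using ab by (simp add: inversions_def simple_refl_def)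
    ultimately have "inversions n w = insert (b, a) (inversions n ?w)" "(b, a) \<notin> inversions n ?w"
      using sub by auto
    then have card: "card (inversions n w) = Suc (card (inversions n ?w))"
      by (simp add: finite_inversions)
    have w': "?w permutes {..<n}" using permutes_compose[OF w simple_refl_permutes[OF i]] .
    obtain ws where ws: "set ws \<subseteq> {1..<n}" "weyl_word ws = ?w" "length ws \<le> card (inversions n ?w)"
      using less.hyps[OF _ w'] card by auto
    have "weyl_word (Suc c # ws) = simple_refl (Suc c) \<circ> weyl_word ws" by (rule weyl_word_Cons)
    then have "weyl_word (Suc c # ws) = w" using ws(2) simple_refl_involutory by simp
    then show ?thesis using ws i card by (intro exI[of _ "Suc c # ws"]) auto
  qed
qed

lemma weyl_length_eq_inversions:
  assumes w: "w permutes {..<n}"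
  shows "weyl_length n w = card (inversions n w)"
proof -
  let ?P = "\<lambda>m. \<exists>ws. set ws \<subseteq> {1..<n} \<and> weyl_word ws = w \<and> length ws = m"
  obtain ws where ws: "set ws \<subseteq> {1..<n}" "weyl_word ws = w" "length ws \<le> card (inversions n w)"
    using weyl_word_exists[OF w] by blast
  have P: "?P (length ws)" using ws by blast
  have "weyl_length n w \<le> length ws" unfolding weyl_length_def using P by (rule Least_le)
  moreover obtain vs where "set vs \<subseteq> {1..<n}" "weyl_word vs = w" "length vs = weyl_length n w"
    unfolding weyl_length_def using LeastI[of ?P, OF P] by blast
  then have "card (inversions n w) \<le> weyl_length n w"
    using card_inversions_weyl_word by metis
  ultimately show ?thesis using ws by simp
qed

text \<open>The longest element: it reverses the order of \<open>0, \<dots>, n - 1\<close>.\<close>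

definition reversal :: "nat \<Rightarrow> nat \<Rightarrow> nat" where
  "reversal n j = (if j < n then n - 1 - j else j)"

lemma reversal_permutes: "reversal n permutes {..<n}"
proof (rule bij_imp_permutes)
  show "bij_betw (reversal n) {..<n} {..<n}"
    by (rule bij_betw_byWitness[where f' = "reversal n"]) (auto simp: reversal_def)
qed (auto simp: reversal_def)

lemma longest_eq_reversal: "longest n = reversal n"
proof -
  let ?L = "weyl_length n" and ?W = "\<lambda>w. w \<in> weyl_group n"
  let ?all = "{(a, b). a < b \<and> b < n}"
  have fin: "finite ?all" by (rule finite_subset[of _ "{..<n} \<times> {..<n}"]) auto
  have W: "?W w \<longleftrightarrow> w permutes {..<n}" for w by (simp add: weyl_group_def)
  have rev_inv: "inversions n (reversal n) = ?all" by (auto simp: inversions_def reversal_def)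
  \<comment> \<open>only the reversal inverts all pairs, so it is the unique element of maximal length\<close>
  have less: "?L w < ?L (reversal n)" if w: "w permutes {..<n}" "w \<noteq> reversal n" for w
  proof -
    have "inversions n w \<noteq> ?all"
    proof
      assume eq: "inversions n w = ?all"
      have p: "(reversal n \<circ> w) permutes {..<n}" using permutes_compose[OF w(1) reversal_permutes] .
      have "reversal n \<circ> w = id"
      proof (rule permutes_mono_eq_id[OF p])
        fix a assume a: "Suc a < n"
        then have "(a, Suc a) \<in> inversions n w" using eq by simp
        moreover have "w a < n" using permutes_in_image[OF w(1), of a] a by simp
        ultimately show "(reversal n \<circ> w) a < (reversal n \<circ> w) (Suc a)"
          by (auto simp: inversions_def reversal_def)
      qed
      then have "reversal n \<circ> (reversal n \<circ> w) = reversal n" by simp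
      moreover have "reversal n \<circ> (reversal n \<circ> w) = w" by (auto simp: reversal_def fun_eq_iff)
      ultimately show False using w(2) by simp
    qed
    then have "inversions n w \<subset> ?all" by (auto simp: inversions_def)
    then show ?thesis
      using psubset_card_mono[OF fin] w(1) reversal_permutes
      by (simp add: weyl_length_eq_inversions rev_inv)
  qed
  have R: "?W (reversal n)" by (simp add: W reversal_permutes)
  have "\<forall>y. ?W y \<longrightarrow> ?L y < Suc (?L (reversal n))"
    using less W by (metis less_SucI lessI)
  from arg_max_nat_lemma[of ?W, OF R this]
  have "?W (longest n)" "?L (reversal n) \<le> ?L (longest n)"
    using R unfolding longest_def by auto
  then show ?thesis using less[of "longest n"] W by (metis not_less)
qed

text \<open>A lift of the permutation \<open>w\<close>: a matrix in \<open>SL\<^sub>n\<close> that maps the \<open>q\<close>-th basis vector to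
  \<open>\<epsilon> q = \<plusminus>1\<close> times the \<open>w q\<close>-th one.\<close>

definition signed_perm :: "nat \<Rightarrow> (nat \<Rightarrow> nat) \<Rightarrow> (nat \<Rightarrow> 'k) \<Rightarrow> 'k::field_char_0 mat \<Rightarrow> bool" where
  "signed_perm n w \<epsilon> A \<longleftrightarrow> A \<in> carrier (SL n) \<and> (\<forall>q. \<epsilon> q * \<epsilon> q = 1) \<and>
     (\<forall>p<n. \<forall>q<n. A $$ (p, q) = (if p = w q then \<epsilon> q else 0))"

lemma signed_perm_mult:
  assumes A: "signed_perm n u \<epsilon> A" and B: "signed_perm n w \<delta> B" and w: "w permutes {..<n}"
  shows "signed_perm n (u \<circ> w) (\<lambda>q. \<epsilon> (w q) * \<delta> q) (A * B)"
proof -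
  have c: "A \<in> carrier_mat n n" "B \<in> carrier_mat n n"
    using A B SL_carrier_mat by (auto simp: signed_perm_def)
  have "(A * B) $$ (p, q) = (if p = (u \<circ> w) q then \<epsilon> (w q) * \<delta> q else 0)" if pq: "p < n" "q < n" for p q
  proof -
    have wq: "w q < n" using permutes_in_image[OF w, of q] pq by simp
    have "(A * B) $$ (p, q) = (\<Sum>c<n. A $$ (p, c) * B $$ (c, q))"
      by (rule mat_mult_entry[OF c pq])
    also have "\<dots> = (\<Sum>c<n. if c = w q then A $$ (p, w q) * \<delta> q else 0)"
      using B pq by (intro sum.cong) (auto simp: signed_perm_def)
    also have "\<dots> = A $$ (p, w q) * \<delta> q" using wq by simp
    finally show ?thesis using A pq wq by (auto simp: signed_perm_def)
  qed
  moreover have "\<epsilon> (w q) * \<delta> q * (\<epsilon> (w q) * \<delta> q) = 1" for q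
  proof -
    have "\<epsilon> (w q) * \<delta> q * (\<epsilon> (w q) * \<delta> q) = (\<epsilon> (w q) * \<epsilon> (w q)) * (\<delta> q * \<delta> q)"
      by (simp only: ac_simps)
    also have "\<epsilon> (w q) * \<epsilon> (w q) = 1" using A unfolding signed_perm_def by blast
    also have "\<delta> q * \<delta> q = 1" using B unfolding signed_perm_def by blast
    finally show ?thesis by simp
  qed
  ultimately show ?thesis using A B SL_mult_closed by (auto simp: signed_perm_def simp del: index_mult_mat(1))
qed

lemma simple_lift_signed_perm:
  assumes i: "i \<in> {1..<n}"
  shows "signed_perm n (simple_refl i) (\<lambda>q. if q = i then - 1 else 1) (simple_lift n i :: 'k::field_char_0 mat)"
proof -
  let ?s = "simple_refl i"
  let ?e = "\<lambda>q. if q = i then - 1 else 1 :: 'k"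
  have s: "?s permutes {0..<n}" using simple_refl_permutes[OF i] by (simp add: atLeast0LessThan)
  have ent: "(simple_lift n i :: 'k mat) $$ (p, q) = (if p = ?s q then ?e q else 0)" if "p < n" "q < n" for p q
  proof -
    obtain k where k: "i = Suc k" using i by (cases i) auto
    consider "q = k" | "q = Suc k" | "q \<noteq> k" "q \<noteq> Suc k" by blast
    then show ?thesis
      by cases (use that k in \<open>simp_all add: simple_lift_def simple_refl_def\<close>)
  qed
  have ss: "?s (?s x) = x" for x by (simp add: simple_refl_def)
  \<comment> \<open>the lift is a diagonal matrix of determinant \<open>-1\<close> with two rows exchanged\<close>
  define D :: "'k mat" where "D = mat n n (\<lambda>(r, c). if r = c then ?e r else 0)"
  have eq: "simple_lift n i = mat n n (\<lambda>(r, c). D $$ (?s r, c))"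
  proof (rule eq_matI)
    fix p q assume pq: "p < dim_row (mat n n (\<lambda>(r, c). D $$ (?s r, c)))"
      "q < dim_col (mat n n (\<lambda>(r, c). D $$ (?s r, c)))"
    then have pq': "p < n" "q < n" "?s p < n" using permutes_in_image[OF s, of p] by auto
    then have "mat n n (\<lambda>(r, c). D $$ (?s r, c)) $$ (p, q) = (if ?s p = q then ?e (?s p) else 0)"
      by (simp add: D_def)
    also have "\<dots> = (if p = ?s q then ?e q else 0)"
      by (cases "?s p = q") (use ss[of p] ss[of q] in auto)
    finally show "simple_lift n i $$ (p, q) = mat n n (\<lambda>(r, c). D $$ (?s r, c)) $$ (p, q)"
      using ent[OF pq'(1,2)] by simp
  qed (auto simp: simple_lift_def)
  have "det D = (\<Prod>q<n. ?e q)"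
    by (subst det_upper_triangular[of _ n])
      (auto simp: D_def prod_list_diag_prod atLeast0LessThan intro!: prod.cong)
  also have "\<dots> = - 1" using i by (simp add: prod.delta)
  finally have "det D = - 1" .
  moreover have "sign ?s = (-1 :: int)" unfolding simple_refl_def using i by (subst sign_swap_id) auto
  ultimately have "det (simple_lift n i :: 'k mat) = 1"
    unfolding eq using det_permute_rows[of D n ?s] s by (simp add: D_def)
  then show ?thesis using ent by (auto simp: signed_perm_def SL_iff simple_lift_def)
qed

lemma word_lift_Cons: "word_lift n (i # ws) = simple_lift n i * word_lift n ws"
  by (simp add: word_lift_def)

lemma word_lift_signed_perm:
  "set ws \<subseteq> {1..<n} \<Longrightarrow> \<exists>\<epsilon>. signed_perm n (weyl_word ws) \<epsilon> (word_lift n ws :: 'k::field_char_0 mat)"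
proof (induction ws)
  case Nil
  then show ?case
    by (intro exI[of _ "\<lambda>_. 1"]) (auto simp: signed_perm_def word_lift_def weyl_word_def SL_one_closed)
next
  case (Cons i ws)
  then obtain \<epsilon> where "signed_perm n (weyl_word ws) \<epsilon> (word_lift n ws :: 'k mat)" by auto
  from signed_perm_mult[OF simple_lift_signed_perm this weyl_word_permutes] Cons.prems
  show ?case by (auto simp: weyl_word_Cons word_lift_Cons simp del: o_apply)
qed

lemma reduced_word_some:
  assumes "w permutes {..<n}"
  shows "reduced_word n w (SOME ws. reduced_word n w ws)"
proof (rule someI_ex)
  let ?P = "\<lambda>m. \<exists>ws. set ws \<subseteq> {1..<n} \<and> weyl_word ws = w \<and> length ws = m"
  obtain ws where "set ws \<subseteq> {1..<n}" "weyl_word ws = w" using weyl_word_exists[OF assms] by blast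
  then have "?P (length ws)" by blast
  from LeastI[of ?P, OF this] show "\<exists>ws. reduced_word n w ws"
    by (auto simp: reduced_word_def weyl_length_def)
qed

lemma weyl_lift_signed_perm:
  assumes "w permutes {..<n}"
  shows "\<exists>\<epsilon>. signed_perm n w \<epsilon> (weyl_lift n w :: 'k::field_char_0 mat)"
  using reduced_word_some[OF assms] word_lift_signed_perm[of "SOME ws. reduced_word n w ws" n]
  by (auto simp: weyl_lift_def reduced_word_def)

lemma weyl_lift_id: "weyl_lift n id = (1\<^sub>m n :: 'k::field_char_0 mat)"
proof -
  have "weyl_length n id = 0"
    by (subst weyl_length_eq_inversions) (simp_all add: permutes_id inversions_id del: id_apply)
  then have "(SOME ws. reduced_word n id ws) = []"
    using reduced_word_some[OF permutes_id, of n] by (simp add: reduced_word_def)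
  then show ?thesis by (simp add: weyl_lift_def word_lift_def)
qed

section \<open>Products of flag minors\<close>

lemma det_mat_permutes:
  "det (mat k k (\<lambda>(p, q). e p q)) = (\<Sum>\<sigma> | \<sigma> permutes {..<k}. signof \<sigma> * (\<Prod>p<k. e p (\<sigma> p)))"
proof (subst det_def'[of _ k], simp, unfold atLeast0LessThan, rule sum.cong[OF refl])
  fix \<sigma> :: "nat \<Rightarrow> nat" assume "\<sigma> \<in> {\<sigma>. \<sigma> permutes {..<k}}"
  then have "\<sigma> p < k" if "p < k" for p using that permutes_in_image[of \<sigma> "{..<k}" p] by simp
  then have "(\<Prod>p<k. mat k k (\<lambda>(p, q). e p q) $$ (p, \<sigma> p)) = (\<Prod>p<k. e p (\<sigma> p))"
    by (intro prod.cong) auto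
  then show "signof \<sigma> * (\<Prod>p<k. mat k k (\<lambda>(p, q). e p q) $$ (p, \<sigma> p)) =
      signof \<sigma> * (\<Prod>p<k. e p (\<sigma> p))" by simp
qed

text \<open>Row multilinearity of the determinant.\<close>

lemma det_sum_rows:
  fixes G :: "nat \<Rightarrow> nat \<Rightarrow> 'k::comm_ring_1"
  shows "det (mat k k (\<lambda>(p, q). \<Sum>c<n. G p c * x c q)) =
    (\<Sum>b\<in>PiE {..<k} (\<lambda>_. {..<n}). (\<Prod>p<k. G p (b p)) * det (mat k k (\<lambda>(p, q). x (b p) q)))"
proof -
  have "det (mat k k (\<lambda>(p, q). \<Sum>c<n. G p c * x c q)) =
    (\<Sum>\<sigma> | \<sigma> permutes {..<k}. signof \<sigma> * (\<Prod>p<k. \<Sum>c<n. G p c * x c (\<sigma> p)))"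
    by (rule det_mat_permutes)
  also have "\<dots> = (\<Sum>\<sigma> | \<sigma> permutes {..<k}. signof \<sigma> *
      (\<Sum>b\<in>PiE {..<k} (\<lambda>_. {..<n}). \<Prod>p<k. G p (b p) * x (b p) (\<sigma> p)))"
    by (subst prod_sum_PiE) auto
  also have "\<dots> = (\<Sum>b\<in>PiE {..<k} (\<lambda>_. {..<n}). \<Sum>\<sigma> | \<sigma> permutes {..<k}.
      signof \<sigma> * (\<Prod>p<k. G p (b p) * x (b p) (\<sigma> p)))"
    unfolding sum_distrib_left by (rule sum.swap)
  also have "\<dots> = (\<Sum>b\<in>PiE {..<k} (\<lambda>_. {..<n}). (\<Prod>p<k. G p (b p)) * det (mat k k (\<lambda>(p, q). x (b p) q)))"
    unfolding det_mat_permutes sum_distrib_left by (intro sum.cong refl) (simp add: prod.distrib ac_simps)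
  finally show ?thesis .
qed

text \<open>The minor of the rows \<open>b 0, \<dots>, b (k - 1)\<close> and the first \<open>k\<close> columns.\<close>

definition flag_minor :: "nat \<Rightarrow> (nat \<Rightarrow> nat) \<Rightarrow> 'k::comm_ring_1 mat \<Rightarrow> 'k" where
  "flag_minor k b g = det (mat k k (\<lambda>(p, q). g $$ (b p, q)))"

text \<open>A list \<open>ks\<close> of column numbers stands for the weight \<open>\<Sum>\<omega>\<^sub>k\<close> and for the tensor product of
  the corresponding exterior powers. The coordinates of the latter are indexed by a family of row
  indices for each entry of \<open>ks\<close>; \<open>flag_coord ks a g\<close> is the coordinate \<open>a\<close> of the image of the
  highest weight vector under \<open>g\<close>, and \<open>tensor_coeff ks g\<close> is the matrix by which \<open>g\<close> acts on the
  ambient tensor product of copies of the standard representation. The row indices need not increase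
  or be distinct, so exterior powers are embedded in tensor powers as antisymmetric tensors, and the
  action is given by products of entries. Row families are extensional functions, so they form a
  finite set. The weight is \<open>list_weight ks\<close>, and its character on triangular matrices is
  \<open>list_char ks\<close>; entries \<open>0\<close> and \<open>n\<close> of \<open>ks\<close> are harmless, as \<open>\<omega>\<^sub>0\<close> and \<open>\<omega>\<^sub>n\<close> represent the trivial
  weight.\<close>

definition row_families :: "nat \<Rightarrow> nat list \<Rightarrow> (nat \<Rightarrow> nat \<Rightarrow> nat) set" where
  "row_families n ks = PiE {..<length ks} (\<lambda>r. PiE {..<ks ! r} (\<lambda>_. {..<n}))"

definition flag_coord :: "nat list \<Rightarrow> (nat \<Rightarrow> nat \<Rightarrow> nat) \<Rightarrow> 'k::comm_ring_1 mat \<Rightarrow> 'k" where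
  "flag_coord ks a g = (\<Prod>r<length ks. flag_minor (ks ! r) (a r) g)"

definition tensor_coeff ::
    "nat list \<Rightarrow> 'k::comm_ring_1 mat \<Rightarrow> (nat \<Rightarrow> nat \<Rightarrow> nat) \<Rightarrow> (nat \<Rightarrow> nat \<Rightarrow> nat) \<Rightarrow> 'k" where
  "tensor_coeff ks g a b = (\<Prod>r<length ks. \<Prod>p<ks ! r. g $$ (a r p, b r p))"

definition list_weight :: "nat list \<Rightarrow> nat \<Rightarrow> int" where
  "list_weight ks j = (\<Sum>r<length ks. fund_weight (ks ! r) j)"

definition list_char :: "nat list \<Rightarrow> 'k::comm_ring_1 mat \<Rightarrow> 'k" where
  "list_char ks h = (\<Prod>r<length ks. \<Prod>j<ks ! r. h $$ (j, j))"

lemma finite_row_families: "finite (row_families n ks)"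
  unfolding row_families_def by (intro finite_PiE ballI) auto

lemma row_families_less: "a \<in> row_families n ks \<Longrightarrow> r < length ks \<Longrightarrow> p < ks ! r \<Longrightarrow> a r p < n"
  unfolding row_families_def by (auto dest!: PiE_mem)

lemma dominant_list_weight: "dominant n (list_weight ks)"
  by (auto simp: dominant_def list_weight_def fund_weight_def intro!: sum_mono)

lemma flag_minor_mult:
  assumes g: "g \<in> carrier_mat n n" "x \<in> carrier_mat n n" and k: "k \<le> n"
    and a: "\<And>p. p < k \<Longrightarrow> a p < n"
  shows "flag_minor k a (g * x) =
    (\<Sum>b\<in>PiE {..<k} (\<lambda>_. {..<n}). (\<Prod>p<k. g $$ (a p, b p)) * flag_minor k b x)"
proof -
  have "flag_minor k a (g * x) = det (mat k k (\<lambda>(p, q). \<Sum>c<n. g $$ (a p, c) * x $$ (c, q)))"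
    unfolding flag_minor_def using assms
    by (intro arg_cong[of _ _ det] cong_mat) (auto simp: mat_mult_entry[of _ n n _ n] simp del: index_mult_mat(1))
  then show ?thesis unfolding flag_minor_def by (simp only: det_sum_rows)
qed

lemma flag_coord_mult:
  assumes g: "g \<in> carrier_mat n n" "x \<in> carrier_mat n n" and ks: "\<forall>k\<in>set ks. k \<le> n"
    and a: "a \<in> row_families n ks"
  shows "flag_coord ks a (g * x) = (\<Sum>b\<in>row_families n ks. tensor_coeff ks g a b * flag_coord ks b x)"
proof -
  have "flag_coord ks a (g * x) = (\<Prod>r<length ks. \<Sum>b\<in>PiE {..<ks ! r} (\<lambda>_. {..<n}).
      (\<Prod>p<ks ! r. g $$ (a r p, b p)) * flag_minor (ks ! r) b x)"
    unfolding flag_coord_def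
    using g ks row_families_less[OF a] by (intro prod.cong refl flag_minor_mult) auto
  also have "\<dots> = (\<Sum>b\<in>row_families n ks. \<Prod>r<length ks.
      (\<Prod>p<ks ! r. g $$ (a r p, b r p)) * flag_minor (ks ! r) (b r) x)"
    unfolding row_families_def by (subst prod_sum_PiE) (auto intro: finite_PiE)
  finally show ?thesis by (simp add: flag_coord_def tensor_coeff_def prod.distrib)
qed

lemma flag_minor_mult_upper:
  assumes g: "g \<in> carrier_mat n n" "b \<in> carrier_mat n n" and k: "k \<le> n"
    and a: "\<And>p. p < k \<Longrightarrow> a p < n" and up: "\<And>i j. j < i \<Longrightarrow> i < n \<Longrightarrow> b $$ (i, j) = 0"
  shows "flag_minor k a (g * b) = flag_minor k a g * (\<Prod>j<k. b $$ (j, j))"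
proof -
  define A where "A = mat n n (\<lambda>(p, c). if p < k then g $$ (a p, c) else 0)"
  have "flag_minor k a (g * b) = det (lead k (A * b))"
    unfolding flag_minor_def lead_def
  proof (intro arg_cong[of _ _ det] cong_mat refl, clarify)
    fix p q assume pq: "p < k" "q < k"
    show "(g * b) $$ (a p, q) = (A * b) $$ (p, q)"
      using pq k a[of p] g by (simp add: mat_mult_entry[of _ n n _ n] A_def del: index_mult_mat(1))
  qed
  also have "\<dots> = det (lead k A) * (\<Prod>j<k. b $$ (j, j))"
    by (rule det_lead_mult_upper[OF _ g(2) k up]) (simp_all add: A_def)
  also have "lead k A = mat k k (\<lambda>(p, q). g $$ (a p, q))"
    using k by (auto simp: lead_def A_def intro!: eq_matI)
  finally show ?thesis by (simp add: flag_minor_def)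
qed

lemma flag_coord_mult_upper:
  assumes g: "g \<in> carrier_mat n n" "b \<in> carrier_mat n n" and ks: "\<forall>k\<in>set ks. k \<le> n"
    and a: "a \<in> row_families n ks" and up: "\<And>i j. j < i \<Longrightarrow> i < n \<Longrightarrow> b $$ (i, j) = 0"
  shows "flag_coord ks a (g * b) = list_char ks b * flag_coord ks a g"
proof -
  have "flag_coord ks a (g * b) =
      (\<Prod>r<length ks. flag_minor (ks ! r) (a r) g * (\<Prod>j<ks ! r. b $$ (j, j)))"
    unfolding flag_coord_def
    using ks row_families_less[OF a] by (intro prod.cong refl flag_minor_mult_upper[OF g _ _ up]) auto
  then show ?thesis by (simp add: flag_coord_def list_char_def prod.distrib mult.commute)
qed

lemma power_int_sum:
  "(x :: 'k::field) \<noteq> 0 \<Longrightarrow> x powi (\<Sum>r\<in>I. f r) = (\<Prod>r\<in>I. x powi f r)"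
  by (induction I rule: infinite_finite_induct) (auto simp: power_int_add)

lemma wt_char_list_weight:
  assumes h: "\<And>j. j < n \<Longrightarrow> h $$ (j, j) \<noteq> 0" and ks: "\<forall>k\<in>set ks. k \<le> n"
  shows "wt_char n (list_weight ks) h = list_char ks h"
proof -
  have "wt_char n (list_weight ks) h =
      (\<Prod>j<n. \<Prod>r<length ks. (h $$ (j, j)) powi fund_weight (ks ! r) j)"
    unfolding wt_char_def list_weight_def using h by (intro prod.cong refl power_int_sum) auto
  also have "\<dots> = (\<Prod>r<length ks. \<Prod>j<n. (h $$ (j, j)) powi fund_weight (ks ! r) j)"
    by (rule prod.swap)
  also have "\<dots> = list_char ks h"
    unfolding list_char_def
  proof (rule prod.cong[OF refl])
    fix r assume "r \<in> {..<length ks}"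
    then have "ks ! r \<le> n" using ks by auto
    then show "(\<Prod>j<n. (h $$ (j, j)) powi fund_weight (ks ! r) j) = (\<Prod>j<ks ! r. h $$ (j, j))"
      by (intro prod.mono_neutral_cong_right) (auto simp: fund_weight_def)
  qed
  finally show ?thesis .
qed

lemma flag_coord_diag_mult:
  assumes h: "h \<in> carrier_mat n n" "\<And>i j. i < n \<Longrightarrow> j < n \<Longrightarrow> i \<noteq> j \<Longrightarrow> h $$ (i, j) = 0"
    and g: "g \<in> carrier_mat n n" and ks: "\<forall>k\<in>set ks. k \<le> n" and a: "a \<in> row_families n ks"
  shows "flag_coord ks a (h * g) = (\<Prod>r<length ks. \<Prod>p<ks ! r. h $$ (a r p, a r p)) * flag_coord ks a g"
proof -
  have ent: "(h * g) $$ (i, j) = h $$ (i, i) * g $$ (i, j)" if "i < n" "j < n" for i j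
  proof -
    have "(h * g) $$ (i, j) = (\<Sum>c<n. if c = i then h $$ (i, i) * g $$ (i, j) else 0)"
      unfolding mat_mult_entry[OF h(1) g that] using h(2) that by (intro sum.cong) auto
    then show ?thesis using that by simp
  qed
  have "flag_minor (ks ! r) (a r) (h * g) =
      (\<Prod>p<ks ! r. h $$ (a r p, a r p)) * flag_minor (ks ! r) (a r) g" if r: "r < length ks" for r
  proof -
    have kn: "ks ! r \<le> n" using ks r by auto
    have e: "(h * g) $$ (a r p, q) = h $$ (a r p, a r p) * g $$ (a r p, q)" if "p < ks ! r" "q < ks ! r" for p q
      using ent[of "a r p" q] row_families_less[OF a r] that kn by simp
    have "flag_minor (ks ! r) (a r) (h * g) =
        det (mat (ks ! r) (ks ! r) (\<lambda>(p, q). h $$ (a r p, a r p) * g $$ (a r p, q)))"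
      unfolding flag_minor_def by (intro arg_cong[of _ _ det] cong_mat refl) (simp add: e)
    then show ?thesis
      unfolding flag_minor_def det_mat_permutes
      by (simp add: prod.distrib sum_distrib_left ac_simps)
  qed
  then show ?thesis by (simp add: flag_coord_def prod.distrib)
qed

lemma flag_coord_poly:
  assumes ks: "\<forall>k\<in>set ks. k \<le> n" and a: "a \<in> row_families n ks"
  shows "(\<lambda>g. flag_coord ks a g) \<in> poly_funs (mat_coords n)"
  unfolding flag_coord_def flag_minor_def
  using ks row_families_less[OF a]
  by (intro poly_funs_prod poly_funs_det poly_funs_entry) (auto, meson less_le_trans nth_mem)

text \<open>Right translates are polynomial functions too.\<close>

lemma flag_coord_translate_poly:
  assumes ks: "\<forall>k\<in>set ks. k \<le> n" and a: "a \<in> row_families n ks" and x: "x \<in> carrier_mat n n"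
  shows "\<exists>p\<in>poly_funs (mat_coords n). \<forall>g\<in>carrier_mat n n. flag_coord ks a (g * x) = p g"
proof
  let ?p = "\<lambda>g. \<Sum>b\<in>row_families n ks. tensor_coeff ks g a b * flag_coord ks b x"
  show "?p \<in> poly_funs (mat_coords n)"
    unfolding tensor_coeff_def using row_families_less[OF a] row_families_less
    by (intro poly_funs_sum poly_funs.mult poly_funs_prod poly_funs.const poly_funs_entry) auto
  show "\<forall>g\<in>carrier_mat n n. flag_coord ks a (g * x) = ?p g"
    using flag_coord_mult[OF _ x ks a] by blast
qed

lemma flag_coord_rat:
  assumes ks: "\<forall>k\<in>set ks. k \<le> n" and a: "a \<in> row_families n ks" and g: "rat_mat n g"
  shows "flag_coord ks a g \<in> \<rat>"
  unfolding flag_coord_def flag_minor_def det_mat_permutes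
proof (intro Rats_prod Rats_sum Rats_mult)
  fix r p and \<sigma> :: "nat \<Rightarrow> nat"
  assume r: "r \<in> {..<length ks}" and p: "p \<in> {..<ks ! r}" and \<sigma>: "\<sigma> \<in> {\<sigma>. \<sigma> permutes {..<ks ! r}}"
  have "\<sigma> p < ks ! r" using \<sigma> p permutes_in_image[of \<sigma> "{..<ks ! r}" p] by simp
  moreover have "ks ! r \<le> n" using r ks by auto
  ultimately show "g $$ (a r p, \<sigma> p) \<in> \<rat>"
    using g row_families_less[OF a] r p by (simp add: rat_mat_def)
qed (simp add: sign_def)

section \<open>Extremality of the highest weight\<close>

lemma sum_nat_set_ge:
  fixes B :: "nat set"
  assumes B: "finite B" "card B = k"
  shows "\<Sum>{..<k} \<le> \<Sum>B \<and> (\<Sum>{..<k} = \<Sum>B \<longrightarrow> B = {..<k})"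
proof -
  let ?K = "{..<k}"
  have 1: "\<Sum>B = \<Sum>(B \<inter> ?K) + \<Sum>(B - ?K)" using B by (metis sum.Int_Diff)
  have 2: "\<Sum>?K = \<Sum>(B \<inter> ?K) + \<Sum>(?K - B)" by (metis sum.Int_Diff finite_lessThan Int_commute)
  have c: "card (?K - B) = card (B - ?K)"
    using B card_Diff_subset_Int[of B ?K] card_Diff_subset_Int[of ?K B] by (simp add: Int_commute)
  have 3: "k * card (B - ?K) \<le> \<Sum>(B - ?K)"
    using sum_bounded_below[of "B - ?K" k "\<lambda>x. x"] by (simp add: mult.commute)
  show ?thesis
  proof (cases "?K - B = {}")
    case True
    then have "B = ?K" using B card_subset_eq[of B ?K] by auto
    then show ?thesis by simp
  next
    case False
    have "\<Sum>(?K - B) < (\<Sum>x\<in>?K - B. k)" using False by (intro sum_strict_mono) auto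
    also have "\<dots> = k * card (B - ?K)" using c by simp
    finally show ?thesis using 1 2 3 by simp
  qed
qed

lemma sum_inj_ge:
  assumes "inj_on (b :: nat \<Rightarrow> nat) {..<k}"
  shows "\<Sum>{..<k} \<le> (\<Sum>p<k. b p)" "\<Sum>{..<k} = (\<Sum>p<k. b p) \<Longrightarrow> b ` {..<k} = {..<k}"
  using sum_nat_set_ge[of "b ` {..<k}" k] sum.reindex[OF assms, of "\<lambda>x. x"] card_image[OF assms]
  by auto

text \<open>The index of the coordinate that belongs to the first rows in their natural order.\<close>

definition top_family :: "nat list \<Rightarrow> nat \<Rightarrow> nat \<Rightarrow> nat" where
  "top_family ks = (\<lambda>r\<in>{..<length ks}. \<lambda>p\<in>{..<ks ! r}. p)"

lemma top_family_in: "\<forall>k\<in>set ks. k \<le> n \<Longrightarrow> top_family ks \<in> row_families n ks"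
  unfolding top_family_def row_families_def by (auto simp: PiE_iff) (meson less_le_trans nth_mem)

lemma flag_minor_not_inj:
  assumes "\<not> inj_on b {..<k}"
  shows "flag_minor k b g = 0"
proof -
  obtain p p' where p: "p < k" "p' < k" "p \<noteq> p'" "b p = b p'" using assms by (auto simp: inj_on_def)
  show ?thesis unfolding flag_minor_def
    by (rule det_identical_rows[of _ k p p']) (use p in \<open>auto intro!: eq_vecI\<close>)
qed

lemma flag_minor_permuted:
  assumes "inj_on b {..<k}" "b ` {..<k} = {..<k}" and k: "k \<le> n"
  shows "flag_minor k b g = flag_minor k b (1\<^sub>m n) * flag_minor k (\<lambda>p. p) (g :: 'k::comm_ring_1 mat)"
proof -
  have bl: "b p < k" if "p < k" for p using assms(2) that by auto
  define \<sigma> where "\<sigma> p = (if p < k then b p else p)" for p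
  have "\<sigma> permutes {..<k}"
  proof (rule bij_imp_permutes)
    show "bij_betw \<sigma> {..<k} {..<k}"
      using assms by (auto simp: \<sigma>_def bij_betw_def inj_on_def)
  qed (simp add: \<sigma>_def)
  then have \<sigma>: "\<sigma> permutes {0..<k}" by (simp add: atLeast0LessThan)
  have eq: "flag_minor k b g = signof \<sigma> * flag_minor k (\<lambda>p. p) g" for g :: "'k mat"
  proof -
    have "flag_minor k b g =
        det (mat k k (\<lambda>(p, q). mat k k (\<lambda>(p, q). g $$ (p, q)) $$ (\<sigma> p, q)))"
      unfolding flag_minor_def using bl
      by (intro arg_cong[of _ _ det] eq_matI) (auto simp: \<sigma>_def)
    also have "\<dots> = signof \<sigma> * det (mat k k (\<lambda>(p, q). g $$ (p, q)))"
      by (rule det_permute_rows[OF _ \<sigma>]) simp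
    finally show ?thesis by (simp add: flag_minor_def)
  qed
  have "mat k k (\<lambda>(p, q). 1\<^sub>m n $$ (p, q)) = (1\<^sub>m k :: 'k mat)" using k by (intro eq_matI) auto
  then have "flag_minor k (\<lambda>p. p) (1\<^sub>m n :: 'k mat) = 1" by (simp add: flag_minor_def)
  then show ?thesis using eq[of g] eq[of "1\<^sub>m n"] by simp
qed

lemma flag_minor_cong: "(\<And>p. p < k \<Longrightarrow> b p = b' p) \<Longrightarrow> flag_minor k b g = flag_minor k b' g"
  unfolding flag_minor_def by (intro arg_cong[of _ _ det] cong_mat) auto

lemma flag_coord_top: "flag_coord ks (top_family ks) g = (\<Prod>r<length ks. flag_minor (ks ! r) (\<lambda>p. p) g)"
  unfolding flag_coord_def top_family_def by (intro prod.cong refl flag_minor_cong) auto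

lemma lead_one: "k \<le> n \<Longrightarrow> lead k (1\<^sub>m n) = 1\<^sub>m k"
  by (intro eq_matI) (auto simp: lead_def)

lemma flag_coord_top_one:
  assumes ks: "\<forall>k\<in>set ks. k \<le> n"
  shows "flag_coord ks (top_family ks) (1\<^sub>m n) = 1"
  unfolding flag_coord_top
proof (intro prod.neutral ballI)
  fix r assume "r \<in> {..<length ks}"
  then have "ks ! r \<le> n" using ks by auto
  then have "det (lead (ks ! r) (1\<^sub>m n :: 'a mat)) = 1" by (simp add: lead_one)
  then show "flag_minor (ks ! r) (\<lambda>p. p) (1\<^sub>m n :: 'a mat) = 1"
    by (simp add: flag_minor_def lead_def)
qed

text \<open>The torus element with diagonal entries \<open>2\<^bsup>n-1-2r\<^esup>\<close>. It separates the highest weight from the other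
  weights of the module.\<close>

definition reg_torus :: "nat \<Rightarrow> 'k::field_char_0 mat" where
  "reg_torus n = mat n n (\<lambda>(r, c). if r = c then 2 ^ (n - 1 - r) / 2 ^ r else 0)"

lemma reg_torus_Torus: "reg_torus n \<in> Torus n"
proof -
  have "det (reg_torus n :: 'a mat) = (\<Prod>j<n. 2 ^ (n - 1 - j) / 2 ^ j)"
    by (subst det_upper_triangular[of _ n])
      (auto simp: reg_torus_def prod_list_diag_prod atLeast0LessThan intro!: prod.cong)
  also have "\<dots> = (\<Prod>j<n. 2 ^ (n - Suc j)) / (\<Prod>j<n. 2 ^ j)" by (simp add: prod_dividef)
  also have "(\<Prod>j<n. 2 ^ (n - Suc j)) = (\<Prod>j<n. (2 :: 'a) ^ j)"
    by (rule prod.nat_diff_reindex)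
  finally show ?thesis by (auto simp: Torus_def Bplus_def Bminus_def SL_iff reg_torus_def)
qed

text \<open>The eigenvalue of the regular torus element on the coordinate \<open>a\<close>.\<close>

definition reg_value :: "nat \<Rightarrow> nat list \<Rightarrow> (nat \<Rightarrow> nat \<Rightarrow> nat) \<Rightarrow> 'k::field_char_0" where
  "reg_value n ks a = (\<Prod>r<length ks. \<Prod>p<ks ! r. reg_torus n $$ (a r p, a r p))"

text \<open>The highest weight space is one-dimensional: where the regular torus element acts by its
  value on the highest weight, the coordinates are proportional to those of the highest weight
  vector.\<close>

lemma flag_coord_extremal:
  fixes g :: "'k::field_char_0 mat"
  assumes ks: "\<forall>k\<in>set ks. k \<le> n" and a: "a \<in> row_families n ks"
    and eq: "(reg_value n ks a :: 'k) = reg_value n ks (top_family ks)"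
  shows "flag_coord ks a g = flag_coord ks a (1\<^sub>m n) * flag_coord ks (top_family ks) g"
proof (cases "\<forall>r<length ks. inj_on (a r) {..<ks ! r}")
  case False
  then obtain r where "r < length ks" "\<not> inj_on (a r) {..<ks ! r}" by blast
  then have "flag_coord ks a g = 0" for g :: "'k mat"
    unfolding flag_coord_def using flag_minor_not_inj by (intro prod_zero) auto
  then show ?thesis by simp
next
  case True
  let ?S = "\<lambda>a. \<Sum>r<length ks. \<Sum>p<ks ! r. a r p"
  let ?N = "\<lambda>a. \<Sum>r<length ks. \<Sum>p<ks ! r. (n - 1 - a r p)"
  have val: "(reg_value n ks a :: 'k) = 2 ^ ?N a / 2 ^ ?S a \<and> ?N a + ?S a = (\<Sum>r<length ks. \<Sum>p<ks ! r. n - 1)"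
    if a: "a \<in> row_families n ks" for a
  proof
    have "(reg_value n ks a :: 'k) = (\<Prod>r<length ks. \<Prod>p<ks ! r. 2 ^ (n - 1 - a r p) / 2 ^ a r p)"
      unfolding reg_value_def using row_families_less[OF a]
      by (intro prod.cong refl) (simp add: reg_torus_def)
    then show "(reg_value n ks a :: 'k) = 2 ^ ?N a / 2 ^ ?S a"
      by (simp add: prod_dividef power_sum)
    have "n - 1 - a r p + a r p = n - 1" if "r < length ks" "p < ks ! r" for r p
      using row_families_less[OF a that] by simp
    then show "?N a + ?S a = (\<Sum>r<length ks. \<Sum>p<ks ! r. n - 1)"
      unfolding sum.distrib[symmetric] by (intro sum.cong refl) auto
  qed
  let ?t = "top_family ks"
  note va = val[OF a] and vt = val[OF top_family_in[OF ks]]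
  have "(2 :: 'k) ^ ?N a / 2 ^ ?S a = 2 ^ ?N ?t / 2 ^ ?S ?t" using va vt eq by simp
  then have "(2 :: 'k) ^ (?N a + ?S ?t) = 2 ^ (?N ?t + ?S a)" by (simp add: field_simps power_add)
  then have "(of_nat (2 ^ (?N a + ?S ?t)) :: 'k) = of_nat (2 ^ (?N ?t + ?S a))" by simp
  then have "(2 :: nat) ^ (?N a + ?S ?t) = 2 ^ (?N ?t + ?S a)" unfolding of_nat_eq_iff .
  then have "?N a + ?S ?t = ?N ?t + ?S a" by simp
  \<comment> \<open>the sums of the row indices agree, and the sum for \<open>ks ! r\<close> distinct indices is minimal\<close>
  then have S: "?S a = ?S ?t" using va vt by linarith
  have top: "(\<Sum>p<ks ! r. ?t r p) = \<Sum>{..<ks ! r}" if "r < length ks" for r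
    using that by (intro sum.cong) (auto simp: top_family_def)
  have le: "\<Sum>{..<ks ! r} \<le> (\<Sum>p<ks ! r. a r p)" if "r < length ks" for r
    using sum_inj_ge(1) True that by blast
  have "(\<Sum>p<ks ! r. a r p) = \<Sum>{..<ks ! r}" if r: "r < length ks" for r
  proof (rule ccontr)
    assume ne: "(\<Sum>p<ks ! r. a r p) \<noteq> \<Sum>{..<ks ! r}"
    have "(\<Sum>r<length ks. \<Sum>{..<ks ! r}) < ?S a"
      by (rule sum_strict_mono_ex1) (use le ne r in \<open>auto intro!: bexI[of _ r] simp: le_neq_implies_less\<close>)
    also have "?S a = (\<Sum>r<length ks. \<Sum>{..<ks ! r})" unfolding S
      by (intro sum.cong) (auto simp: top_family_def)
    finally show False by simp
  qed
  then have im: "a r ` {..<ks ! r} = {..<ks ! r}" if "r < length ks" for r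
    using sum_inj_ge(2)[of "a r" "ks ! r"] True that by simp
  have "flag_minor (ks ! r) (a r) g = flag_minor (ks ! r) (a r) (1\<^sub>m n) * flag_minor (ks ! r) (\<lambda>p. p) g"
    if "r < length ks" for r
    using flag_minor_permuted[of "a r" "ks ! r" n g] True im that ks by simp
  then show ?thesis unfolding flag_coord_top by (simp add: flag_coord_def prod.distrib)
qed

section \<open>Irreducible modules spanned by an orbit\<close>

text \<open>A dual system for the span of the functions \<open>v a\<close>, \<open>a \<in> \<Omega>\<close>, on the set \<open>S\<close>: a basis \<open>\<phi>\<close> that is
  dual to the evaluations at the points \<open>X\<close> of \<open>S\<close>.\<close>

definition dual_system ::
    "'a set \<Rightarrow> ('a \<Rightarrow> 'x \<Rightarrow> 'k::field) \<Rightarrow> 'x set \<Rightarrow> nat \<Rightarrow> (nat \<Rightarrow> 'x \<Rightarrow> 'k) \<Rightarrow> (nat \<Rightarrow> 'x) \<Rightarrow> bool" where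
  "dual_system \<Omega> v S d \<phi> X \<longleftrightarrow> (\<forall>i<d. X i \<in> S) \<and>
    (\<forall>i<d. \<exists>l. \<forall>g. \<phi> i g = (\<Sum>a\<in>\<Omega>. l a * v a g)) \<and>
    (\<forall>i<d. \<forall>j<d. \<phi> i (X j) = (if i = j then 1 else 0)) \<and>
    (\<forall>a\<in>\<Omega>. \<forall>g\<in>S. v a g = (\<Sum>i<d. v a (X i) * \<phi> i g))"

lemma dual_system_exists:
  fixes v :: "'a \<Rightarrow> 'x \<Rightarrow> 'k::field"
  assumes "finite \<Omega>"
  shows "\<exists>d \<phi> X. dual_system \<Omega> v S d \<phi> X"
  using assms
proof induction
  case empty
  show ?case by (intro exI[of _ 0]) (simp add: dual_system_def)
next
  case (insert a \<Omega>)
  obtain d \<phi> X where "dual_system \<Omega> v S d \<phi> X" using insert.IH by blast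
  then have X: "\<And>i. i < d \<Longrightarrow> X i \<in> S"
    and lin: "\<And>i. i < d \<Longrightarrow> \<exists>l. \<forall>g. \<phi> i g = (\<Sum>a\<in>\<Omega>. l a * v a g)"
    and dual: "\<And>i j. i < d \<Longrightarrow> j < d \<Longrightarrow> \<phi> i (X j) = (if i = j then 1 else 0)"
    and exp: "\<And>a g. a \<in> \<Omega> \<Longrightarrow> g \<in> S \<Longrightarrow> v a g = (\<Sum>i<d. v a (X i) * \<phi> i g)"
    unfolding dual_system_def by blast+
  obtain l where l: "\<And>i g. i < d \<Longrightarrow> \<phi> i g = (\<Sum>b\<in>\<Omega>. l i b * v b g)"
    using lin by metis
  define w where "w g = v a g - (\<Sum>i<d. v a (X i) * \<phi> i g)" for g
  define lw where "lw b = (if b = a then 1 else - (\<Sum>i<d. v a (X i) * l i b))" for b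
  have w_lin: "w g = (\<Sum>b\<in>insert a \<Omega>. lw b * v b g)" for g
  proof -
    have "(\<Sum>i<d. v a (X i) * \<phi> i g) = (\<Sum>i<d. \<Sum>b\<in>\<Omega>. v a (X i) * l i b * v b g)"
      using l by (intro sum.cong) (auto simp: sum_distrib_left ac_simps)
    also have "\<dots> = (\<Sum>b\<in>\<Omega>. (\<Sum>i<d. v a (X i) * l i b) * v b g)"
      unfolding sum_distrib_right by (rule sum.swap)
    finally have *: "(\<Sum>i<d. v a (X i) * \<phi> i g) = (\<Sum>b\<in>\<Omega>. (\<Sum>i<d. v a (X i) * l i b) * v b g)" .
    have "(\<Sum>b\<in>\<Omega>. lw b * v b g) = - (\<Sum>i<d. v a (X i) * \<phi> i g)"
    proof -
      have "(\<Sum>b\<in>\<Omega>. lw b * v b g) = (\<Sum>b\<in>\<Omega>. - ((\<Sum>i<d. v a (X i) * l i b) * v b g))"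
        using insert.hyps by (intro sum.cong) (auto simp: lw_def)
      then show ?thesis using * by (simp add: sum_negf)
    qed
    then show ?thesis using insert.hyps by (simp add: w_def lw_def)
  qed
  have lin': "\<exists>l. \<forall>g. \<phi> i g = (\<Sum>a\<in>insert a \<Omega>. l a * v a g)" if "i < d" for i
    using insert.hyps l[OF that]
    by (intro exI[of _ "\<lambda>b. if b = a then 0 else l i b"]) (auto intro!: sum.cong)
  show ?case
  proof (cases "\<forall>g\<in>S. w g = 0")
    case True
    then have "v b g = (\<Sum>i<d. v b (X i) * \<phi> i g)" if "b \<in> insert a \<Omega>" "g \<in> S" for b g
      using that exp by (auto simp: w_def)
    then have "dual_system (insert a \<Omega>) v S d \<phi> X"
      unfolding dual_system_def using X lin' dual by blast
    then show ?thesis by blast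
  next
    case False
    then obtain x where x: "x \<in> S" "w x \<noteq> 0" by blast
    have wX: "w (X j) = 0" if "j < d" for j
    proof -
      have "(\<Sum>i<d. v a (X i) * \<phi> i (X j)) = (\<Sum>i<d. if i = j then v a (X j) else 0)"
        using dual that by (intro sum.cong) auto
      also have "\<dots> = v a (X j)" using that by simp
      finally show ?thesis by (simp add: w_def)
    qed
    \<comment> \<open>a new function that vanishes at the old points, and a new point where its value is \<open>1\<close>\<close>
    define \<psi> where "\<psi> g = w g / w x" for g
    define \<phi>' where "\<phi>' i = (if i = d then \<psi> else (\<lambda>g. \<phi> i g - \<phi> i x * \<psi> g))" for i
    define X' where "X' i = (if i = d then x else X i)" for i
    have sum': "(\<Sum>i<Suc d. v b (X' i) * \<phi>' i g) =
        (\<Sum>i<d. v b (X i) * \<phi> i g) + (v b x - (\<Sum>i<d. v b (X i) * \<phi> i x)) * \<psi> g" for b g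
    proof -
      have "(\<Sum>i<Suc d. v b (X' i) * \<phi>' i g) =
          (\<Sum>i<d. v b (X i) * (\<phi> i g - \<phi> i x * \<psi> g)) + v b x * \<psi> g"
        by (simp add: X'_def \<phi>'_def)
      then show ?thesis by (simp add: algebra_simps sum_subtractf sum_distrib_left sum_distrib_right)
    qed
    have "v b g = (\<Sum>i<Suc d. v b (X' i) * \<phi>' i g)" if b: "b \<in> insert a \<Omega>" and g: "g \<in> S" for b g
    proof (cases "b = a")
      case True
      have "(v a x - (\<Sum>i<d. v a (X i) * \<phi> i x)) * \<psi> g = w g"
        using x(2) by (simp add: \<psi>_def w_def)
      then show ?thesis unfolding True sum' by (simp add: w_def)
    next
      case False
      then have "b \<in> \<Omega>" using b by simp
      then show ?thesis unfolding sum' using exp[of b g] exp[of b x] g x by simp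
    qed
    moreover have "\<exists>l. \<forall>g. \<phi>' i g = (\<Sum>a\<in>insert a \<Omega>. l a * v a g)" if i: "i < Suc d" for i
    proof (cases "i = d")
      case True
      then show ?thesis
        by (intro exI[of _ "\<lambda>b. lw b / w x"])
          (simp add: \<phi>'_def \<psi>_def w_lin sum_divide_distrib del: sum.insert)
    next
      case False
      then obtain m where m: "\<And>g. \<phi> i g = (\<Sum>a\<in>insert a \<Omega>. m a * v a g)" using lin' i by fastforce
      have "\<phi>' i g = (\<Sum>b\<in>insert a \<Omega>. (m b - \<phi> i x * (lw b / w x)) * v b g)" for g
      proof -
        have "\<phi>' i g = (\<Sum>b\<in>insert a \<Omega>. m b * v b g) - \<phi> i x * ((\<Sum>b\<in>insert a \<Omega>. lw b * v b g) / w x)"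
          using False by (simp only: \<phi>'_def \<psi>_def m[of g] w_lin[of g] if_False)
        then show ?thesis
          by (simp only: sum_distrib_left sum_divide_distrib sum_subtractf[symmetric])
            (simp add: algebra_simps del: sum.insert)
      qed
      then show ?thesis by (intro exI[of _ "\<lambda>b. m b - \<phi> i x * (lw b / w x)"] allI)
    qed
    moreover have "\<phi>' i (X' j) = (if i = j then 1 else 0)" if "i < Suc d" "j < Suc d" for i j
      using that x wX[of j] dual[of i j] by (auto simp: \<phi>'_def X'_def \<psi>_def)
    moreover have "X' i \<in> S" if "i < Suc d" for i
      using that x X by (auto simp: X'_def)
    ultimately have "dual_system (insert a \<Omega>) v S (Suc d) \<phi>' X'"
      unfolding dual_system_def by blast
    then show ?thesis by blast
  qed
qed

text \<open>The functions on \<open>SL\<^sub>n\<close> that are linear in the orbit map \<open>g \<mapsto> (flag_coord ks a g)\<^sub>a\<close>, that is,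
  the matrix coefficients of the highest weight vector.\<close>

definition orbit_funs :: "nat \<Rightarrow> nat list \<Rightarrow> ('k::field_char_0 mat \<Rightarrow> 'k) set" where
  "orbit_funs n ks = {\<psi>. \<exists>l. \<forall>g\<in>carrier (SL n). \<psi> g = (\<Sum>a\<in>row_families n ks. l a * flag_coord ks a g)}"

lemma orbit_funs_translate:
  assumes ks: "\<forall>k\<in>set ks. k \<le> n" and \<psi>: "\<psi> \<in> orbit_funs n ks" and h: "h \<in> carrier (SL n)"
  shows "(\<lambda>g. \<psi> (h * g)) \<in> orbit_funs n ks"
proof -
  let ?R = "row_families n ks"
  obtain l where l: "\<And>g. g \<in> carrier (SL n) \<Longrightarrow> \<psi> g = (\<Sum>a\<in>?R. l a * flag_coord ks a g)"
    using \<psi> by (auto simp: orbit_funs_def)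
  have "\<psi> (h * g) = (\<Sum>b\<in>?R. (\<Sum>a\<in>?R. l a * tensor_coeff ks h a b) * flag_coord ks b g)"
    if g: "g \<in> carrier (SL n)" for g
  proof -
    have "\<psi> (h * g) = (\<Sum>a\<in>?R. l a * (\<Sum>b\<in>?R. tensor_coeff ks h a b * flag_coord ks b g))"
      unfolding l[OF SL_mult_closed[OF h g]]
      using flag_coord_mult[OF SL_carrier_mat[OF h] SL_carrier_mat[OF g] ks] by (intro sum.cong) auto
    also have "\<dots> = (\<Sum>a\<in>?R. \<Sum>b\<in>?R. l a * tensor_coeff ks h a b * flag_coord ks b g)"
      by (simp add: sum_distrib_left ac_simps)
    also have "\<dots> = (\<Sum>b\<in>?R. (\<Sum>a\<in>?R. l a * tensor_coeff ks h a b) * flag_coord ks b g)"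
      unfolding sum_distrib_right by (rule sum.swap)
    finally show ?thesis .
  qed
  then show ?thesis unfolding orbit_funs_def mem_Collect_eq
    by (intro exI[of _ "\<lambda>b. \<Sum>a\<in>?R. l a * tensor_coeff ks h a b"]) blast
qed

lemma orbit_funs_mult_upper:
  assumes ks: "\<forall>k\<in>set ks. k \<le> n" and \<psi>: "\<psi> \<in> orbit_funs n ks"
    and g: "g \<in> carrier (SL n)" and b: "b \<in> carrier (SL n)"
    and up: "\<And>i j. j < i \<Longrightarrow> i < n \<Longrightarrow> b $$ (i, j) = 0"
  shows "\<psi> (g * b) = list_char ks b * \<psi> g"
proof -
  obtain l where l: "\<And>g. g \<in> carrier (SL n) \<Longrightarrow> \<psi> g = (\<Sum>a\<in>row_families n ks. l a * flag_coord ks a g)"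
    using \<psi> by (auto simp: orbit_funs_def)
  show ?thesis
    unfolding l[OF SL_mult_closed[OF g b]] l[OF g] sum_distrib_left
    using flag_coord_mult_upper[OF SL_carrier_mat[OF g] SL_carrier_mat[OF b] ks _ up]
    by (intro sum.cong) (auto simp: ac_simps)
qed

lemma orbit_funs_right_translate_poly:
  assumes ks: "\<forall>k\<in>set ks. k \<le> n" and \<psi>: "\<psi> \<in> orbit_funs n ks" and x: "x \<in> carrier (SL n)"
  shows "\<exists>p\<in>poly_funs (mat_coords n). \<forall>g\<in>carrier (SL n). \<psi> (g * x) = p g"
proof -
  let ?R = "row_families n ks"
  obtain l where l: "\<And>g. g \<in> carrier (SL n) \<Longrightarrow> \<psi> g = (\<Sum>a\<in>?R. l a * flag_coord ks a g)"
    using \<psi> by (auto simp: orbit_funs_def)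
  have "\<forall>a\<in>?R. \<exists>p. p \<in> poly_funs (mat_coords n) \<and>
      (\<forall>g\<in>carrier_mat n n. flag_coord ks a (g * x) = p g)"
    using flag_coord_translate_poly[OF ks _ SL_carrier_mat[OF x]] by blast
  from bchoice[OF this] obtain p where p: "\<forall>a\<in>?R. p a \<in> poly_funs (mat_coords n) \<and>
      (\<forall>g\<in>carrier_mat n n. flag_coord ks a (g * x) = p a g)" ..
  have p1: "p a \<in> poly_funs (mat_coords n)" if "a \<in> ?R" for a using bspec[OF p that] ..
  have p2: "flag_coord ks a (g * x) = p a g" if "a \<in> ?R" "g \<in> carrier (SL n)" for a g
    using bspec[OF conjunct2[OF bspec[OF p that(1)]] SL_carrier_mat[OF that(2)]] .
  show ?thesis
  proof (intro bexI[of _ "\<lambda>g. \<Sum>a\<in>?R. l a * p a g"] ballI)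
    show "(\<lambda>g. \<Sum>a\<in>?R. l a * p a g) \<in> poly_funs (mat_coords n)"
      by (intro poly_funs_sum poly_funs.mult poly_funs.const p1)
    fix g :: "'a mat" assume g: "g \<in> carrier (SL n)"
    show "\<psi> (g * x) = (\<Sum>a\<in>?R. l a * p a g)"
      unfolding l[OF SL_mult_closed[OF g x]] using p2[OF _ g] by (intro sum.cong) auto
  qed
qed

lemma orbit_funs_sum:
  assumes "\<And>i. i \<in> I \<Longrightarrow> \<psi> i \<in> orbit_funs n ks"
  shows "(\<lambda>g. \<Sum>i\<in>I. c i * \<psi> i g) \<in> orbit_funs n ks"
proof -
  let ?R = "row_families n ks"
  have "\<forall>i\<in>I. \<exists>l. \<forall>g\<in>carrier (SL n). \<psi> i g = (\<Sum>a\<in>?R. l a * flag_coord ks a g)"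
    using assms by (auto simp: orbit_funs_def)
  from bchoice[OF this] obtain l where
    l: "\<forall>i\<in>I. \<forall>g\<in>carrier (SL n). \<psi> i g = (\<Sum>a\<in>?R. l i a * flag_coord ks a g)" by blast
  have "(\<Sum>i\<in>I. c i * \<psi> i g) = (\<Sum>a\<in>?R. (\<Sum>i\<in>I. c i * l i a) * flag_coord ks a g)"
    if g: "g \<in> carrier (SL n)" for g
  proof -
    have "(\<Sum>i\<in>I. c i * \<psi> i g) = (\<Sum>i\<in>I. \<Sum>a\<in>?R. c i * l i a * flag_coord ks a g)"
      using l g by (intro sum.cong) (auto simp: sum_distrib_left ac_simps)
    also have "\<dots> = (\<Sum>a\<in>?R. (\<Sum>i\<in>I. c i * l i a) * flag_coord ks a g)"
      unfolding sum_distrib_right by (rule sum.swap)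
    finally show ?thesis .
  qed
  then show ?thesis unfolding orbit_funs_def mem_Collect_eq
    by (intro exI[of _ "\<lambda>a. \<Sum>i\<in>I. c i * l i a"] ballI)
qed

text \<open>The model of \<open>V\<^sub>\<lambda>\<close>: the dual of \<open>orbit_funs n ks\<close>, with the evaluations at rational matrices
  \<open>X i\<close> as basis. The vector \<open>cvec g\<close> is the evaluation at \<open>g\<close>, the image of the highest weight
  vector \<open>cvec 1\<close> under \<open>g\<close>, and \<open>coord w a\<close> is the coordinate \<open>a\<close> of \<open>w\<close> in the ambient tensor
  product.\<close>

locale orbit_module =
  fixes n :: nat and ks :: "nat list" and d :: nat
    and \<phi> :: "nat \<Rightarrow> 'k::field_char_0 mat \<Rightarrow> 'k" and X :: "nat \<Rightarrow> 'k mat"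
  assumes ks: "\<forall>k\<in>set ks. k \<le> n"
    and X_SL: "\<And>i. i < d \<Longrightarrow> X i \<in> carrier (SL n)"
    and X_rat: "\<And>i. i < d \<Longrightarrow> rat_mat n (X i)"
    and \<phi>_orbit: "\<And>i. i < d \<Longrightarrow> \<phi> i \<in> orbit_funs n ks"
    and dual: "\<And>i j. i < d \<Longrightarrow> j < d \<Longrightarrow> \<phi> i (X j) = (if i = j then 1 else 0)"
    and expand: "\<And>\<psi> g. \<psi> \<in> orbit_funs n ks \<Longrightarrow> g \<in> carrier (SL n) \<Longrightarrow>
       \<psi> g = (\<Sum>i<d. \<psi> (X i) * \<phi> i g)"
begin

definition rep :: "'k mat \<Rightarrow> 'k mat" where
  "rep g = mat d d (\<lambda>(j, i). \<phi> j (g * X i))"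

definition cvec :: "'k mat \<Rightarrow> 'k vec" where
  "cvec g = vec d (\<lambda>j. \<phi> j g)"

definition coord :: "'k vec \<Rightarrow> (nat \<Rightarrow> nat \<Rightarrow> nat) \<Rightarrow> 'k" where
  "coord w a = (\<Sum>i<d. w $ i * flag_coord ks a (X i))"

lemma rep_carrier [simp]: "rep g \<in> carrier_mat d d"
  by (simp add: rep_def)

lemma cvec_carrier [simp]: "cvec g \<in> carrier_vec d"
  by (simp add: cvec_def)

lemma rep_vec: "w \<in> carrier_vec d \<Longrightarrow> j < d \<Longrightarrow> (rep g *\<^sub>v w) $ j = (\<Sum>i<d. \<phi> j (g * X i) * w $ i)"
  by (auto simp: rep_def scalar_prod_def atLeast0LessThan intro!: sum.cong)

lemma \<phi>_translate: "j < d \<Longrightarrow> h \<in> carrier (SL n) \<Longrightarrow> g \<in> carrier (SL n) \<Longrightarrow>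
    \<phi> j (h * g) = (\<Sum>i<d. \<phi> j (h * X i) * \<phi> i g)"
  using expand[OF orbit_funs_translate[OF ks \<phi>_orbit]] by blast

lemma rep_cvec:
  assumes "h \<in> carrier (SL n)" "g \<in> carrier (SL n)"
  shows "rep h *\<^sub>v cvec g = cvec (h * g)"
proof (rule eq_vecI)
  fix j assume "j < dim_vec (cvec (h * g))"
  then have j: "j < d" by (simp add: cvec_def)
  have "(rep h *\<^sub>v cvec g) $ j = (\<Sum>i<d. \<phi> j (h * X i) * \<phi> i g)"
    unfolding rep_vec[OF cvec_carrier j] by (intro sum.cong) (auto simp: cvec_def)
  then show "(rep h *\<^sub>v cvec g) $ j = cvec (h * g) $ j"
    using \<phi>_translate[OF j assms] j by (simp add: cvec_def)
qed (simp add: rep_def cvec_def)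

lemma rep_mult:
  assumes g: "g \<in> carrier (SL n)" and h: "h \<in> carrier (SL n)"
  shows "rep (g * h) = rep g * rep h"
proof (rule eq_matI)
  fix j i assume "j < dim_row (rep g * rep h)" "i < dim_col (rep g * rep h)"
  then have ji: "j < d" "i < d" by (auto simp: rep_def)
  have "rep (g * h) $$ (j, i) = \<phi> j (g * (h * X i))"
    using ji SL_assoc[OF g h X_SL] by (simp add: rep_def)
  also have "\<dots> = (\<Sum>k<d. \<phi> j (g * X k) * \<phi> k (h * X i))"
    using \<phi>_translate[OF ji(1) g SL_mult_closed[OF h X_SL]] ji by simp
  also have "\<dots> = (rep g * rep h) $$ (j, i)"
    unfolding mat_mult_entry[OF rep_carrier rep_carrier ji]
    using ji by (intro sum.cong) (auto simp: rep_def)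
  finally show "rep (g * h) $$ (j, i) = (rep g * rep h) $$ (j, i)" .
qed (auto simp: rep_def)

lemma rep_one: "rep (1\<^sub>m n) = 1\<^sub>m d"
proof (rule eq_matI)
  fix j i assume "j < dim_row (1\<^sub>m d :: 'k mat)" "i < dim_col (1\<^sub>m d :: 'k mat)"
  then show "rep (1\<^sub>m n) $$ (j, i) = 1\<^sub>m d $$ (j, i)"
    using SL_carrier_mat[OF X_SL, of i] dual[of j i] by (simp add: rep_def left_mult_one_mat[of _ n n])
qed (auto simp: rep_def)

lemma rational_rep: "rational_rep n d rep"
  unfolding rational_rep_def
proof (intro conjI ballI allI impI)
  fix j i assume ji: "j < d" "i < d"
  from orbit_funs_right_translate_poly[OF ks \<phi>_orbit[OF ji(1)] X_SL[OF ji(2)]]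
  obtain p where p: "p \<in> poly_funs (mat_coords n)" and
    eq: "\<forall>g\<in>carrier (SL n). \<phi> j (g * X i) = p g" by (elim bexE)
  have "\<forall>g\<in>carrier (SL n). restrict (\<lambda>g. rep g $$ (j, i)) (carrier (SL n)) g = p g"
    using ji eq by (simp add: rep_def)
  then show "restrict (\<lambda>g. rep g $$ (j, i)) (carrier (SL n)) \<in> O_SL n"
    unfolding O_SL_def using p by (intro CollectI conjI restrict_extensional bexI[of _ p])
qed (simp_all add: rep_mult rep_one)

lemma flag_coord_orbit:
  "a \<in> row_families n ks \<Longrightarrow> (flag_coord ks a :: 'k mat \<Rightarrow> 'k) \<in> orbit_funs n ks"
proof -
  assume a: "a \<in> row_families n ks"
  have "flag_coord ks a g = (\<Sum>b\<in>row_families n ks. (if b = a then 1 else 0) * flag_coord ks b g)"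
    for g :: "'k mat"
  proof -
    have "(\<Sum>b\<in>row_families n ks. (if b = a then 1 else 0) * flag_coord ks b g) =
        (\<Sum>b\<in>row_families n ks. if b = a then flag_coord ks a g else 0)"
      by (intro sum.cong) auto
    then show ?thesis using a finite_row_families[of n ks] by simp
  qed
  then show ?thesis unfolding orbit_funs_def mem_Collect_eq
    by (intro exI[of _ "\<lambda>b. if b = a then 1 else 0"] ballI)
qed

text \<open>The pairing of a vector with a matrix coefficient is equivariant.\<close>

lemma pairing_rep:
  assumes g: "g \<in> carrier (SL n)" and w: "w \<in> carrier_vec d" and \<psi>: "\<psi> \<in> orbit_funs n ks"
  shows "(\<Sum>j<d. (rep g *\<^sub>v w) $ j * \<psi> (X j)) = (\<Sum>i<d. w $ i * \<psi> (g * X i))"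
proof -
  have "(\<Sum>j<d. (rep g *\<^sub>v w) $ j * \<psi> (X j)) = (\<Sum>j<d. \<Sum>i<d. w $ i * (\<psi> (X j) * \<phi> j (g * X i)))"
    using w rep_vec[OF w]
    by (intro sum.cong refl) (simp add: sum_distrib_left sum_distrib_right ac_simps del: index_mult_mat_vec)
  also have "\<dots> = (\<Sum>i<d. w $ i * (\<Sum>j<d. \<psi> (X j) * \<phi> j (g * X i)))"
    unfolding sum_distrib_left by (rule sum.swap)
  also have "\<dots> = (\<Sum>i<d. w $ i * \<psi> (g * X i))"
    using expand[OF \<psi> SL_mult_closed[OF g X_SL]] by (intro sum.cong) auto
  finally show ?thesis .
qed

lemma pairing_cvec:
  assumes "g \<in> carrier (SL n)" "\<psi> \<in> orbit_funs n ks"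
  shows "(\<Sum>j<d. cvec g $ j * \<psi> (X j)) = \<psi> g"
  using expand[OF assms(2,1)] by (simp add: cvec_def mult.commute)

lemma coord_rep:
  assumes "g \<in> carrier (SL n)" "w \<in> carrier_vec d" "a \<in> row_families n ks"
  shows "coord (rep g *\<^sub>v w) a = (\<Sum>i<d. w $ i * flag_coord ks a (g * X i))"
  unfolding coord_def by (rule pairing_rep[OF assms(1,2) flag_coord_orbit[OF assms(3)]])

lemma coord_cvec:
  assumes "g \<in> carrier (SL n)" "a \<in> row_families n ks"
  shows "coord (cvec g) a = flag_coord ks a g"
  unfolding coord_def by (rule pairing_cvec[OF assms(1) flag_coord_orbit[OF assms(2)]])

lemma coord_smult: "w \<in> carrier_vec d \<Longrightarrow> coord (c \<cdot>\<^sub>v w) a = c * coord w a"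
  by (simp add: coord_def sum_distrib_left ac_simps)

lemma coord_inj:
  assumes w: "w \<in> carrier_vec d" "w' \<in> carrier_vec d"
    and eq: "\<And>a. a \<in> row_families n ks \<Longrightarrow> coord w a = coord w' a"
  shows "w = w'"
proof (rule eq_vecI)
  fix j assume "j < dim_vec w'"
  then have j: "j < d" using w by simp
  obtain l where l: "\<And>g. g \<in> carrier (SL n) \<Longrightarrow> \<phi> j g = (\<Sum>a\<in>row_families n ks. l a * flag_coord ks a g)"
    using \<phi>_orbit[OF j] by (auto simp: orbit_funs_def)
  have "w $ j = (\<Sum>a\<in>row_families n ks. l a * coord w a)" if "w \<in> carrier_vec d" for w
  proof -
    have "w $ j = (\<Sum>i<d. if i = j then w $ j else 0)" using j by simp
    also have "\<dots> = (\<Sum>i<d. w $ i * \<phi> j (X i))" using dual j by (intro sum.cong) auto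
    also have "\<dots> = (\<Sum>i<d. \<Sum>a\<in>row_families n ks. l a * (w $ i * flag_coord ks a (X i)))"
      using l[OF X_SL] by (intro sum.cong) (auto simp: sum_distrib_left ac_simps)
    also have "\<dots> = (\<Sum>a\<in>row_families n ks. l a * coord w a)"
      unfolding coord_def sum_distrib_left by (rule sum.swap)
    finally show ?thesis .
  qed
  then show "w $ j = w' $ j" using w eq by simp
qed (use w in auto)

text \<open>The standard symmetric form is nondegenerate on the span of the orbit: on the rational points
  it is positive definite, so its Gram matrix with respect to a rational basis is invertible.\<close>

lemma form_nondegenerate:
  assumes w: "w \<in> carrier_vec d" "w \<noteq> 0\<^sub>v d"
  shows "\<exists>j<d. (\<Sum>a\<in>row_families n ks. coord w a * flag_coord ks a (X j)) \<noteq> 0"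
proof (rule ccontr)
  let ?R = "row_families n ks"
  assume neg: "\<not> ?thesis"
  have "\<forall>a\<in>?R. \<forall>i<d. \<exists>q. flag_coord ks a (X i) = of_rat q"
    using flag_coord_rat[OF ks _ X_rat] by (auto simp: Rats_def)
  then obtain q where q: "\<And>a i. a \<in> ?R \<Longrightarrow> i < d \<Longrightarrow> flag_coord ks a (X i) = of_rat (q a i)"
    by metis
  define R where "R = mat d d (\<lambda>(i, j). \<Sum>a\<in>?R. q a i * q a j)"
  define Q where "Q = mat d d (\<lambda>(i, j). \<Sum>a\<in>?R. flag_coord ks a (X i) * flag_coord ks a (X j))"
  have QR: "Q = map_mat of_rat R"
    by (rule eq_matI) (auto simp: Q_def R_def q of_rat_sum of_rat_mult)
  have "Q *\<^sub>v w = 0\<^sub>v d"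
  proof (rule eq_vecI)
    fix j assume "j < dim_vec (0\<^sub>v d :: 'k vec)"
    then have j: "j < d" by simp
    have "(Q *\<^sub>v w) $ j = (\<Sum>i<d. (\<Sum>a\<in>?R. flag_coord ks a (X j) * flag_coord ks a (X i)) * w $ i)"
      using j w by (auto simp: Q_def scalar_prod_def atLeast0LessThan intro!: sum.cong)
    also have "\<dots> = (\<Sum>i<d. \<Sum>a\<in>?R. w $ i * flag_coord ks a (X i) * flag_coord ks a (X j))"
      by (simp add: sum_distrib_left sum_distrib_right ac_simps)
    also have "\<dots> = (\<Sum>a\<in>?R. coord w a * flag_coord ks a (X j))"
      unfolding coord_def sum_distrib_right by (rule sum.swap)
    also have "\<dots> = 0" using neg j by blast
    finally show "(Q *\<^sub>v w) $ j = 0\<^sub>v d $ j" using j by simp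
  qed (simp add: Q_def)
  then have "det Q = 0" using w det_0_iff_vec_prod_zero_field[of Q d] by (auto simp: Q_def)
  then have "(of_rat (det R) :: 'k) = 0" unfolding QR of_rat_hom.hom_det .
  then have "det R = 0" by simp
  then obtain c where c: "c \<in> carrier_vec d" "c \<noteq> 0\<^sub>v d" "R *\<^sub>v c = 0\<^sub>v d"
    using det_0_iff_vec_prod_zero_field[of R d] by (auto simp: R_def)
  have "(\<Sum>j<d. (\<Sum>a\<in>?R. q a i * q a j) * c $ j) = 0" if i: "i < d" for i
  proof -
    have "(R *\<^sub>v c) $ i = (\<Sum>j<d. (\<Sum>a\<in>?R. q a i * q a j) * c $ j)"
      using i c(1) by (auto simp: R_def scalar_prod_def atLeast0LessThan intro!: sum.cong)
    then show ?thesis using c(3) i by simp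
  qed
  then have "0 = (\<Sum>i<d. c $ i * (\<Sum>j<d. (\<Sum>a\<in>?R. q a i * q a j) * c $ j))" by simp
  also have "\<dots> = (\<Sum>i<d. \<Sum>j<d. \<Sum>a\<in>?R. (c $ i * q a i) * (c $ j * q a j))"
    by (simp add: sum_distrib_left sum_distrib_right ac_simps)
  also have "\<dots> = (\<Sum>i<d. \<Sum>a\<in>?R. \<Sum>j<d. (c $ i * q a i) * (c $ j * q a j))"
    by (intro sum.cong refl sum.swap)
  also have "\<dots> = (\<Sum>a\<in>?R. \<Sum>i<d. \<Sum>j<d. (c $ i * q a i) * (c $ j * q a j))"
    by (rule sum.swap)
  also have "\<dots> = (\<Sum>a\<in>?R. (\<Sum>i<d. c $ i * q a i) * (\<Sum>j<d. c $ j * q a j))"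
    unfolding sum_product ..
  finally have "(\<Sum>a\<in>?R. (\<Sum>i<d. c $ i * q a i) * (\<Sum>j<d. c $ j * q a j)) = 0" ..
  then have z: "(\<Sum>i<d. c $ i * q a i) = 0" if "a \<in> ?R" for a
    using that sum_nonneg_eq_0_iff[OF finite_row_families[of n ks],
      of "\<lambda>a. (\<Sum>i<d. c $ i * q a i) * (\<Sum>j<d. c $ j * q a j)"] by auto
  let ?c = "map_vec of_rat c :: 'k vec"
  have cc: "?c \<in> carrier_vec d" using c(1) by simp
  have "coord ?c a = coord (0\<^sub>v d) a" if a: "a \<in> ?R" for a
  proof -
    have "coord ?c a = of_rat (\<Sum>i<d. c $ i * q a i)"
      unfolding coord_def of_rat_sum using c(1) q[OF a] by (intro sum.cong) (auto simp: of_rat_mult)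
    then show ?thesis using z[OF a] by (simp add: coord_def)
  qed
  then have "?c = 0\<^sub>v d" by (intro coord_inj cc) auto
  then have "c $ i = 0" if "i < d" for i
    using that c(1) by (metis carrier_vecD index_map_vec(1) index_zero_vec(1) of_rat_eq_0_iff)
  then show False using c(1,2) by (auto intro!: eq_vecI)
qed

lemma cvec_one_nonzero: "coord (cvec (1\<^sub>m n)) (top_family ks) = 1"
  using coord_cvec[OF SL_one_closed top_family_in[OF ks]] flag_coord_top_one[OF ks] by simp

lemma d_pos: "0 < d"
proof (rule ccontr)
  assume "\<not> 0 < d"
  then show False using cvec_one_nonzero unfolding coord_def by simp
qed

text \<open>A polynomial in a torus element projects to its highest eigenspace without leaving an
  invariant subspace.\<close>

lemma eigen_filter:
  assumes W: "W \<subseteq> carrier_vec d" "\<And>x y. x \<in> W \<Longrightarrow> y \<in> W \<Longrightarrow> x + y \<in> W"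
    "\<And>c x. x \<in> W \<Longrightarrow> c \<cdot>\<^sub>v x \<in> W" "\<And>x. x \<in> W \<Longrightarrow> rep (reg_torus n) *\<^sub>v x \<in> W"
    and w: "w \<in> W" and E: "finite E"
  shows "\<exists>w'\<in>W. \<forall>a\<in>row_families n ks. coord w' a = (\<Prod>e\<in>E. reg_value n ks a - e) * coord w a"
  using E
proof induction
  case empty
  then show ?case using w by auto
next
  case (insert e E)
  then obtain w' where w': "w' \<in> W"
    "\<And>a. a \<in> row_families n ks \<Longrightarrow> coord w' a = (\<Prod>e\<in>E. reg_value n ks a - e) * coord w a" by blast
  have w'c: "w' \<in> carrier_vec d" using w'(1) W(1) by blast
  let ?h = "reg_torus n :: 'k mat"
  let ?w = "rep ?h *\<^sub>v w' + (- e) \<cdot>\<^sub>v w'"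
  have hS: "?h \<in> carrier (SL n)" using Torus_SL[OF reg_torus_Torus] .
  have "coord ?w a = (reg_value n ks a - e) * coord w' a" if a: "a \<in> row_families n ks" for a
  proof -
    have "coord ?w a = coord (rep ?h *\<^sub>v w') a + (- e) * coord w' a"
      using w'c unfolding coord_def
      by (simp add: sum.distrib[symmetric] sum_distrib_left algebra_simps rep_def del: index_mult_mat_vec)
    also have "coord (rep ?h *\<^sub>v w') a = (\<Sum>i<d. w' $ i * (reg_value n ks a * flag_coord ks a (X i)))"
      unfolding coord_rep[OF hS w'c a] reg_value_def
      using flag_coord_diag_mult[OF SL_carrier_mat[OF hS] Torus_entry[OF reg_torus_Torus]
          SL_carrier_mat[OF X_SL] ks a]
      by (intro sum.cong) auto
    also have "\<dots> = reg_value n ks a * coord w' a" by (simp add: coord_def sum_distrib_left ac_simps)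
    finally show ?thesis by (simp add: algebra_simps)
  qed
  moreover have "?w \<in> W" using W w'(1) by blast
  ultimately show ?case using w'(2) insert.hyps
    by (intro bexI[of _ ?w]) (auto simp: ac_simps)
qed

lemma irreducible_rep: "irreducible_rep n d rep"
  unfolding irreducible_rep_def
proof (intro conjI allI impI)
  show "rational_rep n d rep" by (rule rational_rep)
  show "0 < d" by (rule d_pos)
  fix W assume sub: "VectorSpace.subspace class_ring W (module_vec TYPE('k) d)"
    and inv: "\<forall>g\<in>carrier (SL n). \<forall>w\<in>W. rep g *\<^sub>v w \<in> W"
  interpret W: VectorSpace.subspace class_ring W "module_vec TYPE('k) d" by (rule sub)
  note sm = W.submod
  have Wc: "W \<subseteq> carrier_vec d" using submodule.subset[OF sm] by (simp add: module_vec_simps)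
  have Wadd: "x + y \<in> W" if "x \<in> W" "y \<in> W" for x y
    using submodule.m_closed[OF sm that] by (simp add: module_vec_simps)
  have Wsmult: "c \<cdot>\<^sub>v x \<in> W" if "x \<in> W" for c x
    using submodule.smult_closed[OF sm _ that, of c] by (simp add: module_vec_simps)
  have W0: "0\<^sub>v d \<in> W" using submodule.zero_closed[OF sm] by (simp add: module_vec_simps)
  show "W = {0\<^sub>v d} \<or> W = carrier_vec d"
  proof (cases "W = {0\<^sub>v d}")
    case False
    then obtain w where w: "w \<in> W" "w \<noteq> 0\<^sub>v d" using W0 by blast
    let ?R = "row_families n ks"
    let ?t = "top_family ks"
    have wc: "w \<in> carrier_vec d" using w Wc by blast
    obtain j where j: "j < d" and nz: "(\<Sum>a\<in>?R. coord w a * flag_coord ks a (X j)) \<noteq> 0"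
      using form_nondegenerate[OF wc w(2)] by blast
    \<comment> \<open>applying the transpose of \<open>X j\<close> gives a vector that pairs nontrivially with the highest
      weight vector\<close>
    let ?g = "(X j)\<^sup>T"
    have gS: "?g \<in> carrier (SL n)" using SL_transpose[OF X_SL[OF j]] .
    have Xc: "X j \<in> carrier_mat n n" using SL_carrier_mat[OF X_SL[OF j]] .
    define w1 where "w1 = rep ?g *\<^sub>v w"
    have w1: "w1 \<in> W" using inv gS w by (simp add: w1_def)
    have w1_coord: "coord w1 a = (\<Sum>b\<in>?R. tensor_coeff ks (X j) b a * coord w b)" if a: "a \<in> ?R" for a
    proof -
      have tr: "tensor_coeff ks ?g a b = tensor_coeff ks (X j) b a" if "b \<in> ?R" for b
        unfolding tensor_coeff_def
        using row_families_less[OF a] row_families_less[OF that] Xc by (intro prod.cong refl) auto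
      have "coord w1 a = (\<Sum>i<d. w $ i * (\<Sum>b\<in>?R. tensor_coeff ks ?g a b * flag_coord ks b (X i)))"
        unfolding w1_def coord_rep[OF gS wc a]
        using flag_coord_mult[OF SL_carrier_mat[OF gS] SL_carrier_mat[OF X_SL] ks a]
        by (intro sum.cong) auto
      also have "\<dots> = (\<Sum>i<d. \<Sum>b\<in>?R. tensor_coeff ks (X j) b a * (w $ i * flag_coord ks b (X i)))"
        using tr by (simp add: sum_distrib_left ac_simps)
      also have "\<dots> = (\<Sum>b\<in>?R. tensor_coeff ks (X j) b a * coord w b)"
        unfolding coord_def sum_distrib_left by (rule sum.swap)
      finally show ?thesis .
    qed
    have "(\<Sum>a\<in>?R. coord w1 a * flag_coord ks a (1\<^sub>m n)) =
        (\<Sum>a\<in>?R. \<Sum>b\<in>?R. coord w b * (tensor_coeff ks (X j) b a * flag_coord ks a (1\<^sub>m n)))"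
      by (simp add: w1_coord sum_distrib_left sum_distrib_right ac_simps)
    also have "\<dots> = (\<Sum>b\<in>?R. coord w b * (\<Sum>a\<in>?R. tensor_coeff ks (X j) b a * flag_coord ks a (1\<^sub>m n)))"
      unfolding sum_distrib_left by (rule sum.swap)
    also have "\<dots> = (\<Sum>b\<in>?R. coord w b * flag_coord ks b (X j))"
      using flag_coord_mult[OF Xc one_carrier_mat ks] Xc by (intro sum.cong) auto
    finally have nz1: "(\<Sum>a\<in>?R. coord w1 a * flag_coord ks a (1\<^sub>m n)) \<noteq> 0" using nz by simp
    \<comment> \<open>then the components outside the top eigenvalue of the regular torus element are removed\<close>
    define E where "E = (reg_value n ks ` ?R - {reg_value n ks ?t} :: 'k set)"
    have "finite E" by (simp add: E_def finite_row_families)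
    then obtain w2 where w2: "w2 \<in> W"
      "\<And>a. a \<in> ?R \<Longrightarrow> coord w2 a = (\<Prod>e\<in>E. reg_value n ks a - e) * coord w1 a"
      using eigen_filter[OF Wc Wadd Wsmult _ w1, of E] inv Torus_SL[OF reg_torus_Torus] by blast
    have w1c: "w1 \<in> carrier_vec d" and w2c: "w2 \<in> carrier_vec d" using w1 w2 Wc by auto
    have ext: "coord w1 a = flag_coord ks a (1\<^sub>m n) * coord w1 ?t"
      if "a \<in> ?R" "(reg_value n ks a :: 'k) = reg_value n ks ?t" for a
      unfolding coord_def sum_distrib_left
      by (intro sum.cong refl) (simp add: flag_coord_extremal[OF ks that, of "X _"])
    let ?C = "(\<Prod>e\<in>E. reg_value n ks ?t - e) * coord w1 ?t"
    have one_weight: "flag_coord ks a (1\<^sub>m n :: 'k mat) = 0"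
      if a: "a \<in> ?R" and ne: "(reg_value n ks a :: 'k) \<noteq> reg_value n ks ?t" for a
    proof -
      let ?h = "reg_torus n :: 'k mat"
      note hc = SL_carrier_mat[OF Torus_SL[OF reg_torus_Torus]]
      note hd = Torus_entry[OF reg_torus_Torus]
      have "flag_coord ks a (?h * 1\<^sub>m n) = reg_value n ks a * flag_coord ks a (1\<^sub>m n :: 'k mat)"
        unfolding reg_value_def by (rule flag_coord_diag_mult[OF hc hd _ ks a]) auto
      moreover have "flag_coord ks a (1\<^sub>m n * ?h) = list_char ks ?h * flag_coord ks a (1\<^sub>m n :: 'k mat)"
        by (rule flag_coord_mult_upper[OF _ hc ks a]) (auto intro: hd)
      moreover have "list_char ks ?h = (reg_value n ks ?t :: 'k)"
        by (simp add: list_char_def reg_value_def top_family_def)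
      ultimately have "reg_value n ks a * flag_coord ks a (1\<^sub>m n) =
          reg_value n ks ?t * flag_coord ks a (1\<^sub>m n :: 'k mat)"
        unfolding right_mult_one_mat[OF hc] left_mult_one_mat[OF hc] by metis
      then show ?thesis using ne by simp
    qed
    have "w2 = ?C \<cdot>\<^sub>v cvec (1\<^sub>m n)"
    proof (rule coord_inj[OF w2c])
      fix a assume a: "a \<in> ?R"
      have "coord (?C \<cdot>\<^sub>v cvec (1\<^sub>m n)) a = ?C * coord (cvec (1\<^sub>m n)) a"
        by (rule coord_smult) simp
      also have "coord (cvec (1\<^sub>m n)) a = flag_coord ks a (1\<^sub>m n)"
        by (rule coord_cvec[OF SL_one_closed a])
      also have "?C * flag_coord ks a (1\<^sub>m n) = coord w2 a"
      proof (cases "(reg_value n ks a :: 'k) = reg_value n ks ?t")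
        case True
        then show ?thesis using w2(2)[OF a] ext[OF a True] by (simp add: ac_simps)
      next
        case False
        then have "reg_value n ks a \<in> E" using a by (simp add: E_def)
        then have "(\<Prod>e\<in>E. reg_value n ks a - e) = 0" using \<open>finite E\<close> by (intro prod_zero) auto
        then show ?thesis using w2(2)[OF a] one_weight[OF a False] by simp
      qed
      finally show "coord w2 a = coord (?C \<cdot>\<^sub>v cvec (1\<^sub>m n)) a" ..
    qed simp
    moreover have "?C \<noteq> 0"
    proof -
      have "coord w1 ?t \<noteq> 0"
      proof
        assume z: "coord w1 ?t = 0"
        have "coord w1 a * flag_coord ks a (1\<^sub>m n) = 0" if a: "a \<in> ?R" for a
          using ext[OF a] one_weight[OF a] z by (cases "(reg_value n ks a :: 'k) = reg_value n ks ?t") auto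
        then show False using nz1 by (simp add: sum.neutral)
      qed
      moreover have "(\<Prod>e\<in>E. reg_value n ks ?t - e) \<noteq> 0"
        using \<open>finite E\<close> by (auto simp: E_def)
      ultimately show ?thesis by simp
    qed
    ultimately have "cvec (1\<^sub>m n) = (1 / ?C) \<cdot>\<^sub>v w2" by (simp add: smult_smult_assoc)
    then have c1: "cvec (1\<^sub>m n) \<in> W" using Wsmult[OF w2(1)] by simp
    have cg: "cvec g \<in> W" if g: "g \<in> carrier (SL n)" for g
      using inv c1 rep_cvec[OF g SL_one_closed] g SL_carrier_mat[OF g] by (metis right_mult_one_mat)
    \<comment> \<open>\<open>cvec (X k)\<close> is the \<open>k\<close>-th unit vector\<close>
    have part: "vec d (\<lambda>i. if i < k then x $ i else 0) \<in> W" if "x \<in> carrier_vec d" "k \<le> d" for x k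
      using that(2)
    proof (induction k)
      case 0
      have "vec d (\<lambda>i. if i < 0 then x $ i else 0) = 0\<^sub>v d" by (intro eq_vecI) auto
      then show ?case using W0 by simp
    next
      case (Suc k)
      have "vec d (\<lambda>i. if i < Suc k then x $ i else 0) =
          vec d (\<lambda>i. if i < k then x $ i else 0) + x $ k \<cdot>\<^sub>v cvec (X k)"
        using Suc.prems dual by (intro eq_vecI) (auto simp: cvec_def less_Suc_eq)
      then show ?case using Suc Wadd Wsmult cg X_SL by simp
    qed
    have "x \<in> W" if x: "x \<in> carrier_vec d" for x
    proof -
      have "vec d (\<lambda>i. if i < d then x $ i else 0) = x" using x by (intro eq_vecI) auto
      then show ?thesis using part[OF x le_refl] by simp
    qed
    then show ?thesis using Wc by auto
  qed simp
qed

lemma cvec_mult_upper: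
  assumes "g \<in> carrier (SL n)" "b \<in> carrier (SL n)" "\<And>i j. j < i \<Longrightarrow> i < n \<Longrightarrow> b $$ (i, j) = 0"
  shows "cvec (g * b) = list_char ks b \<cdot>\<^sub>v cvec g"
  using orbit_funs_mult_upper[OF ks \<phi>_orbit assms] by (intro eq_vecI) (auto simp: cvec_def)

lemma cvec_nonzero:
  assumes g: "g \<in> carrier (SL n)"
  shows "cvec g \<noteq> 0\<^sub>v d"
proof
  assume z: "cvec g = 0\<^sub>v d"
  have "rep (inv\<^bsub>SL n\<^esub> g) *\<^sub>v cvec g = cvec (1\<^sub>m n)"
    using rep_cvec[OF SL_inv_closed[OF g] g] SL_inv_l[OF g] by simp
  moreover have "rep (inv\<^bsub>SL n\<^esub> g) *\<^sub>v 0\<^sub>v d = 0\<^sub>v d"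
    by (intro eq_vecI) (auto simp: rep_def)
  ultimately have "cvec (1\<^sub>m n) = 0\<^sub>v d" using z by simp
  then show False using cvec_one_nonzero by (simp add: coord_def)
qed

lemma list_char_upper_unip:
  assumes "\<And>i. i < n \<Longrightarrow> u $$ (i, i) = 1"
  shows "list_char ks u = 1"
  unfolding list_char_def using assms ks by (intro prod.neutral ballI) (meson less_le_trans lessThan_iff nth_mem)

lemma is_V: "is_V n (list_weight ks) d rep"
  unfolding is_V_def
proof (intro conjI exI[of _ "cvec (1\<^sub>m n)"] irreducible_rep)
  show "highest_weight_vector n d rep (list_weight ks) (cvec (1\<^sub>m n))"
    unfolding highest_weight_vector_def weight_vector_def
  proof (intro conjI ballI)
    fix h :: "'k mat" assume h: "h \<in> Torus n"
    note hS = Torus_SL[OF h]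
    have "rep h *\<^sub>v cvec (1\<^sub>m n) = cvec (1\<^sub>m n * h)"
      using rep_cvec[OF hS SL_one_closed] SL_carrier_mat[OF hS] by simp
    also have "\<dots> = list_char ks h \<cdot>\<^sub>v cvec (1\<^sub>m n)"
      using Torus_entry[OF h] by (intro cvec_mult_upper SL_one_closed hS) auto
    also have "list_char ks h = wt_char n (list_weight ks) h"
      using wt_char_list_weight[OF Torus_diag_nonzero[OF h] ks] by simp
    finally show "rep h *\<^sub>v cvec (1\<^sub>m n) = wt_char n (list_weight ks) h \<cdot>\<^sub>v cvec (1\<^sub>m n)" .
  next
    fix u :: "'k mat" assume u: "u \<in> Uplus n"
    note uS = Uplus_SL[OF u]
    have "rep u *\<^sub>v cvec (1\<^sub>m n) = cvec (1\<^sub>m n * u)"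
      using rep_cvec[OF uS SL_one_closed] SL_carrier_mat[OF uS] by simp
    also have "\<dots> = list_char ks u \<cdot>\<^sub>v cvec (1\<^sub>m n)"
      using Uplus_entry(1)[OF u] by (intro cvec_mult_upper SL_one_closed uS) auto
    finally show "rep u *\<^sub>v cvec (1\<^sub>m n) = cvec (1\<^sub>m n)"
      using list_char_upper_unip[OF Uplus_entry(2)[OF u]] by simp
  qed (simp_all add: cvec_nonzero SL_one_closed)
qed

text \<open>The image of the highest weight vector under a lift of the longest element is a lowest weight
  vector.\<close>

lemma lowest_weight_vector_cvec:
  assumes z: "signed_perm n (reversal n) \<epsilon> z"
  shows "lowest_weight_vector n d rep (cvec z)"
proof -
  have zS: "z \<in> carrier (SL n)" and zc: "z \<in> carrier_mat n n"
    and \<epsilon>: "\<And>q. \<epsilon> q * \<epsilon> q = 1"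
    and ze: "\<And>p q. p < n \<Longrightarrow> q < n \<Longrightarrow> z $$ (p, q) = (if p = reversal n q then \<epsilon> q else 0)"
    using z SL_carrier_mat by (auto simp: signed_perm_def)
  have r: "reversal n q < n" if "q < n" for q using that by (simp add: reversal_def)
  \<comment> \<open>conjugation by \<open>z\<close> exchanges lower and upper triangular matrices\<close>
  let ?c = "\<lambda>A. z\<^sup>T * (A * z)"
  have conj: "?c A $$ (p, q) = \<epsilon> p * \<epsilon> q * A $$ (reversal n p, reversal n q)"
    if A: "A \<in> carrier_mat n n" and pq: "p < n" "q < n" for A p q
  proof -
    have Az: "(A * z) $$ (i, q) = A $$ (i, reversal n q) * \<epsilon> q" if i: "i < n" for i
    proof -
      have "(A * z) $$ (i, q) = (\<Sum>c<n. if c = reversal n q then A $$ (i, reversal n q) * \<epsilon> q else 0)"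
        unfolding mat_mult_entry[OF A zc i pq(2)] using ze pq by (intro sum.cong) auto
      then show ?thesis using r[OF pq(2)] by simp
    qed
    have "?c A $$ (p, q) = (\<Sum>c<n. z\<^sup>T $$ (p, c) * (A * z) $$ (c, q))"
      by (rule mat_mult_entry[of _ n n _ n]) (use zc A pq in auto)
    also have "\<dots> = (\<Sum>c<n. if c = reversal n p then \<epsilon> p * (A $$ (reversal n p, reversal n q) * \<epsilon> q) else 0)"
      using zc pq ze Az by (intro sum.cong) (auto simp del: index_mult_mat(1))
    finally show ?thesis using r[OF pq(1)] by simp
  qed
  have zz: "z * z\<^sup>T = 1\<^sub>m n"
  proof -
    have "?c (1\<^sub>m n) = 1\<^sub>m n"
    proof (rule eq_matI)
      fix p q assume "p < dim_row (1\<^sub>m n :: 'k mat)" "q < dim_col (1\<^sub>m n :: 'k mat)"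
      then show "?c (1\<^sub>m n) $$ (p, q) = 1\<^sub>m n $$ (p, q)"
        using conj[of "1\<^sub>m n" p q] \<epsilon>[of p] r[of p] r[of q] by (auto simp: reversal_def simp del: index_mult_mat)
    qed (use zc in auto)
    then have "z\<^sup>T * z = 1\<^sub>m n" using zc by simp
    then show ?thesis using mat_mult_left_right_inverse[of "z\<^sup>T" n z] zc by simp
  qed
  have move: "cvec (A * z) = list_char ks (?c A) \<cdot>\<^sub>v cvec z"
    if A: "A \<in> carrier (SL n)" and low: "\<And>i j. i < j \<Longrightarrow> j < n \<Longrightarrow> A $$ (i, j) = 0" for A
  proof -
    have Ac: "A \<in> carrier_mat n n" using A SL_carrier_mat by blast
    have "A * z = z * ?c A"
      using zz zc Ac assoc_mult_mat[of z n n "z\<^sup>T" n "A * z" n] by simp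
    moreover have "cvec (z * ?c A) = list_char ks (?c A) \<cdot>\<^sub>v cvec z"
    proof (rule cvec_mult_upper[OF zS])
      show "?c A \<in> carrier (SL n)" using SL_mult_closed[OF SL_transpose[OF zS] SL_mult_closed[OF A zS]] .
      fix i j :: nat assume "j < i" "i < n"
      then show "?c A $$ (i, j) = 0"
        using conj[OF Ac, of i j] low[of "reversal n i" "reversal n j"]
        by (auto simp: reversal_def simp del: index_mult_mat)
    qed
    ultimately show ?thesis by simp
  qed
  have "weight_vector n d rep (\<lambda>j. list_weight ks (n - Suc j)) (cvec z)"
    unfolding weight_vector_def
  proof (intro conjI ballI)
    fix h :: "'k mat" assume h: "h \<in> Torus n"
    note hc = SL_carrier_mat[OF Torus_SL[OF h]]
    have diag: "?c h $$ (j, j) = h $$ (n - Suc j, n - Suc j)" if "j < n" for j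
      using conj[OF hc that that] \<epsilon>[of j] that by (simp add: reversal_def del: index_mult_mat)
    have "list_char ks (?c h) = wt_char n (list_weight ks) (?c h)"
      using diag Torus_diag_nonzero[OF h] by (intro wt_char_list_weight[symmetric] ks) auto
    also have "\<dots> = (\<Prod>j<n. (h $$ (n - Suc j, n - Suc j)) powi list_weight ks (n - Suc (n - Suc j)))"
      unfolding wt_char_def using diag by (intro prod.cong) auto
    also have "\<dots> = wt_char n (\<lambda>j. list_weight ks (n - Suc j)) h"
      unfolding wt_char_def
      by (rule prod.nat_diff_reindex[of "\<lambda>j. (h $$ (j, j)) powi list_weight ks (n - Suc j)" n])
    finally show "rep h *\<^sub>v cvec z = wt_char n (\<lambda>j. list_weight ks (n - Suc j)) h \<cdot>\<^sub>v cvec z"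
      using rep_cvec[OF Torus_SL[OF h] zS] move[OF Torus_SL[OF h]] Torus_entry[OF h] by simp
  qed (simp_all add: cvec_nonzero zS)
  moreover have "rep u *\<^sub>v cvec z = cvec z" if u: "u \<in> Uminus n" for u
  proof -
    have "?c u $$ (j, j) = 1" if "j < n" for j
      using conj[OF SL_carrier_mat[OF Uminus_SL[OF u]] that that] \<epsilon>[of j] Uminus_entry(2)[OF u r[OF that]]
      by (simp del: index_mult_mat)
    from list_char_upper_unip[OF this] show ?thesis
      using rep_cvec[OF Uminus_SL[OF u] zS] move[OF Uminus_SL[OF u] Uminus_entry(1)[OF u]] by simp
  qed
  ultimately show ?thesis unfolding lowest_weight_vector_def by blast
qed

end

text \<open>A dual system on the rational points of \<open>SL\<^sub>n\<close> is one on all of \<open>SL\<^sub>n\<close> by density.\<close>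

lemma orbit_module_exists:
  assumes n: "0 < n" and ks: "\<forall>k\<in>set ks. k \<le> n"
  shows "\<exists>d (\<phi> :: nat \<Rightarrow> 'k::field_char_0 mat \<Rightarrow> 'k) X. orbit_module n ks d \<phi> X"
proof -
  let ?R = "row_families n ks"
  let ?S = "{g \<in> carrier (SL n). rat_mat n g} :: 'k mat set"
  obtain d and \<phi> :: "nat \<Rightarrow> 'k mat \<Rightarrow> 'k" and X where X: "\<forall>i<d. X i \<in> ?S"
    and lin: "\<forall>i<d. \<exists>l. \<forall>g. \<phi> i g = (\<Sum>a\<in>?R. l a * flag_coord ks a g)"
    and dual: "\<forall>i<d. \<forall>j<d. \<phi> i (X j) = (if i = j then 1 else 0)"
    and exp: "\<forall>a\<in>?R. \<forall>g\<in>?S. flag_coord ks a g = (\<Sum>i<d. flag_coord ks a (X i) * \<phi> i g)"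
    using dual_system_exists[OF finite_row_families[of n ks], of "flag_coord ks" ?S]
    unfolding dual_system_def by blast
  have \<phi>_poly: "\<phi> i \<in> poly_funs (mat_coords n)" if "i < d" for i
  proof -
    obtain l where "\<forall>g. \<phi> i g = (\<Sum>a\<in>?R. l a * flag_coord ks a g)" using lin \<open>i < d\<close> by blast
    then have "\<phi> i = (\<lambda>g. \<Sum>a\<in>?R. l a * flag_coord ks a g)" by blast
    then show ?thesis using flag_coord_poly[OF ks]
      by (auto intro!: poly_funs_sum poly_funs.mult poly_funs.const)
  qed
  have exp': "flag_coord ks a g = (\<Sum>i<d. flag_coord ks a (X i) * \<phi> i g)"
    if a: "a \<in> ?R" and g: "g \<in> carrier (SL n)" for a g
  proof -
    let ?p = "\<lambda>g. flag_coord ks a g + (-1) * (\<Sum>i<d. flag_coord ks a (X i) * \<phi> i g)"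
    have "?p \<in> poly_funs (mat_coords n)"
      using flag_coord_poly[OF ks a] \<phi>_poly
      by (intro poly_funs.add poly_funs.mult poly_funs.const poly_funs_sum) auto
    from SL_dense_rat[OF n this _ g] exp a have "?p g = 0" by auto
    then show ?thesis by simp
  qed
  have "orbit_module n ks d \<phi> X"
  proof
    fix \<psi> :: "'k mat \<Rightarrow> 'k" and g :: "'k mat" assume \<psi>: "\<psi> \<in> orbit_funs n ks" and g: "g \<in> carrier (SL n)"
    obtain l where l: "\<And>g. g \<in> carrier (SL n) \<Longrightarrow> \<psi> g = (\<Sum>a\<in>?R. l a * flag_coord ks a g)"
      using \<psi> by (auto simp: orbit_funs_def)
    have "\<psi> g = (\<Sum>a\<in>?R. \<Sum>i<d. l a * flag_coord ks a (X i) * \<phi> i g)"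
      unfolding l[OF g] using exp'[OF _ g] by (intro sum.cong) (auto simp: sum_distrib_left ac_simps)
    also have "\<dots> = (\<Sum>i<d. (\<Sum>a\<in>?R. l a * flag_coord ks a (X i)) * \<phi> i g)"
      unfolding sum_distrib_right by (rule sum.swap)
    also have "\<dots> = (\<Sum>i<d. \<psi> (X i) * \<phi> i g)" using X l by (intro sum.cong) auto
    finally show "\<psi> g = (\<Sum>i<d. \<psi> (X i) * \<phi> i g)" .
  next
    fix i assume "i < d"
    then obtain l where "\<forall>g. \<phi> i g = (\<Sum>a\<in>?R. l a * flag_coord ks a g)" using lin by blast
    then show "\<phi> i \<in> orbit_funs n ks" unfolding orbit_funs_def by blast
  qed (use ks X dual in auto)
  then show ?thesis by blast
qed

section \<open>Functions on configurations\<close>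

lemma poly_funs_mat3:
  assumes "p \<in> poly_funs (mat_coords n)"
  shows "(\<lambda>(A, B, C). p A) \<in> poly_funs (mat3_coords n)"
    "(\<lambda>(A, B, C). p B) \<in> poly_funs (mat3_coords n)"
    "(\<lambda>(A, B, C). p C) \<in> poly_funs (mat3_coords n)"
proof -
  have *: "(\<lambda>t. p (\<pi> t)) \<in> poly_funs (mat3_coords n)"
    if "\<And>c. c \<in> mat_coords n \<Longrightarrow> (\<lambda>t. c (\<pi> t)) \<in> mat3_coords n" for \<pi>
    using assms by induction (auto intro: poly_funs.intros that)
  have f: "(\<lambda>(A, B, C). q A) = (\<lambda>t. q (fst t))" "(\<lambda>(A, B, C). q B) = (\<lambda>t. q (fst (snd t)))"
    "(\<lambda>(A, B, C). q C) = (\<lambda>t. q (snd (snd t)))" for q :: "'a mat \<Rightarrow> 'a"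
    by auto
  show "(\<lambda>(A, B, C). p A) \<in> poly_funs (mat3_coords n)" unfolding f(1)
    by (rule *) (auto simp: mat3_coords_def f)
  show "(\<lambda>(A, B, C). p B) \<in> poly_funs (mat3_coords n)" unfolding f(2)
    by (rule *) (auto simp: mat3_coords_def f)
  show "(\<lambda>(A, B, C). p C) \<in> poly_funs (mat3_coords n)" unfolding f(3)
    by (rule *) (auto simp: mat3_coords_def f)
qed

lemma mem_lcoset_iff: "x \<in> a <#\<^bsub>SL n\<^esub> H \<longleftrightarrow> (\<exists>u\<in>H. x = a * u)"
  by (auto simp: l_coset_def)

lemma conf3_in_Conf3:
  assumes "g1 \<in> carrier (SL n)" "g2 \<in> carrier (SL n)" "g3 \<in> carrier (SL n)"
  shows "conf3 n g1 g2 g3 \<in> Conf3 n"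
  using assms unfolding conf3_def Conf3_def orbits_def dec_flags_def LCOSETS_def by blast

text \<open>Two triples represent the same configuration only if they differ by the diagonal action on the
  left and by \<open>U\<^sup>-\<close> on the right.\<close>

lemma conf3_eqD:
  fixes g1 g2 g3 g1' g2' g3' :: "'k::field_char_0 mat"
  assumes g: "g1 \<in> carrier (SL n)" "g2 \<in> carrier (SL n)" "g3 \<in> carrier (SL n)"
    and eq: "conf3 n g1 g2 g3 = conf3 n g1' g2' g3'"
  shows "\<exists>h\<in>carrier (SL n). \<exists>u1\<in>Uminus n. \<exists>u2\<in>Uminus n. \<exists>u3\<in>Uminus n.
    g1 = h * (g1' * u1) \<and> g2 = h * (g2' * u2) \<and> g3 = h * (g3' * u3)"
proof -
  let ?U = "Uminus n :: 'k mat set"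
  let ?t = "(g1 <#\<^bsub>SL n\<^esub> ?U, g2 <#\<^bsub>SL n\<^esub> ?U, g3 <#\<^bsub>SL n\<^esub> ?U)"
  let ?t' = "(g1' <#\<^bsub>SL n\<^esub> ?U, g2' <#\<^bsub>SL n\<^esub> ?U, g3' <#\<^bsub>SL n\<^esub> ?U)"
  have one: "1\<^sub>m n <#\<^bsub>SL n\<^esub> (g <#\<^bsub>SL n\<^esub> ?U) = g <#\<^bsub>SL n\<^esub> ?U" if "g \<in> carrier (SL n)" for g :: "'k mat"
  proof -
    have "1\<^sub>m n * (g * u) = g * u" if "u \<in> ?U" for u
      using SL_carrier_mat[OF SL_mult_closed[OF \<open>g \<in> carrier (SL n)\<close> Uminus_SL[OF that]]]
      by (rule left_mult_one_mat)
    then show ?thesis by (auto simp: l_coset_def)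
  qed
  have "diag_action n (1\<^sub>m n) ?t = ?t" using one g by (simp add: diag_action_def)
  then have "?t \<in> conf3 n g1 g2 g3"
    unfolding conf3_def orbit_def using SL_one_closed[of n] by (auto intro!: exI[of _ "1\<^sub>m n"])
  then have "?t \<in> conf3 n g1' g2' g3'" by (simp only: eq)
  then obtain h where h: "h \<in> carrier (SL n)" "?t = diag_action n h ?t'"
    unfolding conf3_def orbit_def by blast
  have self: "x \<in> x <#\<^bsub>SL n\<^esub> ?U" if "x \<in> carrier (SL n)" for x :: "'k mat"
    unfolding mem_lcoset_iff
    using subgroup.one_closed[OF subgroup_Uminus, of n] SL_carrier_mat[OF that]
    by (intro bexI[of _ "1\<^sub>m n"]) auto
  have m: "g1 \<in> h <#\<^bsub>SL n\<^esub> (g1' <#\<^bsub>SL n\<^esub> ?U)" "g2 \<in> h <#\<^bsub>SL n\<^esub> (g2' <#\<^bsub>SL n\<^esub> ?U)"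
    "g3 \<in> h <#\<^bsub>SL n\<^esub> (g3' <#\<^bsub>SL n\<^esub> ?U)"
    using h(2) self[OF g(1)] self[OF g(2)] self[OF g(3)] by (simp_all add: diag_action_def)
  have two: "\<exists>u\<in>?U. g = h * (g' * u)" if "g \<in> h <#\<^bsub>SL n\<^esub> (g' <#\<^bsub>SL n\<^esub> ?U)" for g g'
    using that by (auto simp: l_coset_def)
  obtain u1 where "u1 \<in> ?U" "g1 = h * (g1' * u1)" using two[OF m(1)] ..
  moreover obtain u2 where "u2 \<in> ?U" "g2 = h * (g2' * u2)" using two[OF m(2)] ..
  moreover obtain u3 where "u3 \<in> ?U" "g3 = h * (g3' * u3)" using two[OF m(3)] ..
  ultimately show ?thesis using h(1)
    by (intro bexI[of _ h] bexI[of _ u1] bexI[of _ u2] bexI[of _ u3]) simp_all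
qed

lemma linear_form_sum: "linear_form d (\<lambda>x. \<Sum>a<d. x $ a * K a)"
proof -
  have "(\<Sum>a<d. (x + y) $ a * K a) = (\<Sum>a<d. x $ a * K a) + (\<Sum>a<d. y $ a * K a)"
    if "y \<in> carrier_vec d" for x y
    unfolding sum.distrib[symmetric] using that by (intro sum.cong) (auto simp: distrib_right)
  moreover have "(\<Sum>a<d. (c \<cdot>\<^sub>v x) $ a * K a) = c * (\<Sum>a<d. x $ a * K a)"
    if "x \<in> carrier_vec d" for x c
    unfolding sum_distrib_left using that by (intro sum.cong) (auto simp: mult.assoc)
  ultimately show ?thesis by (simp add: linear_form_def)
qed

lemma sum_scaled_swap:
  fixes u v :: "'a \<Rightarrow> 'k::comm_ring_1"
  shows "(\<Sum>a\<in>I. u a * (\<Sum>b\<in>J. v b * K a b)) = (\<Sum>b\<in>J. v b * (\<Sum>a\<in>I. u a * K a b))"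
proof -
  have "(\<Sum>a\<in>I. u a * (\<Sum>b\<in>J. v b * K a b)) = (\<Sum>a\<in>I. \<Sum>b\<in>J. v b * (u a * K a b))"
    by (simp add: sum_distrib_left ac_simps)
  also have "\<dots> = (\<Sum>b\<in>J. v b * (\<Sum>a\<in>I. u a * K a b))"
    unfolding sum_distrib_left by (rule sum.swap)
  finally show ?thesis .
qed

text \<open>A \<open>G\<close>-invariant function of three group elements that is a matrix coefficient of the highest
  weight vector in each of them lies in a graded piece: it extends to a trilinear form because the
  orbit of the highest weight vector spans.\<close>

lemma graded_piece_realization:
  fixes F :: "'k::field_char_0 mat \<Rightarrow> 'k mat \<Rightarrow> 'k mat \<Rightarrow> 'k"
  assumes n: "0 < n" and ks: "\<forall>k\<in>set ks1. k \<le> n" "\<forall>k\<in>set ks2. k \<le> n" "\<forall>k\<in>set ks3. k \<le> n"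
    and z: "signed_perm n (reversal n) \<epsilon> z"
    and F1: "\<And>x2 x3. x2 \<in> carrier (SL n) \<Longrightarrow> x3 \<in> carrier (SL n) \<Longrightarrow> (\<lambda>x1. F x1 x2 x3) \<in> orbit_funs n ks1"
    and F2: "\<And>x1 x3. x1 \<in> carrier (SL n) \<Longrightarrow> x3 \<in> carrier (SL n) \<Longrightarrow> (\<lambda>x2. F x1 x2 x3) \<in> orbit_funs n ks2"
    and F3: "\<And>x1 x2. x1 \<in> carrier (SL n) \<Longrightarrow> x2 \<in> carrier (SL n) \<Longrightarrow> (\<lambda>x3. F x1 x2 x3) \<in> orbit_funs n ks3"
    and inv: "\<And>h x1 x2 x3. h \<in> carrier (SL n) \<Longrightarrow> x1 \<in> carrier (SL n) \<Longrightarrow> x2 \<in> carrier (SL n) \<Longrightarrow>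
       x3 \<in> carrier (SL n) \<Longrightarrow> F (h * x1) (h * x2) (h * x3) = F x1 x2 x3"
  shows "\<exists>f\<in>graded_piece n (list_weight ks1) (list_weight ks2) (list_weight ks3).
    \<forall>g1\<in>carrier (SL n). \<forall>g2\<in>carrier (SL n). \<forall>g3\<in>carrier (SL n).
      f (conf3 n g1 g2 g3) = F (g1 * z) (g2 * z) (g3 * z)"
proof -
  have zS: "z \<in> carrier (SL n)" using z by (simp add: signed_perm_def)
  obtain d1 \<phi>1 X1 where "orbit_module n ks1 d1 (\<phi>1 :: nat \<Rightarrow> 'k mat \<Rightarrow> 'k) X1"
    using orbit_module_exists[OF n ks(1)] by blast
  then interpret M1: orbit_module n ks1 d1 \<phi>1 X1 .
  obtain d2 \<phi>2 X2 where "orbit_module n ks2 d2 (\<phi>2 :: nat \<Rightarrow> 'k mat \<Rightarrow> 'k) X2"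
    using orbit_module_exists[OF n ks(2)] by blast
  then interpret M2: orbit_module n ks2 d2 \<phi>2 X2 .
  obtain d3 \<phi>3 X3 where "orbit_module n ks3 d3 (\<phi>3 :: nat \<Rightarrow> 'k mat \<Rightarrow> 'k) X3"
    using orbit_module_exists[OF n ks(3)] by blast
  then interpret M3: orbit_module n ks3 d3 \<phi>3 X3 .
  define \<Phi> where "\<Phi> x y w = (\<Sum>a<d1. x $ a * (\<Sum>b<d2. y $ b * (\<Sum>c<d3. w $ c * F (X1 a) (X2 b) (X3 c))))"
    for x y w
  have tri: "trilinear_form d1 d2 d3 \<Phi>"
    unfolding trilinear_form_def
  proof (intro conjI ballI)
    fix y w show "linear_form d1 (\<lambda>x. \<Phi> x y w)"
      unfolding \<Phi>_def by (rule linear_form_sum)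
  next
    fix x w
    have "(\<lambda>y. \<Phi> x y w) = (\<lambda>y. \<Sum>b<d2. y $ b * (\<Sum>a<d1. x $ a * (\<Sum>c<d3. w $ c * F (X1 a) (X2 b) (X3 c))))"
      unfolding \<Phi>_def by (rule ext) (rule sum_scaled_swap)
    then show "linear_form d2 (\<lambda>y. \<Phi> x y w)" by (simp only: linear_form_sum)
  next
    fix x y
    have "(\<lambda>w. \<Phi> x y w) = (\<lambda>w. \<Sum>c<d3. w $ c * (\<Sum>a<d1. x $ a * (\<Sum>b<d2. y $ b * F (X1 a) (X2 b) (X3 c))))"
    proof
      fix w
      have "\<Phi> x y w = (\<Sum>a<d1. x $ a * (\<Sum>c<d3. w $ c * (\<Sum>b<d2. y $ b * F (X1 a) (X2 b) (X3 c))))"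
        unfolding \<Phi>_def by (intro sum.cong refl arg_cong2[of _ _ _ _ "(*)"] sum_scaled_swap)
      also have "\<dots> = (\<Sum>c<d3. w $ c * (\<Sum>a<d1. x $ a * (\<Sum>b<d2. y $ b * F (X1 a) (X2 b) (X3 c))))"
        by (rule sum_scaled_swap)
      finally show "\<Phi> x y w = (\<Sum>c<d3. w $ c * (\<Sum>a<d1. x $ a * (\<Sum>b<d2. y $ b * F (X1 a) (X2 b) (X3 c))))" .
    qed
    then show "linear_form d3 (\<lambda>w. \<Phi> x y w)" by (simp only: linear_form_sum)
  qed
  have translate: "\<Phi> (M1.rep g *\<^sub>v x) (M2.rep g *\<^sub>v y) (M3.rep g *\<^sub>v w) =
      (\<Sum>a<d1. x $ a * (\<Sum>b<d2. y $ b * (\<Sum>c<d3. w $ c * F (g * X1 a) (g * X2 b) (g * X3 c))))"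
    if g: "g \<in> carrier (SL n)" and c: "x \<in> carrier_vec d1" "y \<in> carrier_vec d2" "w \<in> carrier_vec d3"
    for g x y w
  proof -
    note XS = M1.X_SL M2.X_SL M3.X_SL and gX = SL_mult_closed[OF g]
    have 3: "(\<Sum>c<d3. (M3.rep g *\<^sub>v w) $ c * F (X1 a) (X2 b) (X3 c)) =
        (\<Sum>c<d3. w $ c * F (X1 a) (X2 b) (g * X3 c))" if "a < d1" "b < d2" for a b
      by (rule M3.pairing_rep[OF g c(3) F3[OF XS(1)[OF that(1)] XS(2)[OF that(2)]]])
    have 2: "(\<Sum>b<d2. (M2.rep g *\<^sub>v y) $ b * (\<Sum>c<d3. w $ c * F (X1 a) (X2 b) (g * X3 c))) =
        (\<Sum>b<d2. y $ b * (\<Sum>c<d3. w $ c * F (X1 a) (g * X2 b) (g * X3 c)))" if "a < d1" for a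
    proof (rule M2.pairing_rep[OF g c(2)], rule orbit_funs_sum)
      fix i assume "i \<in> {..<d3}"
      then show "(\<lambda>x2. F (X1 a) x2 (g * X3 i)) \<in> orbit_funs n ks2"
        using F2[OF XS(1)[OF that] gX[OF XS(3)]] by simp
    qed
    have 1: "(\<Sum>a<d1. (M1.rep g *\<^sub>v x) $ a * (\<Sum>b<d2. y $ b * (\<Sum>c<d3. w $ c * F (X1 a) (g * X2 b) (g * X3 c)))) =
        (\<Sum>a<d1. x $ a * (\<Sum>b<d2. y $ b * (\<Sum>c<d3. w $ c * F (g * X1 a) (g * X2 b) (g * X3 c))))"
    proof (rule M1.pairing_rep[OF g c(1)], rule orbit_funs_sum, rule orbit_funs_sum)
      fix j i assume "j \<in> {..<d2}" "i \<in> {..<d3}"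
      then show "(\<lambda>x1. F x1 (g * X2 j) (g * X3 i)) \<in> orbit_funs n ks1"
        using F1[OF gX[OF XS(2)] gX[OF XS(3)]] by simp
    qed
    have "\<Phi> (M1.rep g *\<^sub>v x) (M2.rep g *\<^sub>v y) (M3.rep g *\<^sub>v w) =
        (\<Sum>a<d1. (M1.rep g *\<^sub>v x) $ a * (\<Sum>b<d2. y $ b * (\<Sum>c<d3. w $ c * F (X1 a) (g * X2 b) (g * X3 c))))"
      unfolding \<Phi>_def by (simp only: 3[folded lessThan_iff] 2[folded lessThan_iff] cong: sum.cong)
    also note 1
    finally show ?thesis .
  qed
  have \<Phi>_inv: "\<Phi> (M1.rep g *\<^sub>v x) (M2.rep g *\<^sub>v y) (M3.rep g *\<^sub>v w) = \<Phi> x y w"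
    if "g \<in> carrier (SL n)" "x \<in> carrier_vec d1" "y \<in> carrier_vec d2" "w \<in> carrier_vec d3" for g x y w
  proof -
    have "(\<Sum>a<d1. x $ a * (\<Sum>b<d2. y $ b * (\<Sum>c<d3. w $ c * F (g * X1 a) (g * X2 b) (g * X3 c)))) = \<Phi> x y w"
      unfolding \<Phi>_def
      by (simp only: inv[OF that(1) M1.X_SL M2.X_SL M3.X_SL, folded lessThan_iff] cong: sum.cong)
    then show ?thesis using translate[OF that] by simp
  qed
  have \<Phi>_cvec: "\<Phi> (M1.cvec g1) (M2.cvec g2) (M3.cvec g3) = F g1 g2 g3"
    if g: "g1 \<in> carrier (SL n)" "g2 \<in> carrier (SL n)" "g3 \<in> carrier (SL n)" for g1 g2 g3
  proof -
    have 3: "(\<Sum>c<d3. M3.cvec g3 $ c * F (X1 a) (X2 b) (X3 c)) = F (X1 a) (X2 b) g3"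
      if "a < d1" "b < d2" for a b
      using M3.pairing_cvec[OF g(3) F3[OF M1.X_SL[OF that(1)] M2.X_SL[OF that(2)]]] .
    have 2: "(\<Sum>b<d2. M2.cvec g2 $ b * F (X1 a) (X2 b) g3) = F (X1 a) g2 g3" if "a < d1" for a
      using M2.pairing_cvec[OF g(2) F2[OF M1.X_SL[OF that] g(3)]] .
    have "\<Phi> (M1.cvec g1) (M2.cvec g2) (M3.cvec g3) = (\<Sum>a<d1. M1.cvec g1 $ a * F (X1 a) g2 g3)"
      unfolding \<Phi>_def by (simp only: 3[folded lessThan_iff] 2[folded lessThan_iff] cong: sum.cong)
    also have "\<dots> = F g1 g2 g3" using M1.pairing_cvec[OF g(1) F1[OF g(2,3)]] .
    finally show ?thesis .
  qed
  define V where "V = (\<lambda>(g1, g2, g3). F (g1 * z) (g2 * z) (g3 * z))"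
  have V_lowest: "V (g1, g2, g3) = \<Phi> (M1.rep g1 *\<^sub>v M1.cvec z) (M2.rep g2 *\<^sub>v M2.cvec z) (M3.rep g3 *\<^sub>v M3.cvec z)"
    if "g1 \<in> carrier (SL n)" "g2 \<in> carrier (SL n)" "g3 \<in> carrier (SL n)" for g1 g2 g3
    using that by (simp add: V_def M1.rep_cvec M2.rep_cvec M3.rep_cvec zS \<Phi>_cvec SL_mult_closed)
  note low1 = M1.lowest_weight_vector_cvec[OF z] and low2 = M2.lowest_weight_vector_cvec[OF z]
    and low3 = M3.lowest_weight_vector_cvec[OF z]
  have V_well: "V (h * (g1 * u1), h * (g2 * u2), h * (g3 * u3)) = V (g1, g2, g3)"
    if h: "h \<in> carrier (SL n)" and g: "g1 \<in> carrier (SL n)" "g2 \<in> carrier (SL n)" "g3 \<in> carrier (SL n)"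
      and u: "u1 \<in> Uminus n" "u2 \<in> Uminus n" "u3 \<in> Uminus n" for h g1 g2 g3 u1 u2 u3
  proof -
    note uS = u[THEN Uminus_SL] and gu = SL_mult_closed[OF _ Uminus_SL]
    have fix1: "M1.rep (g1 * u1) *\<^sub>v M1.cvec z = M1.rep g1 *\<^sub>v M1.cvec z"
    proof -
      have "M1.rep u1 *\<^sub>v M1.cvec z = M1.cvec z" using low1 u unfolding lowest_weight_vector_def by blast
      then show ?thesis using M1.rep_mult[OF g(1) uS(1)]
        by (simp add: assoc_mult_mat_vec[of _ d1 d1 _ d1])
    qed
    have fix2: "M2.rep (g2 * u2) *\<^sub>v M2.cvec z = M2.rep g2 *\<^sub>v M2.cvec z"
    proof -
      have "M2.rep u2 *\<^sub>v M2.cvec z = M2.cvec z" using low2 u unfolding lowest_weight_vector_def by blast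
      then show ?thesis using M2.rep_mult[OF g(2) uS(2)]
        by (simp add: assoc_mult_mat_vec[of _ d2 d2 _ d2])
    qed
    have fix3: "M3.rep (g3 * u3) *\<^sub>v M3.cvec z = M3.rep g3 *\<^sub>v M3.cvec z"
    proof -
      have "M3.rep u3 *\<^sub>v M3.cvec z = M3.cvec z" using low3 u unfolding lowest_weight_vector_def by blast
      then show ?thesis using M3.rep_mult[OF g(3) uS(3)]
        by (simp add: assoc_mult_mat_vec[of _ d3 d3 _ d3])
    qed
    have "V (h * (g1 * u1), h * (g2 * u2), h * (g3 * u3)) = F (h * (g1 * u1 * z)) (h * (g2 * u2 * z)) (h * (g3 * u3 * z))"
      using SL_assoc[OF h gu[OF g(1) u(1)] zS] SL_assoc[OF h gu[OF g(2) u(2)] zS] SL_assoc[OF h gu[OF g(3) u(3)] zS]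
      by (simp add: V_def)
    also have "\<dots> = V (g1 * u1, g2 * u2, g3 * u3)"
      unfolding V_def prod.case by (intro inv h SL_mult_closed[OF _ zS] gu g u)
    also have "\<dots> = V (g1, g2, g3)"
      using V_lowest[OF gu[OF g(1) u(1)] gu[OF g(2) u(2)] gu[OF g(3) u(3)]] V_lowest[OF g] fix1 fix2 fix3 by simp
    finally show ?thesis .
  qed
  let ?S3 = "carrier (SL n) \<times> carrier (SL n) \<times> carrier (SL n) :: ('k mat \<times> 'k mat \<times> 'k mat) set"
  \<comment> \<open>by \<open>V_well\<close> the choice of the representative does not matter\<close>
  define f where "f = (\<lambda>Y\<in>Conf3 n. V (SOME t. t \<in> ?S3 \<and> Y = (case t of (g1, g2, g3) \<Rightarrow> conf3 n g1 g2 g3)))"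
  have f_conf: "f (conf3 n g1 g2 g3) = V (g1, g2, g3)"
    if g: "g1 \<in> carrier (SL n)" "g2 \<in> carrier (SL n)" "g3 \<in> carrier (SL n)" for g1 g2 g3
  proof -
    let ?P = "\<lambda>t. t \<in> ?S3 \<and> conf3 n g1 g2 g3 = (case t of (g1, g2, g3) \<Rightarrow> conf3 n g1 g2 g3)"
    obtain g1' g2' g3' where t: "(SOME t. ?P t) = (g1', g2', g3')" by (cases "SOME t. ?P t") auto
    have "?P (g1, g2, g3)" using g by simp
    then have "?P (SOME t. ?P t)" by (rule someI)
    then have g': "g1' \<in> carrier (SL n)" "g2' \<in> carrier (SL n)" "g3' \<in> carrier (SL n)"
      and eq: "conf3 n g1 g2 g3 = conf3 n g1' g2' g3'" unfolding t by auto
    obtain h u1 u2 u3 where "h \<in> carrier (SL n)" "u1 \<in> Uminus n" "u2 \<in> Uminus n" "u3 \<in> Uminus n"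
      "g1 = h * (g1' * u1)" "g2 = h * (g2' * u2)" "g3 = h * (g3' * u3)"
      using conf3_eqD[OF g eq] by blast
    then have "V (g1, g2, g3) = V (g1', g2', g3')" using V_well g' by simp
    then show ?thesis unfolding f_def using conf3_in_Conf3[OF g] t by simp
  qed
  have f_reg: "f \<in> O_Conf3 n"
  proof -
    have "\<exists>p. p \<in> poly_funs (mat_coords n) \<and> (\<forall>g\<in>carrier (SL n). \<phi>1 a (g * z) = p g)" if "a < d1" for a
      using orbit_funs_right_translate_poly[OF ks(1) M1.\<phi>_orbit[OF that] zS] by (simp only: Bex_def)
    then obtain p1 where p1: "\<And>a. a < d1 \<Longrightarrow> p1 a \<in> poly_funs (mat_coords n)"
      "\<And>a g. a < d1 \<Longrightarrow> g \<in> carrier (SL n) \<Longrightarrow> \<phi>1 a (g * z) = p1 a g" by metis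
    have "\<exists>p. p \<in> poly_funs (mat_coords n) \<and> (\<forall>g\<in>carrier (SL n). \<phi>2 a (g * z) = p g)" if "a < d2" for a
      using orbit_funs_right_translate_poly[OF ks(2) M2.\<phi>_orbit[OF that] zS] by (simp only: Bex_def)
    then obtain p2 where p2: "\<And>a. a < d2 \<Longrightarrow> p2 a \<in> poly_funs (mat_coords n)"
      "\<And>a g. a < d2 \<Longrightarrow> g \<in> carrier (SL n) \<Longrightarrow> \<phi>2 a (g * z) = p2 a g" by metis
    have "\<exists>p. p \<in> poly_funs (mat_coords n) \<and> (\<forall>g\<in>carrier (SL n). \<phi>3 a (g * z) = p g)" if "a < d3" for a
      using orbit_funs_right_translate_poly[OF ks(3) M3.\<phi>_orbit[OF that] zS] by (simp only: Bex_def)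
    then obtain p3 where p3: "\<And>a. a < d3 \<Longrightarrow> p3 a \<in> poly_funs (mat_coords n)"
      "\<And>a g. a < d3 \<Longrightarrow> g \<in> carrier (SL n) \<Longrightarrow> \<phi>3 a (g * z) = p3 a g" by metis
    let ?p = "\<lambda>t. \<Sum>a<d1. (case t of (A, B, C) \<Rightarrow> p1 a A) * (\<Sum>b<d2. (case t of (A, B, C) \<Rightarrow> p2 b B) *
        (\<Sum>c<d3. (case t of (A, B, C) \<Rightarrow> p3 c C) * F (X1 a) (X2 b) (X3 c)))"
    have "?p \<in> poly_funs (mat3_coords n)"
      by (intro poly_funs_sum poly_funs.mult poly_funs.const poly_funs_mat3 p1 p2 p3) auto
    moreover have "f (conf3 n g1 g2 g3) = ?p (g1, g2, g3)"
      if g: "g1 \<in> carrier (SL n)" "g2 \<in> carrier (SL n)" "g3 \<in> carrier (SL n)" for g1 g2 g3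
    proof -
      have "V (g1, g2, g3) = \<Phi> (M1.cvec (g1 * z)) (M2.cvec (g2 * z)) (M3.cvec (g3 * z))"
        using g by (simp add: V_def \<Phi>_cvec SL_mult_closed zS)
      also have "\<dots> = ?p (g1, g2, g3)"
        unfolding \<Phi>_def prod.case using p1(2)[OF _ g(1)] p2(2)[OF _ g(2)] p3(2)[OF _ g(3)]
        by (simp add: M1.cvec_def M2.cvec_def M3.cvec_def)
      finally show ?thesis using f_conf[OF g] by simp
    qed
    moreover have "f \<in> extensional (Conf3 n)" by (simp add: f_def)
    ultimately show ?thesis unfolding O_Conf3_def by (intro CollectI conjI bexI[of _ ?p]) auto
  qed
  have f_form: "\<forall>g1\<in>carrier (SL n). \<forall>g2\<in>carrier (SL n). \<forall>g3\<in>carrier (SL n).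
      f (conf3 n g1 g2 g3) = \<Phi> (M1.rep g1 *\<^sub>v M1.cvec z) (M2.rep g2 *\<^sub>v M2.cvec z) (M3.rep g3 *\<^sub>v M3.cvec z)"
    using f_conf V_lowest by simp
  have \<Phi>_inv': "\<forall>g\<in>carrier (SL n). \<forall>x\<in>carrier_vec d1. \<forall>y\<in>carrier_vec d2. \<forall>w\<in>carrier_vec d3.
      \<Phi> (M1.rep g *\<^sub>v x) (M2.rep g *\<^sub>v y) (M3.rep g *\<^sub>v w) = \<Phi> x y w"
    by (intro ballI \<Phi>_inv)
  have "f \<in> graded_piece n (list_weight ks1) (list_weight ks2) (list_weight ks3)"
    unfolding graded_piece_def
    by (intro CollectI conjI exI, rule f_reg, rule M1.is_V, rule low1, rule M2.is_V, rule low2,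
        rule M3.is_V, rule low3, rule tri, rule \<Phi>_inv', rule f_form)
  then show ?thesis using f_conf by (intro bexI[of _ f]) (auto simp: V_def)
qed

section \<open>The invariant for a generalized minor\<close>

text \<open>If \<open>k\<close> consecutive columns of a square matrix are taken from \<open>g\<close> and the others are fixed, then
  iterated Laplace expansion along the fixed columns writes its determinant as a linear combination
  of minors of \<open>g\<close>.\<close>

lemma det_linear_in_minors:
  fixes C :: "nat \<Rightarrow> nat \<Rightarrow> 'k::comm_ring_1"
  assumes "lo + k \<le> m" "\<And>i. i < m \<Longrightarrow> a i < n"
  shows "\<exists>l. \<forall>g. det (mat m m (\<lambda>(i, q). if lo \<le> q \<and> q < lo + k then g $$ (a i, c (q - lo)) else C i q)) =
    (\<Sum>b\<in>PiE {..<k} (\<lambda>_. {..<n}). l b * det (mat k k (\<lambda>(p, q). g $$ (b p, c q))))"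
  using assms
proof (induction m arbitrary: lo a C)
  case 0
  then show ?case by (intro exI[of _ "\<lambda>_. 1"]) (simp add: PiE_empty_domain)
next
  case (Suc m)
  let ?M = "\<lambda>lo a C m (g :: 'k mat). mat m m (\<lambda>(i, q). if lo \<le> q \<and> q < lo + k then g $$ (a i, c (q - lo)) else C i q)"
  let ?B = "PiE {..<k} (\<lambda>_. {..<n})"
  have combine: ?case if exp: "\<And>g. det (?M lo a C (Suc m) g) = (\<Sum>i<Suc m. w i * det (?M lo' (a' i) (C' i) m g))"
      and lo': "lo' + k \<le> m" and a': "\<And>i j. i < Suc m \<Longrightarrow> j < m \<Longrightarrow> a' i j < n"
    for w lo' a' C'
  proof -
    have "\<forall>i\<in>{..<Suc m}. \<exists>l. \<forall>g. det (?M lo' (a' i) (C' i) m g) =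
        (\<Sum>b\<in>?B. l b * det (mat k k (\<lambda>(p, q). g $$ (b p, c q))))"
    proof
      fix i assume "i \<in> {..<Suc m}"
      then show "\<exists>l. \<forall>g. det (?M lo' (a' i) (C' i) m g) =
          (\<Sum>b\<in>?B. l b * det (mat k k (\<lambda>(p, q). g $$ (b p, c q))))"
        by (intro Suc.IH[OF lo'] a') simp
    qed
    from bchoice[OF this] obtain l where l: "\<forall>i\<in>{..<Suc m}. \<forall>g. det (?M lo' (a' i) (C' i) m g) =
        (\<Sum>b\<in>?B. l i b * det (mat k k (\<lambda>(p, q). g $$ (b p, c q))))" ..
    have "det (?M lo a C (Suc m) g) =
        (\<Sum>b\<in>?B. (\<Sum>i<Suc m. w i * l i b) * det (mat k k (\<lambda>(p, q). g $$ (b p, c q))))" for g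
    proof -
      have "det (?M lo a C (Suc m) g) =
          (\<Sum>i<Suc m. \<Sum>b\<in>?B. w i * l i b * det (mat k k (\<lambda>(p, q). g $$ (b p, c q))))"
        unfolding exp using l by (intro sum.cong refl) (auto simp: sum_distrib_left mult.assoc)
      also have "\<dots> = (\<Sum>b\<in>?B. (\<Sum>i<Suc m. w i * l i b) * det (mat k k (\<lambda>(p, q). g $$ (b p, c q))))"
        unfolding sum_distrib_right by (rule sum.swap)
      finally show ?thesis .
    qed
    then show ?thesis by (intro exI[of _ "\<lambda>b. \<Sum>i<Suc m. w i * l i b"] allI)
  qed
  consider "0 < lo" | "lo = 0" "k \<le> m" | "lo = 0" "k = Suc m" using Suc.prems by linarith
  then show ?case
  proof cases
    case 1
    then obtain lo' where lo: "lo = Suc lo'" by (cases lo) auto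
    let ?s = "\<lambda>i j. if j < i then j else Suc j"
    show ?thesis
    proof (rule combine[of "\<lambda>i. C i 0 * (-1) ^ i" lo' "\<lambda>i j. a (?s i j)" "\<lambda>i j q. C (?s i j) (Suc q)"])
      fix g :: "'k mat"
      have "mat_delete (?M lo a C (Suc m) g) i 0 =
          ?M lo' (\<lambda>j. a (?s i j)) (\<lambda>j q. C (?s i j) (Suc q)) m g" if "i < Suc m" for i
        using that lo by (intro eq_matI) (auto simp: mat_delete_def)
      then show "det (?M lo a C (Suc m) g) = (\<Sum>i<Suc m. C i 0 * (-1) ^ i *
          det (?M lo' (\<lambda>j. a (?s i j)) (\<lambda>j q. C (?s i j) (Suc q)) m g))"
        using lo by (subst laplace_expansion_column[of _ "Suc m" 0])
          (auto simp: cofactor_def mult.assoc simp del: sum.lessThan_Suc intro!: sum.cong)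
    qed (use Suc.prems lo in auto)
  next
    case 2
    let ?s = "\<lambda>i j. if j < i then j else Suc j"
    show ?thesis
    proof (rule combine[of "\<lambda>i. C i m * (-1) ^ (i + m)" lo "\<lambda>i j. a (?s i j)" "\<lambda>i j q. C (?s i j) q"])
      fix g :: "'k mat"
      have "mat_delete (?M lo a C (Suc m) g) i m =
          ?M lo (\<lambda>j. a (?s i j)) (\<lambda>j q. C (?s i j) q) m g" if "i < Suc m" for i
        using that 2 by (intro eq_matI) (auto simp: mat_delete_def)
      then show "det (?M lo a C (Suc m) g) = (\<Sum>i<Suc m. C i m * (-1) ^ (i + m) *
          det (?M lo (\<lambda>j. a (?s i j)) (\<lambda>j q. C (?s i j) q) m g))"
        using 2 by (subst laplace_expansion_column[of _ "Suc m" m])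
          (auto simp: cofactor_def mult.assoc simp del: sum.lessThan_Suc intro!: sum.cong)
    qed (use Suc.prems 2 in auto)
  next
    case 3
    let ?a = "\<lambda>p\<in>{..<k}. a p"
    have a: "?a \<in> ?B" using Suc.prems 3 by (auto simp: PiE_iff)
    have "det (?M lo a C (Suc m) g) =
        (\<Sum>b\<in>?B. (if b = ?a then 1 else 0) * det (mat k k (\<lambda>(p, q). g $$ (b p, c q))))" for g
    proof -
      have "(\<Sum>b\<in>?B. (if b = ?a then 1 else 0) * det (mat k k (\<lambda>(p, q). g $$ (b p, c q)))) =
          (\<Sum>b\<in>?B. if b = ?a then det (mat k k (\<lambda>(p, q). g $$ (?a p, c q))) else 0)"
        by (intro sum.cong) auto
      also have "\<dots> = det (mat k k (\<lambda>(p, q). g $$ (?a p, c q)))"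
        using a by (simp add: finite_PiE)
      also have "mat k k (\<lambda>(p, q). g $$ (?a p, c q)) = ?M lo a C (Suc m) g"
        using 3 by (intro eq_matI) auto
      finally show ?thesis ..
    qed
    then show ?thesis by (intro exI[of _ "\<lambda>b. if b = ?a then 1 else 0"] allI)
  qed
qed

lemma det_reverse_columns:
  "\<exists>s. \<forall>e. det (mat k k (\<lambda>(p, q). e p (k - 1 - q))) = s * det (mat k k (\<lambda>(p, q). e p q :: 'k::comm_ring_1))"
proof (intro exI allI)
  fix e :: "nat \<Rightarrow> nat \<Rightarrow> 'k"
  let ?A = "mat k k (\<lambda>(p, q). e p q)"
  let ?J = "mat k k (\<lambda>(p, q). if p = k - 1 - q then 1 else 0) :: 'k mat"
  have "mat k k (\<lambda>(p, q). e p (k - 1 - q)) = ?A * ?J"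
  proof (rule eq_matI)
    fix p q assume "p < dim_row (?A * ?J)" "q < dim_col (?A * ?J)"
    then have pq: "p < k" "q < k" by auto
    have "(?A * ?J) $$ (p, q) = (\<Sum>c<k. ?A $$ (p, c) * ?J $$ (c, q))"
      by (rule mat_mult_entry[of _ k k _ k]) (use pq in auto)
    also have "\<dots> = (\<Sum>c<k. if c = k - 1 - q then e p (k - 1 - q) else 0)"
      using pq by (intro sum.cong) auto
    finally show "mat k k (\<lambda>(p, q). e p (k - 1 - q)) $$ (p, q) = (?A * ?J) $$ (p, q)"
      using pq by simp
  qed auto
  then show "det (mat k k (\<lambda>(p, q). e p (k - 1 - q))) = det ?J * det ?A"
    using det_mult[of ?A k ?J] by (simp add: mult.commute)
qed

text \<open>A determinant of functions that are linear in minors is linear in products of minors.\<close>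

lemma det_orbit_funs:
  assumes "\<And>r s. r < length ks \<Longrightarrow> s < length ks \<Longrightarrow>
    \<exists>l. \<forall>g\<in>carrier (SL n). \<psi> r s g = (\<Sum>b\<in>PiE {..<ks ! r} (\<lambda>_. {..<n}). l b * flag_minor (ks ! r) b g)"
  shows "(\<lambda>g. det (mat (length ks) (length ks) (\<lambda>(r, s). \<psi> r s g))) \<in> orbit_funs n ks"
proof -
  let ?m = "length ks"
  let ?B = "\<lambda>r. PiE {..<ks ! r} (\<lambda>_. {..<n})"
  have "\<forall>rs\<in>{..<?m} \<times> {..<?m}. \<exists>l. \<forall>g\<in>carrier (SL n). \<psi> (fst rs) (snd rs) g =
      (\<Sum>b\<in>?B (fst rs). l b * flag_minor (ks ! fst rs) b g)" using assms by auto
  from bchoice[OF this] obtain l where l: "\<forall>rs\<in>{..<?m} \<times> {..<?m}. \<forall>g\<in>carrier (SL n).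
      \<psi> (fst rs) (snd rs) g = (\<Sum>b\<in>?B (fst rs). l rs b * flag_minor (ks ! fst rs) b g)" ..
  have l': "\<psi> r s g = (\<Sum>b\<in>?B r. l (r, s) b * flag_minor (ks ! r) b g)"
    if "r < ?m" "s < ?m" "g \<in> carrier (SL n)" for r s g
    using bspec[OF bspec[OF l, of "(r, s)"] that(3)] that by simp
  have "det (mat ?m ?m (\<lambda>(r, s). \<psi> r s g)) = (\<Sum>a\<in>row_families n ks.
      (\<Sum>\<sigma> | \<sigma> permutes {..<?m}. signof \<sigma> * (\<Prod>r<?m. l (r, \<sigma> r) (a r))) * flag_coord ks a g)"
    if g: "g \<in> carrier (SL n)" for g
  proof -
    have "(\<Prod>r<?m. \<psi> r (\<sigma> r) g) =
        (\<Sum>a\<in>row_families n ks. (\<Prod>r<?m. l (r, \<sigma> r) (a r)) * flag_coord ks a g)"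
      if "\<sigma> permutes {..<?m}" for \<sigma>
    proof -
      have "\<sigma> r < ?m" if "r < ?m" for r
        using permutes_in_image[OF \<open>\<sigma> permutes {..<?m}\<close>, of r] that by simp
      then have "(\<Prod>r<?m. \<psi> r (\<sigma> r) g) = (\<Prod>r<?m. \<Sum>b\<in>?B r. l (r, \<sigma> r) b * flag_minor (ks ! r) b g)"
        using l' g by (intro prod.cong) auto
      also have "\<dots> = (\<Sum>a\<in>row_families n ks. \<Prod>r<?m. l (r, \<sigma> r) (a r) * flag_minor (ks ! r) (a r) g)"
        unfolding row_families_def by (rule prod_sum_PiE) (auto intro: finite_PiE)
      finally show ?thesis by (simp add: flag_coord_def prod.distrib)
    qed
    then have "det (mat ?m ?m (\<lambda>(r, s). \<psi> r s g)) = (\<Sum>\<sigma> | \<sigma> permutes {..<?m}. \<Sum>a\<in>row_families n ks.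
        signof \<sigma> * (\<Prod>r<?m. l (r, \<sigma> r) (a r)) * flag_coord ks a g)"
      unfolding det_mat_permutes by (intro sum.cong) (auto simp: sum_distrib_left mult.assoc)
    also have "\<dots> = (\<Sum>a\<in>row_families n ks.
        (\<Sum>\<sigma> | \<sigma> permutes {..<?m}. signof \<sigma> * (\<Prod>r<?m. l (r, \<sigma> r) (a r))) * flag_coord ks a g)"
      unfolding sum_distrib_right by (rule sum.swap)
    finally show ?thesis .
  qed
  then show ?thesis unfolding orbit_funs_def mem_Collect_eq
    by (intro exI[of _ "\<lambda>a. \<Sum>\<sigma> | \<sigma> permutes {..<?m}. signof \<sigma> * (\<Prod>r<?m. l (r, \<sigma> r) (a r))"] ballI)
qed

text \<open>The determinant of \<open>flag_matrix n j s x1 x2 x3\<close> pairs column \<open>s\<close> of the third matrix with the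
  first \<open>j\<close> columns of the second and the first \<open>n - 1 - j\<close> columns of the first. If these columns
  span opposite coordinate flags, this picks the \<open>j\<close>-th coordinate, so that the determinant of
  these numbers for \<open>j = J 0, \<dots>, J (i - 1)\<close> and \<open>s = 0, \<dots>, i - 1\<close> becomes the minor with rows
  \<open>J\<close> and columns \<open>0, \<dots>, i - 1\<close>.\<close>

definition flag_matrix :: "nat \<Rightarrow> nat \<Rightarrow> nat \<Rightarrow> 'k::comm_ring_1 mat \<Rightarrow> 'k mat \<Rightarrow> 'k mat \<Rightarrow> 'k mat" where
  "flag_matrix n j s x1 x2 x3 = mat n n (\<lambda>(p, q).
     if q < j then x2 $$ (p, q) else if q = j then x3 $$ (p, s) else x1 $$ (p, n - 1 - q))"

definition triple_det :: "nat \<Rightarrow> nat \<Rightarrow> (nat \<Rightarrow> nat) \<Rightarrow> 'k::comm_ring_1 mat \<Rightarrow> 'k mat \<Rightarrow> 'k mat \<Rightarrow> 'k" where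
  "triple_det n i J x1 x2 x3 = det (mat i i (\<lambda>(r, s). det (flag_matrix n (J r) s x1 x2 x3)))"

lemma triple_det_orbit1:
  assumes J: "\<And>r. r < i \<Longrightarrow> J r < n"
  shows "(\<lambda>x1. triple_det n i J x1 x2 x3) \<in> orbit_funs n (map (\<lambda>r. n - 1 - J r) [0..<i])"
proof -
  let ?ks = "map (\<lambda>r. n - 1 - J r) [0..<i]"
  have "(\<lambda>g. det (mat (length ?ks) (length ?ks) (\<lambda>(r, s). det (flag_matrix n (J r) s g x2 x3)))) \<in> orbit_funs n ?ks"
  proof (rule det_orbit_funs)
    fix r s assume "r < length ?ks" "s < length ?ks"
    then have r: "r < i" by simp
    then have j: "J r < n" using J by simp
    let ?k = "n - 1 - J r" and ?lo = "Suc (J r)"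
    let ?C = "\<lambda>p q. if q < J r then x2 $$ (p, q) else x3 $$ (p, s)"
    have eq: "flag_matrix n (J r) s g x2 x3 =
        mat n n (\<lambda>(p, q). if ?lo \<le> q \<and> q < ?lo + ?k then g $$ (p, ?k - 1 - (q - ?lo)) else ?C p q)" for g
      unfolding flag_matrix_def using j by (intro cong_mat) (auto intro!: arg_cong2[of _ _ _ _ "\<lambda>p q. g $$ (p, q)"])
    obtain l where l: "\<forall>g. det (flag_matrix n (J r) s g x2 x3) =
        (\<Sum>b\<in>PiE {..<?k} (\<lambda>_. {..<n}). l b * det (mat ?k ?k (\<lambda>(p, q). g $$ (b p, ?k - 1 - q))))"
      using det_linear_in_minors[of ?lo ?k n "\<lambda>p. p" n "\<lambda>q. ?k - 1 - q" ?C] j unfolding eq by auto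
    obtain \<theta> where \<theta>: "\<forall>e. det (mat ?k ?k (\<lambda>(p, q). e p (?k - 1 - q))) = \<theta> * det (mat ?k ?k (\<lambda>(p, q). e p q :: 'a))"
      using det_reverse_columns by blast
    have "det (flag_matrix n (J r) s g x2 x3) =
        (\<Sum>b\<in>PiE {..<?k} (\<lambda>_. {..<n}). l b * \<theta> * flag_minor ?k b g)" for g
      unfolding l[rule_format] flag_minor_def
      by (intro sum.cong refl) (use \<theta>[rule_format, of "\<lambda>p q. g $$ (_ p, q)"] in \<open>simp add: mult.assoc\<close>)
    then show "\<exists>l. \<forall>g\<in>carrier (SL n). det (flag_matrix n (J r) s g x2 x3) =
        (\<Sum>b\<in>PiE {..<?ks ! r} (\<lambda>_. {..<n}). l b * flag_minor (?ks ! r) b g)"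
      using r by (intro exI[of _ "\<lambda>b. l b * \<theta>"]) simp
  qed
  then show ?thesis by (simp add: triple_det_def)
qed

lemma triple_det_orbit2:
  assumes J: "\<And>r. r < i \<Longrightarrow> J r < n"
  shows "(\<lambda>x2. triple_det n i J x1 x2 x3) \<in> orbit_funs n (map J [0..<i])"
proof -
  let ?ks = "map J [0..<i]"
  have "(\<lambda>g. det (mat (length ?ks) (length ?ks) (\<lambda>(r, s). det (flag_matrix n (J r) s x1 g x3)))) \<in> orbit_funs n ?ks"
  proof (rule det_orbit_funs)
    fix r s assume "r < length ?ks" "s < length ?ks"
    then have r: "r < i" by simp
    then have j: "J r < n" using J by simp
    let ?C = "\<lambda>p q. if q = J r then x3 $$ (p, s) else x1 $$ (p, n - 1 - q)"
    have eq: "flag_matrix n (J r) s x1 g x3 =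
        mat n n (\<lambda>(p, q). if 0 \<le> q \<and> q < 0 + J r then g $$ (p, q - 0) else ?C p q)" for g
      unfolding flag_matrix_def by (intro cong_mat) auto
    obtain l where "\<forall>g. det (flag_matrix n (J r) s x1 g x3) =
        (\<Sum>b\<in>PiE {..<J r} (\<lambda>_. {..<n}). l b * det (mat (J r) (J r) (\<lambda>(p, q). g $$ (b p, q))))"
      using det_linear_in_minors[of 0 "J r" n "\<lambda>p. p" n "\<lambda>q. q" ?C] j unfolding eq by auto
    then show "\<exists>l. \<forall>g\<in>carrier (SL n). det (flag_matrix n (J r) s x1 g x3) =
        (\<Sum>b\<in>PiE {..<?ks ! r} (\<lambda>_. {..<n}). l b * flag_minor (?ks ! r) b g)"
      unfolding flag_minor_def using r by (intro exI[of _ l]) simp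
  qed
  then show ?thesis by (simp add: triple_det_def)
qed

lemma triple_det_orbit3:
  assumes J: "\<And>r. r < i \<Longrightarrow> J r < n"
  shows "(\<lambda>x3. triple_det n i J x1 x2 x3) \<in> orbit_funs n [i]"
proof -
  \<comment> \<open>these cofactors do not involve column \<open>J r\<close>, so the third matrix and \<open>s = 0\<close> are dummies\<close>
  define G where "G r p = cofactor (flag_matrix n (J r) 0 x1 x2 x1) p (J r)" for r p
  have D: "det (flag_matrix n (J r) s x1 x2 g) = (\<Sum>p<n. G r p * g $$ (p, s))" if r: "r < i" for r s g
  proof -
    have "det (flag_matrix n (J r) s x1 x2 g) =
        (\<Sum>p<n. flag_matrix n (J r) s x1 x2 g $$ (p, J r) * cofactor (flag_matrix n (J r) s x1 x2 g) p (J r))"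
      by (rule laplace_expansion_column) (use J[OF r] in \<open>auto simp: flag_matrix_def\<close>)
    also have "\<dots> = (\<Sum>p<n. G r p * g $$ (p, s))"
    proof (intro sum.cong refl)
      fix p assume "p \<in> {..<n}"
      then have p: "p < n" by simp
      have "mat_delete (flag_matrix n (J r) s x1 x2 g) p (J r) =
          mat_delete (flag_matrix n (J r) 0 x1 x2 x1) p (J r)"
        using p J[OF r] by (intro eq_matI) (auto simp: mat_delete_def flag_matrix_def)
      then show "flag_matrix n (J r) s x1 x2 g $$ (p, J r) * cofactor (flag_matrix n (J r) s x1 x2 g) p (J r) =
          G r p * g $$ (p, s)"
        using p J[OF r] by (simp add: G_def cofactor_def flag_matrix_def mult.commute)
    qed
    finally show ?thesis .
  qed
  have "triple_det n i J x1 x2 g = (\<Sum>b\<in>PiE {..<i} (\<lambda>_. {..<n}). (\<Prod>r<i. G r (b r)) * flag_minor i b g)" for g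
  proof -
    have "triple_det n i J x1 x2 g = det (mat i i (\<lambda>(r, s). \<Sum>p<n. G r p * g $$ (p, s)))"
      unfolding triple_det_def by (intro arg_cong[of _ _ det] cong_mat) (auto simp: D)
    then show ?thesis unfolding flag_minor_def by (simp only: det_sum_rows)
  qed
  moreover have "(\<Sum>b\<in>PiE {..<i} (\<lambda>_. {..<n}). K b) = (\<Sum>a\<in>row_families n [i]. K (a 0))"
    for K :: "(nat \<Rightarrow> nat) \<Rightarrow> 'a"
  proof -
    have "(\<Prod>r<length [i]. \<Sum>b\<in>PiE {..<[i] ! r} (\<lambda>_. {..<n}). K b) =
        (\<Sum>a\<in>row_families n [i]. \<Prod>r<length [i]. K (a r))"
      unfolding row_families_def by (rule prod_sum_PiE) (auto intro: finite_PiE)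
    then show ?thesis by simp
  qed
  ultimately have "triple_det n i J x1 x2 g =
      (\<Sum>a\<in>row_families n [i]. (\<Prod>r<i. G r (a 0 r)) * flag_coord [i] a g)" for g
    by (simp add: flag_coord_def)
  then show ?thesis unfolding orbit_funs_def mem_Collect_eq
    by (intro exI[of _ "\<lambda>a. \<Prod>r<i. G r (a 0 r)"] ballI)
qed

lemma triple_det_invariant:
  assumes h: "h \<in> carrier (SL n)" and x: "x1 \<in> carrier_mat n n" "x2 \<in> carrier_mat n n" "x3 \<in> carrier_mat n n"
    and i: "i \<le> n"
  shows "triple_det n i J (h * x1) (h * x2) (h * x3) = triple_det n i J x1 x2 x3"
  unfolding triple_det_def
proof (intro arg_cong[of _ _ det] cong_mat refl, clarify)
  fix r s assume rs: "r < i" "s < i"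
  note hc = SL_carrier_mat[OF h]
  let ?N = "flag_matrix n (J r) s x1 x2 x3"
  have Nc: "?N \<in> carrier_mat n n" by (simp add: flag_matrix_def)
  have "flag_matrix n (J r) s (h * x1) (h * x2) (h * x3) = h * ?N"
  proof (rule eq_matI)
    fix p q assume "p < dim_row (h * ?N)" "q < dim_col (h * ?N)"
    then have pq: "p < n" "q < n" using hc Nc by auto
    have s: "s < n" and q': "n - 1 - q < n" using rs i by auto
    have "(h * ?N) $$ (p, q) = (\<Sum>c<n. h $$ (p, c) * ?N $$ (c, q))"
      by (rule mat_mult_entry[OF hc Nc pq])
    then show "flag_matrix n (J r) s (h * x1) (h * x2) (h * x3) $$ (p, q) = (h * ?N) $$ (p, q)"
      using pq s q' mat_mult_entry[OF hc x(1) pq(1) q'] mat_mult_entry[OF hc x(2) pq]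
        mat_mult_entry[OF hc x(3) pq(1) s]
      by (auto simp: flag_matrix_def simp del: index_mult_mat(1))
  qed (use hc Nc in \<open>auto simp: flag_matrix_def\<close>)
  then show "det (flag_matrix n (J r) s (h * x1) (h * x2) (h * x3)) = det ?N"
    using det_mult[OF hc Nc] h by (simp add: SL_iff)
qed

lemma det_scale_rows_columns:
  fixes e :: "nat \<Rightarrow> nat \<Rightarrow> 'k::comm_ring_1"
  shows "det (mat i i (\<lambda>(r, s). \<alpha> r * e r s * \<beta> s)) = (\<Prod>r<i. \<alpha> r) * (\<Prod>s<i. \<beta> s) * det (mat i i (\<lambda>(r, s). e r s))"
  unfolding det_mat_permutes sum_distrib_left
proof (intro sum.cong refl)
  fix \<sigma> assume "\<sigma> \<in> {\<sigma>. \<sigma> permutes {..<i}}"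
  then have "(\<Prod>r<i. \<beta> (\<sigma> r)) = (\<Prod>s<i. \<beta> s)"
    using prod.permute[of \<sigma> "{..<i}" \<beta>] by (simp add: o_def)
  then show "signof \<sigma> * (\<Prod>p<i. \<alpha> p * e p (\<sigma> p) * \<beta> (\<sigma> p)) =
      (\<Prod>r<i. \<alpha> r) * (\<Prod>s<i. \<beta> s) * (signof \<sigma> * (\<Prod>p<i. e p (\<sigma> p)))"
    by (simp add: prod.distrib ac_simps)
qed

text \<open>Cramer's rule for a diagonal matrix with diagonal entries \<open>\<plusminus>1\<close>.\<close>

lemma det_diagonal_replace_column:
  fixes e :: "nat \<Rightarrow> 'k::field"
  assumes e: "\<And>q. q < n \<Longrightarrow> e q * e q = 1" and j: "j < n"
  shows "det (mat n n (\<lambda>(p, q). if q = j then b p else if p = q then e q else 0)) = e j * b j * (\<Prod>q<n. e q)"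
proof -
  let ?A = "mat n n (\<lambda>(p, q). if p = q then e q else 0)"
  let ?x = "vec n (\<lambda>q. e q * b q)"
  have "?A *\<^sub>v ?x = vec n b"
  proof (rule eq_vecI)
    fix p assume "p < dim_vec (vec n b)"
    then have p: "p < n" by simp
    have "(?A *\<^sub>v ?x) $ p = (\<Sum>q<n. (if p = q then e q else 0) * (e q * b q))"
      using p by (auto simp: scalar_prod_def atLeast0LessThan intro!: sum.cong)
    also have "\<dots> = (\<Sum>q<n. if q = p then b p else 0)"
      using p e by (intro sum.cong) (auto simp: mult.assoc[symmetric])
    finally show "(?A *\<^sub>v ?x) $ p = vec n b $ p" using p by simp
  qed auto
  then have "mat n n (\<lambda>(p, q). if q = j then b p else if p = q then e q else 0) = replace_col ?A (?A *\<^sub>v ?x) j"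
    unfolding replace_col_def by (intro eq_matI) auto
  moreover have "det ?A = (\<Prod>q<n. e q)"
    by (subst det_upper_triangular[of _ n]) (auto simp: prod_list_diag_prod atLeast0LessThan intro!: prod.cong)
  ultimately show ?thesis using cramer_lemma_mat[of ?A n ?x j] j by simp
qed

lemma triple_det_value:
  fixes z :: "'k::field_char_0 mat"
  assumes z: "signed_perm n (reversal n) \<epsilon> z" and J: "\<And>r. r < i \<Longrightarrow> J r < n" and i: "i \<le> n"
  shows "\<exists>\<kappa>. \<kappa> \<noteq> 0 \<and> (\<forall>y\<in>carrier_mat n n. triple_det n i J z (z * z) (y * (z * z)) =
    \<kappa> * det (mat i i (\<lambda>(r, s). y $$ (J r, s))))"
proof -
  define \<delta> where "\<delta> q = \<epsilon> (reversal n q) * \<epsilon> q" for q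
  have "signed_perm n (reversal n \<circ> reversal n) \<delta> (z * z)"
    unfolding \<delta>_def by (rule signed_perm_mult[OF z z reversal_permutes])
  moreover have "reversal n \<circ> reversal n = id" by (auto simp: reversal_def fun_eq_iff)
  ultimately have zz: "signed_perm n id \<delta> (z * z)" by simp
  have zzc: "z * z \<in> carrier_mat n n"
    using zz unfolding signed_perm_def by (blast dest: SL_carrier_mat)
  have sq: "\<epsilon> q * \<epsilon> q = 1" "\<delta> q * \<delta> q = 1" for q using z zz unfolding signed_perm_def by blast+
  then have nz: "\<epsilon> q \<noteq> 0" "\<delta> q \<noteq> 0" for q by (metis mult_zero_left zero_neq_one)+
  have ze: "z $$ (p, q) = (if p = reversal n q then \<epsilon> q else 0)" if "p < n" "q < n" for p q
    using z that by (simp add: signed_perm_def)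
  have zze: "(z * z) $$ (p, q) = (if p = q then \<delta> q else 0)" if "p < n" "q < n" for p q
    using zz that by (simp add: signed_perm_def del: index_mult_mat(1))
  \<comment> \<open>apart from column \<open>j\<close> the flag matrix is diagonal with these entries; for \<open>q = j\<close> either sign
    would do\<close>
  define e where "e j q = (if q < j then \<delta> q else if q = j then 1 else \<epsilon> (n - 1 - q))" for j q
  have e: "e j q * e j q = 1" for j q using sq by (simp add: e_def)
  have enz: "e j q \<noteq> 0" for j q using nz by (simp add: e_def)
  let ?\<kappa> = "(\<Prod>r<i. \<Prod>q<n. e (J r) q) * (\<Prod>s<i. \<delta> s)"
  have "triple_det n i J z (z * z) (y * (z * z)) = ?\<kappa> * det (mat i i (\<lambda>(r, s). y $$ (J r, s)))"
    if y: "y \<in> carrier_mat n n" for y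
  proof -
    have yz: "(y * (z * z)) $$ (p, s) = y $$ (p, s) * \<delta> s" if "p < n" "s < n" for p s
    proof -
      have "(y * (z * z)) $$ (p, s) = (\<Sum>c<n. if c = s then y $$ (p, s) * \<delta> s else 0)"
        unfolding mat_mult_entry[OF y zzc that] using zze that by (intro sum.cong) (auto simp del: index_mult_mat(1))
      then show ?thesis using that by simp
    qed
    have "det (flag_matrix n (J r) s z (z * z) (y * (z * z))) =
        (\<Prod>q<n. e (J r) q) * y $$ (J r, s) * \<delta> s" if rs: "r < i" "s < i" for r s
    proof -
      have s: "s < n" using rs i by simp
      have "flag_matrix n (J r) s z (z * z) (y * (z * z)) =
          mat n n (\<lambda>(p, q). if q = J r then y $$ (p, s) * \<delta> s else if p = q then e (J r) q else 0)"
        unfolding flag_matrix_def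
        using s by (intro cong_mat) (auto simp: yz zze ze e_def reversal_def simp del: index_mult_mat(1))
      then show ?thesis
        using det_diagonal_replace_column[of n "e (J r)" "J r" "\<lambda>p. y $$ (p, s) * \<delta> s"] e J[OF rs(1)]
        by (simp add: e_def[of "J r" "J r"] ac_simps)
    qed
    then have "triple_det n i J z (z * z) (y * (z * z)) =
        det (mat i i (\<lambda>(r, s). (\<Prod>q<n. e (J r) q) * y $$ (J r, s) * \<delta> s))"
      unfolding triple_det_def by (intro arg_cong[of _ _ det] cong_mat) auto
    then show ?thesis by (simp only: det_scale_rows_columns)
  qed
  moreover have "?\<kappa> \<noteq> 0" using enz nz by simp
  ultimately show ?thesis by blast
qed

text \<open>Up to a constant factor, which is a sign, \<open>\<Delta>\<^bsub>u\<omega>\<^sub>i,\<omega>\<^sub>i\<^esub>\<close> is the minor with rows \<open>u 0, \<dots>, u (i - 1)\<close>.\<close>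

lemma gen_minor_eq_minor:
  assumes n: "0 < n" and i: "i \<le> n" and u: "u permutes {..<n}"
  shows "\<exists>\<kappa>. \<forall>y\<in>carrier (SL n).
    (gen_minor n u id i y :: 'k::field_char_0) = \<kappa> * det (mat i i (\<lambda>(r, s). y $$ (u r, s)))"
proof -
  let ?u = "weyl_lift n u :: 'k mat"
  obtain \<epsilon> where su: "signed_perm n u \<epsilon> ?u" using weyl_lift_signed_perm[OF u] by blast
  have uS: "?u \<in> carrier (SL n)" using su by (simp add: signed_perm_def)
  note uc = SL_carrier_mat[OF uS]
  have "gen_minor n u id i y = (\<Prod>r<i. \<epsilon> r) * det (mat i i (\<lambda>(r, s). y $$ (u r, s)))"
    if y: "y \<in> carrier (SL n)" for y
  proof -
    let ?A = "inv\<^bsub>SL n\<^esub> ?u * y"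
    have Ac: "?A \<in> carrier_mat n n" using SL_carrier_mat[OF SL_mult_closed[OF SL_inv_closed[OF uS] y]] .
    have uA: "?u * ?A = y" using SL_inv_cancel(1)[OF uS y] .
    have ent: "?A $$ (r, s) = \<epsilon> r * y $$ (u r, s)" if rs: "r < i" "s < i" for r s
    proof -
      have r: "r < n" "s < n" using rs i by auto
      have ur: "u r < n" using permutes_in_image[OF u, of r] r by simp
      have "(?u * ?A) $$ (u r, s) = (\<Sum>c<n. ?u $$ (u r, c) * ?A $$ (c, s))"
        by (rule mat_mult_entry[OF uc Ac ur r(2)])
      also have "\<dots> = (\<Sum>c<n. if c = r then \<epsilon> r * ?A $$ (r, s) else 0)"
        using su ur permutes_inj[OF u]
        by (intro sum.cong) (auto simp: signed_perm_def inj_eq simp del: index_mult_mat(1))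
      finally have "y $$ (u r, s) = \<epsilon> r * ?A $$ (r, s)" using r uA by simp
      moreover have "\<epsilon> r * \<epsilon> r = 1" using su unfolding signed_perm_def by blast
      ultimately show ?thesis by (metis mult.assoc mult_1)
    qed
    have "gen_minor n u id i y = det (lead i ?A)"
      by (rule gen_minor_eq_lead[OF n i uS weyl_lift_id y])
    also have "lead i ?A = mat i i (\<lambda>(r, s). \<epsilon> r * y $$ (u r, s) * 1)"
      unfolding lead_def by (intro cong_mat) (auto simp: ent simp del: index_mult_mat(1))
    also have "det (mat i i (\<lambda>(r, s). \<epsilon> r * y $$ (u r, s) * 1)) =
        (\<Prod>r<i. \<epsilon> r) * (\<Prod>s<i. 1) * det (mat i i (\<lambda>(r, s). y $$ (u r, s)))"
      by (rule det_scale_rows_columns)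
    finally show ?thesis by (simp only: prod.neutral_const mult_1_right)
  qed
  then show ?thesis by blast
qed

lemma orbit_funs_scale: "\<psi> \<in> orbit_funs n ks \<Longrightarrow> (\<lambda>g. c * \<psi> g) \<in> orbit_funs n ks"
  using orbit_funs_sum[of "{()}" "\<lambda>_. \<psi>" n ks "\<lambda>_. c"] by simp

theorem proposition3p2:
  fixes n :: nat and word :: "nat list"
  assumes "2 \<le> n"
    and "reduced_word n (longest n) word"
  shows "\<forall>l \<in> {1..length word}.
    \<exists>lam mu nu. dominant n lam \<and> dominant n mu \<and> dominant n nu \<and>
      (\<exists>f \<in> graded_piece n lam mu nu. \<forall>y \<in> Bminus n.
        f (Bminus_to_Conf3 n y) =
          (gen_minor n (weyl_word (take l word)) id (word ! (l - 1)) y :: 'k::field_char_0))"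
proof
  fix l assume l: "l \<in> {1..length word}"
  define u where "u = weyl_word (take l word)"
  define i where "i = word ! (l - 1)"
  have n: "0 < n" using assms(1) by simp
  have word: "set word \<subseteq> {1..<n}" using assms(2) by (simp add: reduced_word_def)
  have "word ! (l - 1) \<in> set word" using l by (intro nth_mem) auto
  then have i: "i \<le> n" using word by (auto simp: i_def)
  have u: "u permutes {..<n}"
    unfolding u_def by (rule weyl_word_permutes) (use word set_take_subset[of l word] in blast)
  have J: "u r < n" if "r < i" for r using permutes_in_image[OF u, of r] that i by simp
  let ?z = "weyl_lift n (longest n) :: 'k mat"
  obtain \<epsilon> where z: "signed_perm n (reversal n) \<epsilon> ?z"
    using weyl_lift_signed_perm[OF reversal_permutes] by (auto simp: longest_eq_reversal)
  have zS: "?z \<in> carrier (SL n)" using z by (simp add: signed_perm_def)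
  obtain \<kappa> where "\<kappa> \<noteq> 0 \<and> (\<forall>y\<in>carrier_mat n n. triple_det n i u ?z (?z * ?z) (y * (?z * ?z)) =
      \<kappa> * det (mat i i (\<lambda>(r, s). y $$ (u r, s))))"
    using triple_det_value[OF z J i] ..
  then have \<kappa>: "\<kappa> \<noteq> 0" "\<forall>y\<in>carrier_mat n n. triple_det n i u ?z (?z * ?z) (y * (?z * ?z)) =
      \<kappa> * det (mat i i (\<lambda>(r, s). y $$ (u r, s)))" by simp_all
  obtain \<kappa>' where \<kappa>': "\<forall>y\<in>carrier (SL n).
      (gen_minor n u id i y :: 'k) = \<kappa>' * det (mat i i (\<lambda>(r, s). y $$ (u r, s)))"
    using gen_minor_eq_minor[OF n i u] by blast
  define F where "F x1 x2 x3 = \<kappa>' / \<kappa> * triple_det n i u x1 x2 x3" for x1 x2 x3 :: "'k mat"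
  let ?ks1 = "map (\<lambda>r. n - 1 - u r) [0..<i]" and ?ks2 = "map u [0..<i]"
  have "\<exists>f\<in>graded_piece n (list_weight ?ks1) (list_weight ?ks2) (list_weight [i]).
    \<forall>g1\<in>carrier (SL n). \<forall>g2\<in>carrier (SL n). \<forall>g3\<in>carrier (SL n).
      f (conf3 n g1 g2 g3) = F (g1 * ?z) (g2 * ?z) (g3 * ?z)"
  proof (rule graded_piece_realization[OF n _ _ _ z])
    show "(\<lambda>x1. F x1 x2 x3) \<in> orbit_funs n ?ks1" for x2 x3
      unfolding F_def by (rule orbit_funs_scale[OF triple_det_orbit1[OF J]])
    show "(\<lambda>x2. F x1 x2 x3) \<in> orbit_funs n ?ks2" for x1 x3
      unfolding F_def by (rule orbit_funs_scale[OF triple_det_orbit2[OF J]])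
    show "(\<lambda>x3. F x1 x2 x3) \<in> orbit_funs n [i]" for x1 x2
      unfolding F_def by (rule orbit_funs_scale[OF triple_det_orbit3[OF J]])
    show "F (h * x1) (h * x2) (h * x3) = F x1 x2 x3"
      if "h \<in> carrier (SL n)" "x1 \<in> carrier (SL n)" "x2 \<in> carrier (SL n)" "x3 \<in> carrier (SL n)" for h x1 x2 x3
      unfolding F_def using triple_det_invariant[OF that(1) that(2-4)[THEN SL_carrier_mat] i] by simp
  qed (use i J in \<open>auto simp: less_imp_le\<close>)
  then obtain f where f: "f \<in> graded_piece n (list_weight ?ks1) (list_weight ?ks2) (list_weight [i])"
    "\<forall>g1\<in>carrier (SL n). \<forall>g2\<in>carrier (SL n). \<forall>g3\<in>carrier (SL n).
      f (conf3 n g1 g2 g3) = F (g1 * ?z) (g2 * ?z) (g3 * ?z)" ..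
  have "f (Bminus_to_Conf3 n y) = gen_minor n u id i y" if y: "y \<in> Bminus n" for y
  proof -
    note yS = Bminus_SL[OF y]
    have "f (Bminus_to_Conf3 n y) = F (1\<^sub>m n * ?z) (?z * ?z) (y * ?z * ?z)"
      unfolding Bminus_to_Conf3_def SL_mult SL_one
      by (rule f(2)[rule_format, OF SL_one_closed zS SL_mult_closed[OF yS zS]])
    also have "\<dots> = \<kappa>' / \<kappa> * triple_det n i u ?z (?z * ?z) (y * (?z * ?z))"
      using SL_assoc[OF yS zS zS] SL_carrier_mat[OF zS] by (simp add: F_def)
    also have "\<dots> = gen_minor n u id i y"
      using \<kappa> \<kappa>' yS SL_carrier_mat[OF yS] by simp
    finally show ?thesis .
  qed
  then have result: "\<exists>f\<in>graded_piece n (list_weight ?ks1) (list_weight ?ks2) (list_weight [i]).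
      \<forall>y\<in>Bminus n. f (Bminus_to_Conf3 n y) = (gen_minor n u id i y :: 'k)"
    by (intro bexI[OF _ f(1)] ballI)
  show "\<exists>lam mu nu. dominant n lam \<and> dominant n mu \<and> dominant n nu \<and>
      (\<exists>f \<in> graded_piece n lam mu nu. \<forall>y \<in> Bminus n.
        f (Bminus_to_Conf3 n y) =
          (gen_minor n (weyl_word (take l word)) id (word ! (l - 1)) y :: 'k))"
    by (intro exI conjI, rule dominant_list_weight, rule dominant_list_weight,
        rule dominant_list_weight, rule result[unfolded u_def i_def])
qed

end
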